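(* Let $\mathscr C$ be a non-empty set of finite non-empty sets, let $\mathcal T=\mathcal T(\mathscr C)$ be the transformation category over $\mathscr C$ (all maps between members of $\mathscr C$), let $\xi$ be the least cardinal strictly greater than $|A|$ for every $A\in\mathscr C$, and let $I_r=\{\alpha\in\mathcal T:\operatorname{rank}(\alpha)\le r\}$ for $1\le r<\xi$, with $I_\omega=\mathcal T$ if $\xi=\omega$. (i) The minimal ideal $I_1$ is (isomorphic to) a partial rectangular band, so its congruences are precisely those corresponding to the relations $\sigma_{\mathcal E_1,\mathcal E_2}$ described in the context. In particular, there is a lattice isomorphism $\operatorname{Cong}(I_1)\cong\prod_{A\in\mathscr C}\mathfrak{Eq}(A)$. (ii) For $r\ge2$ (i.e. $2\le r<\xi$, and also $r=\omega$ if $\xi=\omega$), $$\operatorname{Cong}(I_r)=\{\Delta_{I_r}\}\cup\{R^{I_r}_{I_q,N^\natural}:1\le q<r,\ N\unlhd\mathcal S_{q+1}\}\cup\{\widetilde\nabla_{I_r}\},$$ and this is a chain under inclusion.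
   Context: **Transformation category.** Morphisms are triples $(A,\alpha,B)$ with $A,B\in\mathscr C$ and $\alpha:A\to B$ a function; $\mathbf d(A,\alpha,B)=A$, $\mathbf r(A,\alpha,B)=B$, and $(A,\alpha,B)(B,\beta,C)=(A,\alpha\beta,C)$, where $\alpha\beta$ means first $\alpha$, then $\beta$ (maps act on the right). $\operatorname{rank}(\alpha)=|\operatorname{im}(\alpha)|$. The $\mathscr J=\mathscr D$-classes of $\mathcal T$ are $D_q=\{\alpha:\operatorname{rank}(\alpha)=q\}$, $1\le q<\xi$. $\mathfrak{Eq}(A)$ is the lattice of equivalence relations on $A$; $\mathcal S_q$ is the symmetric group on $\{1,\ldots,q\}$. **The groups.** For each $1\le q<\xi$ fix $X_q\in\mathscr C$ with $n_q=|X_q|\ge q$ and write $X_q=\{x_1,\ldots,x_{n_q}\}$. For $\pi\in\mathcal S_q$ let $\pi^\natural:X_q\to X_q$ be given by $x_i\mapsto x_{i\pi}$ for $1\le i<q$ and $x_i\mapsto x_{q\pi}$ for $q\le i\le n_q$. For $N\subseteq\mathcal S_q$ put $N^\natural=\{\pi^\natural:\pi\in N\}$. Then $\mathcal S_q^\natural$ is a group $\mathscr H$-class contained in $D_q$. **Congruences.** For a partial semigroup (category without necessarily having identities) $S$ with domain/range maps $\mathbf d,\mathbf r$, write $x\sim y$ if $\mathbf d(x)=\mathbf d(y)$ and $\mathbf r(x)=\mathbf r(y)$. A congruence on $S$ is an equivalence $\sigma$ such that $(x,y)\in\sigma$ implies $x\sim y$, and $\sigma$ is compatible with all defined left and right multiplications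 by elements of $S$. $\operatorname{Cong}(S)$ is the lattice of congruences under inclusion. $\Delta_S$ is equality, $\widetilde\nabla_S=\{(x,y):x\sim y\}$. For an ideal $I$ of $S$ (non-empty, closed under defined multiplication by elements of $S$ on either side), $R_I^S=\widetilde\nabla_I\cup\Delta_S$. For $N$ a normal subgroup of a group $\mathscr H$-class contained in a $\mathscr J$-class $D$ of $S$ that is minimal among the $\mathscr J$-classes in $S\setminus I$ (all $\mathscr J$-classes here being regular and stable), $\nu_N=\{(axb,ayb):x,y\in N,\ a,b\in S^1,\ axb,ayb\in D\}$ and $R^S_{I,N}=R_I^S\cup\nu_N$; here $S^1$ is $S$ with identities adjoined at objects where needed. **Partial rectangular bands.** Given non-empty sets $X_A,Y_A$ ($A\in\mathscr C$), the $X_A$ pairwise disjoint and the $Y_A$ pairwise disjoint, the partial rectangular band is $\bigcup_{A,B\in\mathscr C}X_A\times Y_B$ with $\mathbf d(x,y)=A$, $\mathbf r(x,y)=B$ for $x\in X_A,y\in Y_B$, and $(x_1,y_1)(x_2,y_2)=(x_1,y_2)$ when $\mathbf r(x_1,y_1)=\mathbf d(x_2,y_2)$. For tuples $\mathcal E_1=(\varepsilon^A_1)_A$, $\mathcal E_2=(\varepsilon_2^A)_A$ with $\varepsilon_1^A\in\mathfrak{Eq}(X_A)$, $\varepsilon_2^A\in\mathfrak{Eq}(Y_A)$, $\sigma_{\mathcal E_1,\mathcal E_2}$ relates $(x_1,y_1)$ and $(x_2,y_2)$ iff both lie in a common $X_A\times Y_B$ and $(x_1,x_2)\in\varepsilon_1^A$,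 $(y_1,y_2)\in\varepsilon_2^B$. Isomorphisms are over $\mathscr C$ (preserving $\mathbf d$, $\mathbf r$). *)

theory Defs
  imports
    "HOL-Algebra.Sym_Groups"
    "HOL-Algebra.Lattice"
    "HOL-Library.FuncSet"
    "HOL-Library.Extended_Nat"
begin

section \<open>Partial semigroups\<close>

text \<open>
  Products are written in the order of the diagram: \<open>x \<cdot>\<^bsub>S\<^esub> y\<close> is meaningful when
  the range of \<open>x\<close> is the domain of \<open>y\<close>.
\<close>

record ('o, 'm) psg = "'m partial_object" +
  objs :: "'o set"
  dm :: "'m \<Rightarrow> 'o"
  rg :: "'m \<Rightarrow> 'o"
  pmult :: "'m \<Rightarrow> 'm \<Rightarrow> 'm" (infixl "\<cdot>\<index>" 70)

locale partial_semigroup =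
  fixes S :: "('o, 'm) psg" (structure)
  assumes dm_closed: "x \<in> carrier S \<Longrightarrow> dm S x \<in> objs S"
    and rg_closed: "x \<in> carrier S \<Longrightarrow> rg S x \<in> objs S"
    and mult_closed:
      "\<lbrakk>x \<in> carrier S; y \<in> carrier S; rg S x = dm S y\<rbrakk> \<Longrightarrow> x \<cdot> y \<in> carrier S"
    and dm_mult:
      "\<lbrakk>x \<in> carrier S; y \<in> carrier S; rg S x = dm S y\<rbrakk> \<Longrightarrow> dm S (x \<cdot> y) = dm S x"
    and rg_mult:
      "\<lbrakk>x \<in> carrier S; y \<in> carrier S; rg S x = dm S y\<rbrakk> \<Longrightarrow> rg S (x \<cdot> y) = rg S y"
    and assoc:
      "\<lbrakk>x \<in> carrier S; y \<in> carrier S; z \<in> carrier S; rg S x = dm S y; rg S y = dm S z\<rbrakk>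
        \<Longrightarrow> (x \<cdot> y) \<cdot> z = x \<cdot> (y \<cdot> z)"

definition psg_iso :: "('o, 'm) psg \<Rightarrow> ('o, 'n) psg \<Rightarrow> ('m \<Rightarrow> 'n) \<Rightarrow> bool" where
  "psg_iso S T \<phi> \<longleftrightarrow>
     objs S = objs T \<and> bij_betw \<phi> (carrier S) (carrier T) \<and>
     (\<forall>x\<in>carrier S. dm T (\<phi> x) = dm S x \<and> rg T (\<phi> x) = rg S x) \<and>
     (\<forall>x\<in>carrier S. \<forall>y\<in>carrier S. rg S x = dm S y \<longrightarrow> \<phi> (x \<cdot>\<^bsub>S\<^esub> y) = \<phi> x \<cdot>\<^bsub>T\<^esub> \<phi> y)"

definition psg_ideal :: "('o, 'm) psg \<Rightarrow> 'm set \<Rightarrow> bool" where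
  "psg_ideal S I \<longleftrightarrow>
     I \<subseteq> carrier S \<and> I \<noteq> {} \<and>
     (\<forall>x\<in>I. \<forall>a\<in>carrier S.
        (rg S a = dm S x \<longrightarrow> a \<cdot>\<^bsub>S\<^esub> x \<in> I) \<and> (rg S x = dm S a \<longrightarrow> x \<cdot>\<^bsub>S\<^esub> a \<in> I))"

definition has_identity :: "('o, 'm) psg \<Rightarrow> 'o \<Rightarrow> bool" where
  "has_identity S A \<longleftrightarrow>
     (\<exists>e\<in>carrier S. dm S e = A \<and> rg S e = A \<and>
        (\<forall>x\<in>carrier S. (dm S x = A \<longrightarrow> e \<cdot>\<^bsub>S\<^esub> x = x) \<and> (rg S x = A \<longrightarrow> x \<cdot>\<^bsub>S\<^esub> e = x)))"

text \<open>The partial semigroup \<open>S\<^sup>1\<close>: \<open>Inl x\<close> is the element \<open>x\<close> of \<open>S\<close>, and \<open>Inr A\<close> is a new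
  identity at the object \<open>A\<close>, present only if \<open>S\<close> has no identity at \<open>A\<close>.\<close>

definition adjoin_ids :: "('o, 'm) psg \<Rightarrow> ('o, 'm + 'o) psg" where
  "adjoin_ids S =
     \<lparr>carrier = Inl ` carrier S \<union> Inr ` {A \<in> objs S. \<not> has_identity S A},
      objs = objs S,
      dm = case_sum (dm S) (\<lambda>A. A),
      rg = case_sum (rg S) (\<lambda>A. A),
      pmult = (\<lambda>a b. case a of
          Inl x \<Rightarrow> (case b of Inl y \<Rightarrow> Inl (x \<cdot>\<^bsub>S\<^esub> y) | Inr _ \<Rightarrow> Inl x)
        | Inr _ \<Rightarrow> b)\<rparr>"

text \<open>\<open>two_sided S a x b z\<close>: the product \<open>a x b\<close>, with \<open>a, b\<close> in \<open>S\<^sup>1\<close>, is defined and equals \<open>z\<close>.\<close>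

definition two_sided :: "('o, 'm) psg \<Rightarrow> 'm + 'o \<Rightarrow> 'm \<Rightarrow> 'm + 'o \<Rightarrow> 'm \<Rightarrow> bool" where
  "two_sided S a x b z \<longleftrightarrow>
     rg (adjoin_ids S) a = dm S x \<and> rg S x = dm (adjoin_ids S) b \<and>
     a \<cdot>\<^bsub>adjoin_ids S\<^esub> Inl x \<cdot>\<^bsub>adjoin_ids S\<^esub> b = Inl z"

definition principal_ideal :: "('o, 'm) psg \<Rightarrow> 'm \<Rightarrow> 'm set" where
  "principal_ideal S x =
     {z. \<exists>a\<in>carrier (adjoin_ids S). \<exists>b\<in>carrier (adjoin_ids S). two_sided S a x b z}"

definition J_class :: "('o, 'm) psg \<Rightarrow> 'm \<Rightarrow> 'm set" where
  "J_class S x = {z \<in> carrier S. principal_ideal S z = principal_ideal S x}"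


section \<open>Congruences\<close>

definition psg_sim :: "('o, 'm) psg \<Rightarrow> 'm \<Rightarrow> 'm \<Rightarrow> bool" where
  "psg_sim S x y \<longleftrightarrow> dm S x = dm S y \<and> rg S x = rg S y"

definition Cong :: "('o, 'm) psg \<Rightarrow> 'm rel set" where
  "Cong S =
     {\<sigma>. equiv (carrier S) \<sigma> \<and>
        (\<forall>(x, y)\<in>\<sigma>. psg_sim S x y \<and>
           (\<forall>a\<in>carrier S.
              (rg S a = dm S x \<longrightarrow> (a \<cdot>\<^bsub>S\<^esub> x, a \<cdot>\<^bsub>S\<^esub> y) \<in> \<sigma>) \<and>
              (rg S x = dm S a \<longrightarrow> (x \<cdot>\<^bsub>S\<^esub> a, y \<cdot>\<^bsub>S\<^esub> a) \<in> \<sigma>)))}"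

definition Delta :: "('o, 'm) psg \<Rightarrow> 'm rel" where
  "Delta S = Id_on (carrier S)"

definition Nabla :: "('o, 'm) psg \<Rightarrow> 'm rel" where
  "Nabla S = {(x, y). x \<in> carrier S \<and> y \<in> carrier S \<and> psg_sim S x y}"

definition Rees :: "('o, 'm) psg \<Rightarrow> 'm set \<Rightarrow> 'm rel" where
  "Rees S I = Nabla (S\<lparr>carrier := I\<rparr>) \<union> Delta S"

text \<open>Here \<open>N\<close> is meant to lie in a single \<open>\<J>\<close>-class of \<open>S\<close>, and the union over \<open>N\<close> below is
  that class, called \<open>D\<close> in the usual description of this relation.\<close>

definition nu :: "('o, 'm) psg \<Rightarrow> 'm set \<Rightarrow> 'm rel" where
  "nu S N =
     {(u, v). \<exists>x\<in>N. \<exists>y\<in>N. \<exists>a\<in>carrier (adjoin_ids S). \<exists>b\<in>carrier (adjoin_ids S).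
        two_sided S a x b u \<and> two_sided S a y b v \<and>
        u \<in> (\<Union>n\<in>N. J_class S n) \<and> v \<in> (\<Union>n\<in>N. J_class S n)}"

definition Rees_normal :: "('o, 'm) psg \<Rightarrow> 'm set \<Rightarrow> 'm set \<Rightarrow> 'm rel" where
  "Rees_normal S I N = Rees S I \<union> nu S N"


section \<open>Lattices\<close>

definition Cong_lattice :: "('o, 'm) psg \<Rightarrow> 'm rel gorder" where
  "Cong_lattice S = \<lparr>carrier = Cong S, eq = (=), le = (\<subseteq>)\<rparr>"

definition Eq_lattice :: "'b set \<Rightarrow> 'b rel gorder" where
  "Eq_lattice A = \<lparr>carrier = {\<epsilon>. equiv A \<epsilon>}, eq = (=), le = (\<subseteq>)\<rparr>"

definition prod_lattice :: "'i set \<Rightarrow> ('i \<Rightarrow> 'b gorder) \<Rightarrow> ('i \<Rightarrow> 'b) gorder" where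
  "prod_lattice K L =
     \<lparr>carrier = (\<Pi>\<^sub>E i\<in>K. carrier (L i)), eq = (=),
      le = (\<lambda>f g. \<forall>i\<in>K. f i \<sqsubseteq>\<^bsub>L i\<^esub> g i)\<rparr>"

text \<open>Both \<^const>\<open>join_pres\<close> and \<^const>\<open>meet_pres\<close> include that the two structures are lattices.\<close>

definition lattice_iso :: "'b gorder \<Rightarrow> 'c gorder \<Rightarrow> ('b \<Rightarrow> 'c) \<Rightarrow> bool" where
  "lattice_iso L M f \<longleftrightarrow>
     bij_betw f (carrier L) (carrier M) \<and> join_pres L M f \<and> meet_pres L M f"


section \<open>Partial rectangular bands\<close>

definition band_data :: "'o set \<Rightarrow> ('o \<Rightarrow> 'x set) \<Rightarrow> ('o \<Rightarrow> 'y set) \<Rightarrow> bool" where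
  "band_data \<C> X Y \<longleftrightarrow>
     (\<forall>A\<in>\<C>. X A \<noteq> {} \<and> Y A \<noteq> {}) \<and> disjoint_family_on X \<C> \<and> disjoint_family_on Y \<C>"

definition partial_rect_band ::
    "'o set \<Rightarrow> ('o \<Rightarrow> 'x set) \<Rightarrow> ('o \<Rightarrow> 'y set) \<Rightarrow> ('o, 'x \<times> 'y) psg" where
  "partial_rect_band \<C> X Y =
     \<lparr>carrier = (\<Union>A\<in>\<C>. \<Union>B\<in>\<C>. X A \<times> Y B),
      objs = \<C>,
      dm = (\<lambda>(x, y). THE A. A \<in> \<C> \<and> x \<in> X A),
      rg = (\<lambda>(x, y). THE B. B \<in> \<C> \<and> y \<in> Y B),
      pmult = (\<lambda>(x1, y1) (x2, y2). (x1, y2))\<rparr>"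

definition band_cong ::
    "'o set \<Rightarrow> ('o \<Rightarrow> 'x set) \<Rightarrow> ('o \<Rightarrow> 'y set) \<Rightarrow> ('o \<Rightarrow> 'x rel) \<Rightarrow> ('o \<Rightarrow> 'y rel)
      \<Rightarrow> ('x \<times> 'y) rel" where
  "band_cong \<C> X Y E1 E2 =
     {((x1, y1), (x2, y2)). \<exists>A\<in>\<C>. \<exists>B\<in>\<C>.
        (x1, y1) \<in> X A \<times> Y B \<and> (x2, y2) \<in> X A \<times> Y B \<and>
        (x1, x2) \<in> E1 A \<and> (y1, y2) \<in> E2 B}"


section \<open>The transformation category\<close>

text \<open>A function \<open>A \<rightarrow> B\<close> is represented extensionally, i.e. with the value \<^const>\<open>undefined\<close>
  outside \<open>A\<close>, so that equality of triples is equality of morphisms.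
  Note that \<^const>\<open>compose\<close> takes the map applied last as its first map.\<close>

type_synonym 'a morph = "'a set \<times> ('a \<Rightarrow> 'a) \<times> 'a set"

definition trans_cat :: "'a set set \<Rightarrow> ('a set, 'a morph) psg" where
  "trans_cat \<C> =
     \<lparr>carrier = {(A, \<alpha>, B). A \<in> \<C> \<and> B \<in> \<C> \<and> \<alpha> \<in> A \<rightarrow>\<^sub>E B},
      objs = \<C>,
      dm = (\<lambda>(A, \<alpha>, B). A),
      rg = (\<lambda>(A, \<alpha>, B). B),
      pmult = (\<lambda>(A, \<alpha>, B) (B', \<beta>, C). (A, compose A \<beta> \<alpha>, C))\<rparr>"

definition rank :: "'a morph \<Rightarrow> nat" where
  "rank = (\<lambda>(A, \<alpha>, B). card (\<alpha> ` A))"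

text \<open>As all members of \<open>\<C>\<close> are finite, the cardinals that matter are those up to \<open>\<omega>\<close>,
  which are modelled by \<^typ>\<open>enat\<close> with \<open>\<omega> = \<infinity>\<close>.\<close>

definition xi :: "'a set set \<Rightarrow> enat" where
  "xi \<C> = (LEAST k. \<forall>A\<in>\<C>. enat (card A) < k)"

definition I_set :: "'a set set \<Rightarrow> enat \<Rightarrow> 'a morph set" where
  "I_set \<C> r = {m \<in> carrier (trans_cat \<C>). enat (rank m) \<le> r}"

definition I_psg :: "'a set set \<Rightarrow> enat \<Rightarrow> ('a set, 'a morph) psg" where
  "I_psg \<C> r = (trans_cat \<C>)\<lparr>carrier := I_set \<C> r\<rparr>"

text \<open>The map \<open>\<pi>\<^sup>\<natural>\<close> on \<open>X = {x 1, \<dots>, x n}\<close> for a permutation \<open>\<pi>\<close> of \<open>{1..q}\<close>, \<open>q \<le> n\<close>.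
  The group \<^term>\<open>sym_group q\<close> composes permutations from right to left while here maps act
  on the right; this passes to the opposite group and does not affect which subsets are normal
  subgroups.\<close>

definition natural :: "nat \<Rightarrow> 'a set \<Rightarrow> (nat \<Rightarrow> 'a) \<Rightarrow> (nat \<Rightarrow> nat) \<Rightarrow> 'a morph" where
  "natural q X x \<pi> =
     (X,
      \<lambda>v\<in>X. let i = inv_into {1..card X} x v in if i < q then x (\<pi> i) else x (\<pi> q),
      X)"


section \<open>Basic facts\<close>

lemma trans_cat_partial_semigroup: "partial_semigroup (trans_cat \<C>)"
  by unfold_locales
    (auto simp: trans_cat_def PiE_def Pi_def compose_def extensional_def fun_eq_iff)

lemma I_set_infinity: "I_set \<C> \<infinity> = carrier (trans_cat \<C>)"
  by (simp add: I_set_def)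

lemma band_dm:
  assumes "band_data \<C> X Y" "A \<in> \<C>" "x \<in> X A"
  shows "dm (partial_rect_band \<C> X Y) (x, y) = A"
  using assms unfolding partial_rect_band_def band_data_def disjoint_family_on_def
  by (simp, intro the_equality) blast+

lemma band_rg:
  assumes "band_data \<C> X Y" "B \<in> \<C>" "y \<in> Y B"
  shows "rg (partial_rect_band \<C> X Y) (x, y) = B"
  using assms unfolding partial_rect_band_def band_data_def disjoint_family_on_def
  by (simp, intro the_equality) blast+

lemma ideal_partial_semigroup:
  assumes "partial_semigroup S" "psg_ideal S I"
  shows "partial_semigroup (S\<lparr>carrier := I\<rparr>)"
proof -
  interpret partial_semigroup S by fact
  have I: "I \<subseteq> carrier S" using assms(2) by (simp add: psg_ideal_def)
  show ?thesis
  proof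
    show "x \<cdot>\<^bsub>S\<lparr>carrier := I\<rparr>\<^esub> y \<in> carrier (S\<lparr>carrier := I\<rparr>)"
      if "x \<in> carrier (S\<lparr>carrier := I\<rparr>)" "y \<in> carrier (S\<lparr>carrier := I\<rparr>)"
        "rg (S\<lparr>carrier := I\<rparr>) x = dm (S\<lparr>carrier := I\<rparr>) y" for x y
      using assms(2) that I by (auto simp: psg_ideal_def)
  qed (use I in \<open>auto simp: subset_iff dm_closed rg_closed dm_mult rg_mult assoc\<close>)
qed

lemma partial_rect_band_partial_semigroup:
  assumes "band_data \<C> X Y"
  shows "partial_semigroup (partial_rect_band \<C> X Y)"
proof -
  let ?S = "partial_rect_band \<C> X Y"
  have cE: "\<exists>A\<in>\<C>. \<exists>B\<in>\<C>. fst p \<in> X A \<and> snd p \<in> Y B \<and> dm ?S p = A \<and> rg ?S p = B"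
    if "p \<in> carrier ?S" for p
    using that band_dm[OF assms] band_rg[OF assms]
    by (cases p) (fastforce simp: partial_rect_band_def)
  have m: "p \<cdot>\<^bsub>?S\<^esub> p' = (fst p, snd p')" for p p'
    by (simp add: partial_rect_band_def split_beta)
  have c: "(u, v) \<in> carrier ?S" if "A \<in> \<C>" "B \<in> \<C>" "u \<in> X A" "v \<in> Y B" for u v A B
    using that by (auto simp: partial_rect_band_def)
  have o: "objs ?S = \<C>" by (simp add: partial_rect_band_def)
  show ?thesis
  proof
    fix p assume "p \<in> carrier ?S"
    then show "dm ?S p \<in> objs ?S" "rg ?S p \<in> objs ?S" using cE[of p] o by auto
  next
    fix p p' assume "p \<in> carrier ?S" "p' \<in> carrier ?S"
    then obtain A B' where "A \<in> \<C>" "fst p \<in> X A" "dm ?S p = A"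
      and "B' \<in> \<C>" "snd p' \<in> Y B'" "rg ?S p' = B'"
      using cE[of p] cE[of p'] by fast
    then show "p \<cdot>\<^bsub>?S\<^esub> p' \<in> carrier ?S"
      "dm ?S (p \<cdot>\<^bsub>?S\<^esub> p') = dm ?S p" "rg ?S (p \<cdot>\<^bsub>?S\<^esub> p') = rg ?S p'"
      using c band_dm[OF assms] band_rg[OF assms] by (simp_all add: m)
  qed (simp add: m)
qed

end

theory Submission
  imports Defs
begin

text \<open>
  A map of rank \<open>p\<close> factors as a surjection onto \<open>{1..p}\<close> followed by an injection, and pre- and
  postcomposition with maps of rank at most \<open>p\<close> turns any such factorisation into any other. Hence
  a congruence that relates a map of rank \<open>k\<close> to a map with a different kernel relates every map of
  rank between \<open>2\<close> and \<open>k\<close> to one of smaller rank, and it identifies the constant maps with the same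
  domain and range, so it collapses everything of rank at most \<open>k\<close>. A related pair with equal ranks
  and different images is reduced to this case by a retraction of the range; a related pair of
  distinct maps of rank \<open>k\<close> with the same kernel and image is reduced to it by merging two points of
  the image, and then everything of rank at most \<open>k - 1\<close> collapses. If \<open>q\<close> is the largest rank that
  collapses, the remaining non-trivial pairs have rank \<open>q + 1\<close> and differ by a permutation of
  \<open>{1..q + 1}\<close>; these permutations form a normal subgroup. The congruences form a chain because
  the normal subgroups of a finite symmetric group do: the only one besides the trivial subgroup,
  the alternating group and the whole group is Klein's four-group in degree \<open>4\<close>.
\<close>

section \<open>Normal subgroups of finite symmetric groups\<close>

text \<open>Multipliers must lie in \<open>I_set \<C> r\<close> themselves, so extensions and
  retractions are built with small images throughout. Separating two constants takes a multiplier
  with two values, hence the bound \<open>2 \<le> r\<close>. For \<open>r = 1\<close> only constant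
  multipliers are left; they never send two values to two different ones, and so any choice of an
  equivalence on each codomain gives a congruence. The relation \<open>nu\<close> depends on chosen
  sets, adjoined identities and J-classes. It is traded for a relation between maps
  \<open>t \<circ> s\<close> and \<open>t \<circ> \<pi> \<circ> s\<close>, where \<open>s\<close> is
  onto \<open>{1..p}\<close> and \<open>t\<close> is injective on it. Changing the factorisation
  conjugates \<pi>: this is where normality of the subgroup is used and where it comes from.\<close>

lemma permutes_extending_lists:
  assumes "finite S" "distinct xs" "distinct ys" "length xs = length ys"
    and "set xs \<subseteq> S" "set ys \<subseteq> S"
  obtains s where "s permutes S" "map s xs = ys"
proof -
  define f where "f = (\<lambda>x. the (map_of (zip xs ys) x))"
  have f: "map f xs = ys"
    by (rule nth_equalityI) (use assms in \<open>auto simp: f_def map_of_zip_nth\<close>)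
  then have fim: "f ` set xs = set ys" by (metis list.set_map)
  have "card (S - set xs) = card (S - set ys)"
    using assms by (simp add: card_Diff_subset distinct_card)
  then obtain g where g: "bij_betw g (S - set xs) (S - set ys)"
    using assms(1) using finite_same_card_bij[of "S - set xs" "S - set ys"] by auto
  have "bij_betw f (set xs) (set ys)"
    using fim assms by (simp add: bij_betw_def eq_card_imp_inj_on distinct_card)
  then have "bij_betw (\<lambda>x. if x \<in> set xs then f x else g x) (set xs \<union> (S - set xs)) (set ys \<union> (S - set ys))"
    using g by (intro bij_betw_disjoint_Un) auto
  moreover have "set xs \<union> (S - set xs) = S" "set ys \<union> (S - set ys) = S"
    using assms(5,6) by auto
  ultimately have "bij_betw (\<lambda>x. if x \<in> set xs then f x else g x) S S" by argo
  then have "bij_betw (\<lambda>x. if x \<in> S then if x \<in> set xs then f x else g x else x) S S"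
    by (rule bij_betw_cong[THEN iffD1, rotated]) simp
  then have "(\<lambda>x. if x \<in> S then if x \<in> set xs then f x else g x else x) permutes S"
    by (rule bij_imp_permutes) simp
  moreover have "map (\<lambda>x. if x \<in> S then if x \<in> set xs then f x else g x else x) xs = ys"
    using assms(5) by (subst f[symmetric]) (auto intro!: map_cong)
  ultimately show ?thesis by (rule that)
qed

lemma permutes_conj_transpose:
  assumes "s permutes S"
  shows "s \<circ> transpose a b \<circ> inv' s = transpose (s a) (s b)"
proof
  fix x
  have inj: "inj s" by (rule permutes_inj[OF assms])
  have "s (transpose a b y) = transpose (s a) (s b) (s y)" for y
    using inj by (auto simp: transpose_def dest: injD)
  from this[of "inv' s x"] show "(s \<circ> transpose a b \<circ> inv' s) x = transpose (s a) (s b) x"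
    by (simp add: permutes_inverses(1)[OF assms])
qed

section \<open>Commutators, three-cycles and fixed points in a normal subgroup\<close>

context
  fixes n :: nat and N :: "(nat \<Rightarrow> nat) set"
  assumes N: "N \<lhd> sym_group n"
begin

lemma normal_sym_subgroup: "subgroup N (sym_group n)"
  using N by (simp add: normal_def)

lemma normal_sym_permutes: "p \<in> N \<Longrightarrow> p permutes {1..n}"
  using subgroup.mem_carrier[OF normal_sym_subgroup] by (simp add: sym_group_carrier)

lemma normal_sym_id: "id \<in> N"
  using subgroup.one_closed[OF normal_sym_subgroup] by (simp add: sym_group_one)

lemma normal_sym_comp: "p \<in> N \<Longrightarrow> q \<in> N \<Longrightarrow> p \<circ> q \<in> N"
  using subgroup.m_closed[OF normal_sym_subgroup] by (simp add: sym_group_mult)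

lemma normal_sym_inv: "p \<in> N \<Longrightarrow> inv' p \<in> N"
  using subgroup.m_inv_closed[OF normal_sym_subgroup] normal_sym_permutes sym_group_inv_equality
  by (metis sym_group_carrier)

lemma normal_sym_conj:
  assumes "p \<in> N" "s permutes {1..n}"
  shows "s \<circ> p \<circ> inv' s \<in> N"
  using normal.inv_op_closed2[OF N, of s p] assms
  by (simp add: sym_group_carrier sym_group_mult)

text \<open>The element is the commutator of \<open>p\<close> with the transposition of
  \<open>a\<close> and \<open>b\<close>. Grouped one way it is \<open>p\<close> times a conjugate of
  its inverse, hence in \<open>N\<close>; grouped the other way it is a product of two
  transpositions. It moves at most \<open>a\<close>, \<open>b\<close>, \<open>p a\<close>,
  \<open>p b\<close>, which makes it a source of short cycles.\<close>

lemma normal_sym_commutator: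
  assumes p: "p \<in> N" and ab: "a \<in> {1..n}" "b \<in> {1..n}"
  shows "transpose (p a) (p b) \<circ> transpose a b \<in> N"
proof -
  have t: "transpose a b permutes {1..n}" by (rule permutes_swap_id[OF ab])
  have "p \<circ> (transpose a b \<circ> inv' p \<circ> inv' (transpose a b)) \<in> N"
    by (intro normal_sym_comp p normal_sym_conj normal_sym_inv t)
  also have "p \<circ> (transpose a b \<circ> inv' p \<circ> inv' (transpose a b))
      = (p \<circ> transpose a b \<circ> inv' p) \<circ> transpose a b"
    by (simp add: comp_assoc)
  finally show ?thesis
    unfolding permutes_conj_transpose[OF normal_sym_permutes[OF p]] .
qed

text \<open>The given product is a three-cycle. A permutation carrying \<open>[a, b, c]\<close> to
  the entries of another three-cycle conjugates one into the other, and the three-cycles generate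
  the alternating group.\<close>

lemma alt_le_normal_sym_if_three_cycle:
  assumes abc: "{a, b, c} \<subseteq> {1..n}" "distinct [a, b, c]"
    and mem: "transpose a b \<circ> transpose b c \<in> N"
  shows "carrier (alt_group n) \<subseteq> N"
proof -
  have cyc: "p \<in> N" if "p \<in> three_cycles n" for p
  proof -
    from that obtain cs where cs: "p = cycle_of_list cs" "distinct cs" "length cs = 3" "set cs \<subseteq> {1..n}"
      by auto
    then obtain a' b' c' where cs': "cs = [a', b', c']" using stupid_lemma by blast
    obtain s where s: "s permutes {1..n}" "map s [a, b, c] = [a', b', c']"
      using permutes_extending_lists[of "{1..n}" "[a, b, c]" "[a', b', c']"] abc cs cs' by auto
    have "s \<circ> (transpose a b \<circ> transpose b c) \<circ> inv' s
        = (s \<circ> transpose a b \<circ> inv' s) \<circ> (s \<circ> transpose b c \<circ> inv' s)"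
      using permutes_inverses(2)[OF s(1)] by (simp add: fun_eq_iff)
    also have "\<dots> = p"
      using s cs(1) cs' by (simp add: permutes_conj_transpose)
    finally show ?thesis using normal_sym_conj[OF mem s(1)] by simp
  qed
  show ?thesis
  proof
    fix p assume "p \<in> carrier (alt_group n)"
    then have "p \<in> generate (alt_group n) (three_cycles n)"
      using alt_group_carrier_as_three_cycles by simp
    then show "p \<in> N"
    proof (induction rule: generate.induct)
      case one
      then show ?case using normal_sym_id unfolding alt_group_one .
    next
      case (incl h)
      then show ?case by (rule cyc)
    next
      case (inv h)
      then have "h \<in> carrier (alt_group n)" using three_cycles_incl by blast
      then show ?case using normal_sym_inv[OF cyc[OF inv]] by (simp add: alt_group_inv_equality)
    next
      case (eng h1 h2)
      then show ?case unfolding alt_group_mult by (intro normal_sym_comp)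
    qed
  qed
qed

text \<open>As \<open>p f = f\<close>, the commutator of \<open>p\<close> with the transposition of
  \<open>c\<close> and \<open>f\<close> is a product of two transpositions sharing the point
  \<open>f\<close>, that is, a three-cycle on \<open>p c\<close>, \<open>f\<close>,
  \<open>c\<close>.\<close>

lemma alt_le_normal_sym_if_fixpoint:
  assumes p: "p \<in> N" and cf: "c \<in> {1..n}" "f \<in> {1..n}" "p c \<noteq> c" "p f = f"
  shows "carrier (alt_group n) \<subseteq> N"
proof (rule alt_le_normal_sym_if_three_cycle)
  have pp: "p permutes {1..n}" by (rule normal_sym_permutes[OF p])
  show "{p c, f, c} \<subseteq> {1..n}" using cf permutes_in_image[OF pp] by auto
  show "distinct [p c, f, c]" using cf permutes_inj[OF pp] by (auto dest: injD)
  show "transpose (p c) f \<circ> transpose f c \<in> N"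
    using normal_sym_commutator[OF p cf(1,2)] cf(4) by (simp add: transpose_commute)
qed

text \<open>A fixed point of \<open>p\<close> would put a three-cycle into \<open>N\<close>; so
  would a point with \<open>p (p x) \<noteq> x\<close>, through the commutator with the
  transposition of \<open>x\<close> and \<open>p x\<close>. For \<open>d\<close> outside the orbit
  of \<open>c\<close>, the commutator with the transposition of \<open>c\<close> and
  \<open>d\<close> moves only \<open>c\<close>, \<open>p c\<close>, \<open>d\<close>,
  \<open>p d\<close>, so a fifth point would be fixed by a non-identity element of
  \<open>N\<close>.\<close>

lemma alt_le_normal_sym_or_involution:
  assumes p: "p \<in> N" "p \<noteq> id" and not: "\<not> carrier (alt_group n) \<subseteq> N"
  shows "n = 4 \<and> (\<forall>x\<in>{1..n}. p x \<noteq> x \<and> p (p x) = x)"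
proof -
  have pp: "p permutes {1..n}" by (rule normal_sym_permutes[OF p(1)])
  have pin: "p x \<in> {1..n} \<longleftrightarrow> x \<in> {1..n}" for x by (rule permutes_in_image[OF pp])
  obtain c where c: "p c \<noteq> c" using p(2) by (auto simp: fun_eq_iff)
  then have cin: "c \<in> {1..n}" using permutes_not_in[OF pp] by auto
  have nofix: "p x \<noteq> x" if "x \<in> {1..n}" for x
    using alt_le_normal_sym_if_fixpoint[OF p(1) cin that c] not by auto
  have invol: "p (p x) = x" if "x \<in> {1..n}" for x
  proof (rule ccontr)
    assume ne: "p (p x) \<noteq> x"
    have "carrier (alt_group n) \<subseteq> N"
    proof (rule alt_le_normal_sym_if_three_cycle)
      show "{p (p x), p x, x} \<subseteq> {1..n}" using that pin by auto
      show "distinct [p (p x), p x, x]" using that pin nofix[of x] nofix[of "p x"] ne by auto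
      show "transpose (p (p x)) (p x) \<circ> transpose (p x) x \<in> N"
        using normal_sym_commutator[OF p(1), of x "p x"] that pin by (simp add: transpose_commute)
    qed
    with not show False by simp
  qed
  \<comment> \<open>For \<open>n \<le> 2\<close> the only even permutation is the identity, so the
    alternating group would lie in \<open>N\<close>. Larger \<open>n\<close> guarantees a point
    outside the orbit of \<open>c\<close>.\<close>
  have small: False if "n \<le> 2"
  proof -
    have "{1..n} \<subseteq> {1, 2}" using that by auto
    then have "q = id" if "q \<in> carrier (alt_group n)" for q
    proof -
      have "q permutes {1, 2}" "evenperm q"
        using that permutes_subset \<open>{1..n} \<subseteq> {1, 2}\<close> unfolding alt_group_carrier by blast+
      then show ?thesis
        unfolding permutes_doubleton_iff using evenperm_swap[of 1 "2::nat"] by auto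
    qed
    then show False using not normal_sym_id by blast
  qed
  have "\<exists>d. d \<in> {1..n} - {c, p c}"
  proof (rule ccontr)
    assume "\<not> ?thesis"
    then have "card {1..n} \<le> card {c, p c}" by (intro card_mono) auto
    also have "\<dots> \<le> 2" by (simp add: card_insert_if)
    finally show False using small by simp
  qed
  then obtain d where d: "d \<in> {1..n}" "d \<noteq> c" "d \<noteq> p c" by auto
  have dist: "distinct [c, p c, d, p d]"
    using d c nofix[OF d(1)] invol[OF cin] invol[OF d(1)] by auto
  have le4: "{1..n} \<subseteq> {c, p c, d, p d}"
  proof (rule ccontr)
    assume "\<not> ?thesis"
    then obtain f where f: "f \<in> {1..n}" "f \<notin> {c, p c, d, p d}" by blast
    have "carrier (alt_group n) \<subseteq> N"
    proof (rule alt_le_normal_sym_if_fixpoint)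
      show "transpose (p c) (p d) \<circ> transpose c d \<in> N"
        by (rule normal_sym_commutator[OF p(1) cin d(1)])
      show "(transpose (p c) (p d) \<circ> transpose c d) f = f"
        using f by (simp add: transpose_def)
      show "(transpose (p c) (p d) \<circ> transpose c d) c \<noteq> c"
        using dist by (simp add: transpose_def)
    qed (use f cin in auto)
    with not show False by simp
  qed
  have "{1..n} = {c, p c, d, p d}" using le4 cin d pin by auto
  then have "card {1..n} = 4" using dist by simp
  then show ?thesis using nofix invol by simp
qed

end

text \<open>The orbits of 1 and of any \<open>d\<close> outside \<open>{1, p 1}\<close> are disjoint
  pairs that fill the four points. The normal form serves twice: such a \<open>p\<close> is even,
  and any two of them are conjugate.\<close>

lemma fixpoint_free_involution_4:
  assumes p: "p permutes {1..4::nat}" and inv: "\<forall>x\<in>{1..4}. p x \<noteq> x \<and> p (p x) = x"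
  obtains a b c d where "distinct [a, b, c, d]" "{a, b, c, d} = {1..4}"
    "p = transpose a b \<circ> transpose c d"
proof -
  have pin: "p x \<in> {1..4} \<longleftrightarrow> x \<in> {1..4}" for x by (rule permutes_in_image[OF p])
  have "\<exists>d. d \<in> {1..4::nat} - {1, p 1}"
  proof (rule ccontr)
    assume "\<not> ?thesis"
    then have "card {1..4::nat} \<le> card {1, p 1}" by (intro card_mono) auto
    also have "\<dots> \<le> 2" by (simp add: card_insert_if)
    finally show False by simp
  qed
  then obtain d where d: "d \<in> {1..4}" "d \<noteq> 1" "d \<noteq> p 1" by auto
  have one: "p 1 \<noteq> 1" "p (p 1) = 1" using inv by auto
  have dd: "p d \<noteq> d" "p (p d) = d" using inv d by auto
  have dist: "distinct [1, p 1, d, p d]"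
    using d one dd by auto
  have "{1, p 1, d, p d} \<subseteq> {1..4}" using d pin[of 1] pin[of d] by auto
  moreover have "card {1, p 1, d, p d} = card {1..4::nat}" using dist by simp
  ultimately have eq: "{1, p 1, d, p d} = {1..4}" by (intro card_subset_eq) auto
  have "p = transpose 1 (p 1) \<circ> transpose d (p d)"
  proof
    fix x
    show "p x = (transpose 1 (p 1) \<circ> transpose d (p d)) x"
    proof (cases "x \<in> {1..4}")
      case True
      then have "x \<in> {1, p 1, d, p d}" using eq by simp
      then show ?thesis using dist one dd by (auto simp: transpose_def)
    next
      case False
      then have "x \<notin> {1, p 1, d, p d}" "p x = x" using eq permutes_not_in[OF p] by auto
      then show ?thesis by (simp add: transpose_def)
    qed
  qed
  then show ?thesis using dist eq that by blast
qed

text \<open>No list of normal subgroups is drawn up. One that contains the alternating group is that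
  group or everything, because the alternating group has index at most 2 (\<open>full\<close>); any
  other one lies inside it (\<open>sub\<close>), since its non-identity elements are products of two
  disjoint transpositions. Two of the latter kind are compared by conjugacy: as soon as
  \<open>M\<close> has a non-identity element, the conjugates of that element include all
  non-identity elements of \<open>N\<close>.\<close>

lemma normal_subgroups_sym_group_chain:
  assumes N: "N \<lhd> sym_group n" and M: "M \<lhd> sym_group n"
  shows "N \<subseteq> M \<or> M \<subseteq> N"
proof -
  let ?A = "carrier (alt_group n)"
  have full: "p \<in> K" if K: "K \<lhd> sym_group n" "?A \<subseteq> K" "q \<in> K" "q \<notin> ?A" and p: "p permutes {1..n}"
    for K p q
  proof (cases "evenperm p")
    case True
    then show ?thesis using K p by (auto simp: alt_group_carrier)
  next
    case False
    have q: "q permutes {1..n}" by (rule normal_sym_permutes[OF K(1,3)])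
    then have qo: "\<not> evenperm q" using K(4) by (simp add: alt_group_carrier)
    have perm: "permutation p" "permutation q" "permutation (inv' q)"
      using p q permutes_inv[OF q] by (auto simp: permutation_permutes)
    have "p \<circ> inv' q \<in> ?A"
      using p q qo False perm
      by (simp add: alt_group_carrier evenperm_comp evenperm_inv permutes_compose permutes_inv)
    then have "(p \<circ> inv' q) \<circ> q \<in> K" by (rule normal_sym_comp[OF K(1) subsetD[OF K(2)] K(3)])
    moreover have "(p \<circ> inv' q) \<circ> q = p"
      using permutes_inverses(2)[OF q] by (simp add: fun_eq_iff)
    ultimately show ?thesis by simp
  qed
  have sub: "K \<subseteq> ?A" if K: "K \<lhd> sym_group n" "\<not> ?A \<subseteq> K" for K
  proof
    fix p assume p: "p \<in> K"
    have pp: "p permutes {1..n}" by (rule normal_sym_permutes[OF K(1) p])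
    show "p \<in> ?A"
    proof (cases "p = id")
      case False
      then have n: "n = 4" and inv: "\<forall>x\<in>{1..n}. p x \<noteq> x \<and> p (p x) = x"
        using alt_le_normal_sym_or_involution[OF K(1) p False K(2)] by auto
      obtain a b c d where "distinct [a, b, c, d]" "p = transpose a b \<circ> transpose c d"
        using fixpoint_free_involution_4[of p] pp inv n by metis
      then have "evenperm p"
        by (simp add: evenperm_comp evenperm_swap permutation_swap_id)
      then show ?thesis using pp by (simp add: alt_group_carrier)
    qed (simp add: alt_group_carrier permutes_id)
  qed
  have one_way: "K \<subseteq> L \<or> L \<subseteq> K"
    if K: "K \<lhd> sym_group n" "?A \<subseteq> K" and L: "L \<lhd> sym_group n" for K L
  proof (cases "?A \<subseteq> L")
    case True
    show ?thesis
    proof (cases "L \<subseteq> ?A")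
      case False
      then show ?thesis using full[OF L True] normal_sym_permutes[OF K(1)] by blast
    qed (use K in blast)
  next
    case False
    then show ?thesis using sub[OF L] K by blast
  qed
  show ?thesis
  proof (cases "?A \<subseteq> N \<or> ?A \<subseteq> M")
    case True
    then show ?thesis using one_way[OF N _ M] one_way[OF M _ N] by blast
  next
    case False
    then have nN: "\<not> ?A \<subseteq> N" and nM: "\<not> ?A \<subseteq> M" by auto
    show ?thesis
    proof (cases "M \<subseteq> {id}")
      case True
      then show ?thesis using normal_sym_id[OF N] by auto
    next
      case False
      then obtain m where m: "m \<in> M" "m \<noteq> id" by auto
      have n: "n = 4" and minv: "\<forall>x\<in>{1..n}. m x \<noteq> x \<and> m (m x) = x"
        using alt_le_normal_sym_or_involution[OF M m nM] by auto
      obtain a b c d where m': "distinct [a, b, c, d]" "{a, b, c, d} = {1..4}"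
          "m = transpose a b \<circ> transpose c d"
        using fixpoint_free_involution_4[of m] normal_sym_permutes[OF M m(1)] minv n by metis
      have "N \<subseteq> M"
      proof
        fix p assume p: "p \<in> N"
        show "p \<in> M"
        proof (cases "p = id")
          case True
          then show ?thesis using normal_sym_id[OF M] by simp
        next
          case False
          have pinv: "\<forall>x\<in>{1..n}. p x \<noteq> x \<and> p (p x) = x"
            using alt_le_normal_sym_or_involution[OF N p False nN] by auto
          obtain a' b' c' d' where p': "distinct [a', b', c', d']" "{a', b', c', d'} = {1..4}"
              "p = transpose a' b' \<circ> transpose c' d'"
            using fixpoint_free_involution_4[of p] normal_sym_permutes[OF N p] pinv n by metis
          obtain s where s: "s permutes {1..4}" "map s [a, b, c, d] = [a', b', c', d']"
            using permutes_extending_lists[of "{1..4}" "[a, b, c, d]" "[a', b', c', d']"] m'(1,2) p'(1,2)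
            by auto
          have "s \<circ> m \<circ> inv' s = (s \<circ> transpose a b \<circ> inv' s) \<circ> (s \<circ> transpose c d \<circ> inv' s)"
            using permutes_inverses(2)[OF s(1)] m'(3) by (simp add: fun_eq_iff)
          also have "\<dots> = p"
            using s p'(3) by (simp add: permutes_conj_transpose)
          finally show ?thesis using normal_sym_conj[OF M m(1), of s] s(1) unfolding n by simp
        qed
      qed
      then show ?thesis ..
    qed
  qed
qed

section \<open>Order isomorphisms and products of lattices\<close>

lemma partial_orderI_eq:
  assumes "eq L = (=)"
    and "\<And>x. x \<in> carrier L \<Longrightarrow> x \<sqsubseteq>\<^bsub>L\<^esub> x"
    and "\<And>x y. \<lbrakk>x \<in> carrier L; y \<in> carrier L; x \<sqsubseteq>\<^bsub>L\<^esub> y; y \<sqsubseteq>\<^bsub>L\<^esub> x\<rbrakk> \<Longrightarrow> x = y"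
    and "\<And>x y z. \<lbrakk>x \<in> carrier L; y \<in> carrier L; z \<in> carrier L; x \<sqsubseteq>\<^bsub>L\<^esub> y; y \<sqsubseteq>\<^bsub>L\<^esub> z\<rbrakk> \<Longrightarrow> x \<sqsubseteq>\<^bsub>L\<^esub> z"
  shows "partial_order L"
proof unfold_locales
  fix x y z w
  show "x .=\<^bsub>L\<^esub> x" by (simp add: assms(1))
  show "y .=\<^bsub>L\<^esub> x" if "x .=\<^bsub>L\<^esub> y" using that by (simp add: assms(1))
  show "x .=\<^bsub>L\<^esub> z" if "x .=\<^bsub>L\<^esub> y" "y .=\<^bsub>L\<^esub> z" using that by (simp add: assms(1))
  show "x .=\<^bsub>L\<^esub> y" if "x \<in> carrier L" "y \<in> carrier L" "x \<sqsubseteq>\<^bsub>L\<^esub> y" "y \<sqsubseteq>\<^bsub>L\<^esub> x"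
    using assms(3)[OF that] by (simp add: assms(1))
  show "x \<sqsubseteq>\<^bsub>L\<^esub> z" if "x \<in> carrier L" "y \<in> carrier L" "z \<in> carrier L" "x \<sqsubseteq>\<^bsub>L\<^esub> y" "y \<sqsubseteq>\<^bsub>L\<^esub> z"
    using assms(4) that by blast
  show "x \<sqsubseteq>\<^bsub>L\<^esub> z \<longleftrightarrow> y \<sqsubseteq>\<^bsub>L\<^esub> w" if "x .=\<^bsub>L\<^esub> y" "z .=\<^bsub>L\<^esub> w"
    using that by (simp add: assms(1))
  show "x \<sqsubseteq>\<^bsub>L\<^esub> x" if "x \<in> carrier L" by (rule assms(2)[OF that])
qed (rule assms(1))

lemma latticeI_eq:
  assumes "partial_order L"
    and "\<And>x y. \<lbrakk>x \<in> carrier L; y \<in> carrier L\<rbrakk> \<Longrightarrow> \<exists>s. least L s (Upper L {x, y})"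
    and "\<And>x y. \<lbrakk>x \<in> carrier L; y \<in> carrier L\<rbrakk> \<Longrightarrow> \<exists>s. greatest L s (Lower L {x, y})"
  shows "lattice L"
proof -
  interpret partial_order L by fact
  show ?thesis by unfold_locales (use assms in auto)
qed

lemma least_Upper_pair_iff:
  assumes "x \<in> carrier L" "y \<in> carrier L"
  shows "least L s (Upper L {x, y}) \<longleftrightarrow>
    s \<in> carrier L \<and> x \<sqsubseteq>\<^bsub>L\<^esub> s \<and> y \<sqsubseteq>\<^bsub>L\<^esub> s \<and> (\<forall>u\<in>carrier L. x \<sqsubseteq>\<^bsub>L\<^esub> u \<longrightarrow> y \<sqsubseteq>\<^bsub>L\<^esub> u \<longrightarrow> s \<sqsubseteq>\<^bsub>L\<^esub> u)"
  using assms by (auto simp: least_def Upper_def)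

lemma greatest_Lower_pair_iff:
  assumes "x \<in> carrier L" "y \<in> carrier L"
  shows "greatest L s (Lower L {x, y}) \<longleftrightarrow>
    s \<in> carrier L \<and> s \<sqsubseteq>\<^bsub>L\<^esub> x \<and> s \<sqsubseteq>\<^bsub>L\<^esub> y \<and> (\<forall>u\<in>carrier L. u \<sqsubseteq>\<^bsub>L\<^esub> x \<longrightarrow> u \<sqsubseteq>\<^bsub>L\<^esub> y \<longrightarrow> u \<sqsubseteq>\<^bsub>L\<^esub> s)"
  using assms by (auto simp: greatest_def Lower_def)

lemma (in lattice) least_Upper_pair_join:
  assumes "x \<in> carrier L" "y \<in> carrier L"
  shows "least L s (Upper L {x, y}) \<longleftrightarrow> s = x \<squnion> y"
proof -
  have "least L (x \<squnion> y) (Upper L {x, y})"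
    by (rule joinI[OF _ assms])
  then show ?thesis using least_unique by blast
qed

lemma (in lattice) greatest_Lower_pair_meet:
  assumes "x \<in> carrier L" "y \<in> carrier L"
  shows "greatest L s (Lower L {x, y}) \<longleftrightarrow> s = x \<sqinter> y"
proof -
  have "greatest L (x \<sqinter> y) (Lower L {x, y})"
    by (rule meetI[OF _ assms])
  then show ?thesis using greatest_unique by blast
qed

text \<open>Joins and meets in \<open>L\<close> are obtained as preimages of those in
  \<open>M\<close>, since being a least upper or greatest lower bound is a purely order-theoretic
  condition. This spares a description of joins of congruences.\<close>

lemma lattice_iso_if_order_iso:
  assumes M: "lattice M" and eqL: "eq L = (=)" and bij: "bij_betw f (carrier L) (carrier M)"
    and le: "\<And>x y. \<lbrakk>x \<in> carrier L; y \<in> carrier L\<rbrakk> \<Longrightarrow> x \<sqsubseteq>\<^bsub>L\<^esub> y \<longleftrightarrow> f x \<sqsubseteq>\<^bsub>M\<^esub> f y"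
  shows "lattice_iso L M f"
proof -
  interpret M: lattice M by fact
  have im: "f ` carrier L = carrier M" and inj: "inj_on f (carrier L)"
    using bij by (auto simp: bij_betw_def)
  have fc: "f x \<in> carrier M" if "x \<in> carrier L" for x using im that by blast
  have ball: "(\<forall>u\<in>carrier M. P u) \<longleftrightarrow> (\<forall>u\<in>carrier L. P (f u))" for P
    unfolding im[symmetric] by blast
  have po: "partial_order L"
  proof (rule partial_orderI_eq)
    show "eq L = (=)" by (rule eqL)
    show "x = y" if "x \<in> carrier L" "y \<in> carrier L" "x \<sqsubseteq>\<^bsub>L\<^esub> y" "y \<sqsubseteq>\<^bsub>L\<^esub> x" for x y
      using that le fc M.le_antisym inj by (metis inj_onD)
    show "x \<sqsubseteq>\<^bsub>L\<^esub> z"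
      if "x \<in> carrier L" "y \<in> carrier L" "z \<in> carrier L" "x \<sqsubseteq>\<^bsub>L\<^esub> y" "y \<sqsubseteq>\<^bsub>L\<^esub> z" for x y z
      using that le fc M.le_trans[of "f x" "f y" "f z"] by simp
  qed (simp add: le fc)
  have lst: "least L s (Upper L {x, y}) \<longleftrightarrow> s \<in> carrier L \<and> least M (f s) (Upper M {f x, f y})"
    if "x \<in> carrier L" "y \<in> carrier L" for x y s
    unfolding least_Upper_pair_iff[OF that] least_Upper_pair_iff[OF fc[OF that(1)] fc[OF that(2)]] ball
    using that by (auto simp: le fc)
  have grt: "greatest L s (Lower L {x, y}) \<longleftrightarrow> s \<in> carrier L \<and> greatest M (f s) (Lower M {f x, f y})"
    if "x \<in> carrier L" "y \<in> carrier L" for x y s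
    unfolding greatest_Lower_pair_iff[OF that] greatest_Lower_pair_iff[OF fc[OF that(1)] fc[OF that(2)]] ball
    using that by (auto simp: le fc)
  have lat: "lattice L"
  proof (rule latticeI_eq[OF po])
    fix x y assume xy: "x \<in> carrier L" "y \<in> carrier L"
    have "f x \<squnion>\<^bsub>M\<^esub> f y \<in> f ` carrier L" "f x \<sqinter>\<^bsub>M\<^esub> f y \<in> f ` carrier L"
      unfolding im using xy fc by simp_all
    then obtain j m where "j \<in> carrier L" "f j = f x \<squnion>\<^bsub>M\<^esub> f y" "m \<in> carrier L" "f m = f x \<sqinter>\<^bsub>M\<^esub> f y"
      by (metis imageE)
    then have "least L j (Upper L {x, y})" "greatest L m (Lower L {x, y})"
      unfolding lst[OF xy] grt[OF xy]
      using M.least_Upper_pair_join[OF fc fc, OF xy] M.greatest_Lower_pair_meet[OF fc fc, OF xy] by simp_all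
    then show "\<exists>s. least L s (Upper L {x, y})" "\<exists>s. greatest L s (Lower L {x, y})" by blast+
  qed
  interpret L: lattice L by (rule lat)
  have "f (x \<squnion>\<^bsub>L\<^esub> y) = f x \<squnion>\<^bsub>M\<^esub> f y" "f (x \<sqinter>\<^bsub>L\<^esub> y) = f x \<sqinter>\<^bsub>M\<^esub> f y"
    if xy: "x \<in> carrier L" "y \<in> carrier L" for x y
    using L.least_Upper_pair_join[OF xy] lst[OF xy] M.least_Upper_pair_join[OF fc fc, OF xy]
      L.greatest_Lower_pair_meet[OF xy] grt[OF xy] M.greatest_Lower_pair_meet[OF fc fc, OF xy]
    by blast+
  then show ?thesis
    using bij lat M by (simp add: lattice_iso_def join_pres_def meet_pres_def)
qed

text \<open>The join is the intersection of all equivalences above both, a non-empty family because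
  \<open>A \<times> A\<close> belongs to it; no transitive closure has to be formed.\<close>

lemma lattice_Eq_lattice: "lattice (Eq_lattice A)"
proof (rule latticeI_eq)
  show "partial_order (Eq_lattice A)"
    by (rule partial_orderI_eq) (auto simp: Eq_lattice_def)
next
  fix \<epsilon> \<delta> assume "\<epsilon> \<in> carrier (Eq_lattice A)" "\<delta> \<in> carrier (Eq_lattice A)"
  then have eq: "equiv A \<epsilon>" "equiv A \<delta>" by (simp_all add: Eq_lattice_def)
  let ?J = "\<Inter>{\<eta>. equiv A \<eta> \<and> \<epsilon> \<subseteq> \<eta> \<and> \<delta> \<subseteq> \<eta>}"
  have top: "equiv A (A \<times> A)" by (auto simp: equiv_def refl_on_def sym_def trans_def)
  have "equiv A ?J"
  proof (rule equivI)
    show "?J \<subseteq> A \<times> A"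
      using top equiv_type[OF eq(1)] equiv_type[OF eq(2)] by blast
    show "refl_on A ?J" by (intro refl_onI) (auto simp: equiv_def dest: refl_onD)
    show "sym ?J" by (intro symI) (auto simp: equiv_def dest: symD)
    show "trans ?J" by (intro transI) (auto simp: equiv_def dest: transD)
  qed
  then have "least (Eq_lattice A) ?J (Upper (Eq_lattice A) {\<epsilon>, \<delta>})"
    using eq by (subst least_Upper_pair_iff) (auto simp: Eq_lattice_def)
  then show "\<exists>s. least (Eq_lattice A) s (Upper (Eq_lattice A) {\<epsilon>, \<delta>})" ..
  have "equiv A (\<epsilon> \<inter> \<delta>)"
    using eq by (intro equivI refl_onI symI transI) (auto simp: equiv_def dest: refl_onD symD transD)
  then have "greatest (Eq_lattice A) (\<epsilon> \<inter> \<delta>) (Lower (Eq_lattice A) {\<epsilon>, \<delta>})"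
    using eq by (subst greatest_Lower_pair_iff) (auto simp: Eq_lattice_def)
  then show "\<exists>s. greatest (Eq_lattice A) s (Lower (Eq_lattice A) {\<epsilon>, \<delta>})" ..
qed

lemma lattice_prod_lattice:
  assumes L: "\<And>i. i \<in> K \<Longrightarrow> lattice (L i)"
  shows "lattice (prod_lattice K L)"
proof (rule latticeI_eq)
  have po: "partial_order (L i)" if "i \<in> K" for i
    using L[OF that] by (simp add: lattice_def upper_semilattice_def)
  have refl: "a \<sqsubseteq>\<^bsub>L i\<^esub> a" if "i \<in> K" "a \<in> carrier (L i)" for i a
    by (rule weak_partial_order.le_refl) (use po that in \<open>simp_all add: partial_order_def\<close>)
  have trans: "a \<sqsubseteq>\<^bsub>L i\<^esub> c" if "i \<in> K" "a \<sqsubseteq>\<^bsub>L i\<^esub> b" "b \<sqsubseteq>\<^bsub>L i\<^esub> c"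
    "a \<in> carrier (L i)" "b \<in> carrier (L i)" "c \<in> carrier (L i)" for i a b c
    using weak_partial_order.le_trans[of "L i" a b c] po that by (simp add: partial_order_def)
  show "partial_order (prod_lattice K L)"
  proof (rule partial_orderI_eq)
    fix f g assume "f \<in> carrier (prod_lattice K L)" "g \<in> carrier (prod_lattice K L)"
      "f \<sqsubseteq>\<^bsub>prod_lattice K L\<^esub> g" "g \<sqsubseteq>\<^bsub>prod_lattice K L\<^esub> f"
    then show "f = g"
      by (intro PiE_ext[of f K _ g]) (auto simp: prod_lattice_def intro: partial_order.le_antisym[OF po])
  qed (auto simp: prod_lattice_def PiE_iff intro: refl trans)
next
  fix f g assume fg: "f \<in> carrier (prod_lattice K L)" "g \<in> carrier (prod_lattice K L)"
  then have c: "f i \<in> carrier (L i)" "g i \<in> carrier (L i)" if "i \<in> K" for i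
    using that by (auto simp: prod_lattice_def)
  have j: "f i \<squnion>\<^bsub>L i\<^esub> g i \<in> carrier (L i) \<and> f i \<sqsubseteq>\<^bsub>L i\<^esub> f i \<squnion>\<^bsub>L i\<^esub> g i \<and> g i \<sqsubseteq>\<^bsub>L i\<^esub> f i \<squnion>\<^bsub>L i\<^esub> g i \<and>
      (\<forall>u\<in>carrier (L i). f i \<sqsubseteq>\<^bsub>L i\<^esub> u \<longrightarrow> g i \<sqsubseteq>\<^bsub>L i\<^esub> u \<longrightarrow> f i \<squnion>\<^bsub>L i\<^esub> g i \<sqsubseteq>\<^bsub>L i\<^esub> u)" if "i \<in> K" for i
    using lattice.least_Upper_pair_join[OF L[OF that] c[OF that]] least_Upper_pair_iff[OF c[OF that]]
    by blast
  have m: "f i \<sqinter>\<^bsub>L i\<^esub> g i \<in> carrier (L i) \<and> f i \<sqinter>\<^bsub>L i\<^esub> g i \<sqsubseteq>\<^bsub>L i\<^esub> f i \<and> f i \<sqinter>\<^bsub>L i\<^esub> g i \<sqsubseteq>\<^bsub>L i\<^esub> g i \<and>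
      (\<forall>u\<in>carrier (L i). u \<sqsubseteq>\<^bsub>L i\<^esub> f i \<longrightarrow> u \<sqsubseteq>\<^bsub>L i\<^esub> g i \<longrightarrow> u \<sqsubseteq>\<^bsub>L i\<^esub> f i \<sqinter>\<^bsub>L i\<^esub> g i)" if "i \<in> K" for i
    using lattice.greatest_Lower_pair_meet[OF L[OF that] c[OF that]] greatest_Lower_pair_iff[OF c[OF that]]
    by blast
  have "least (prod_lattice K L) (\<lambda>i\<in>K. f i \<squnion>\<^bsub>L i\<^esub> g i) (Upper (prod_lattice K L) {f, g})"
    unfolding least_Upper_pair_iff[OF fg] using j by (auto simp: prod_lattice_def PiE_iff)
  then show "\<exists>s. least (prod_lattice K L) s (Upper (prod_lattice K L) {f, g})" by blast
  have "greatest (prod_lattice K L) (\<lambda>i\<in>K. f i \<sqinter>\<^bsub>L i\<^esub> g i) (Lower (prod_lattice K L) {f, g})"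
    unfolding greatest_Lower_pair_iff[OF fg] using m by (auto simp: prod_lattice_def PiE_iff)
  then show "\<exists>s. greatest (prod_lattice K L) s (Lower (prod_lattice K L) {f, g})" by blast
qed

section \<open>Collapsing ranks by congruences\<close>

lemma enat_le_trans: "m \<le> n \<Longrightarrow> enat n \<le> r \<Longrightarrow> enat m \<le> r"
  using order_trans[of "enat m" "enat n" r] by simp

text \<open>The middle set \<open>{1..p}\<close> is not an object of the category: \<open>s\<close>
  and \<open>t\<close> are plain functions, and only composites from one object to another become
  morphisms. In return all maps of rank \<open>p\<close> share one middle set, on which the
  symmetric group acts.\<close>

lemma factor_through_interval:
  assumes "finite A" "card (f ` A) = p"
  obtains s t where "s ` A = {1..p}" "inj_on t {1..p}" "t ` {1..p} = f ` A" "\<And>a. a \<in> A \<Longrightarrow> f a = t (s a)"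
proof -
  obtain t where t: "bij_betw t {1..p} (f ` A)"
    using assms finite_same_card_bij[of "{1..p}" "f ` A"] by auto
  define s where "s = inv_into {1..p} t \<circ> f"
  have "s ` A = inv_into {1..p} t ` f ` A" by (simp add: s_def image_comp)
  also have "\<dots> = {1..p}" using bij_betw_inv_into[OF t] by (simp add: bij_betw_def)
  finally have "s ` A = {1..p}" .
  moreover have "f a = t (s a)" if "a \<in> A" for a
    using that bij_betw_inv_into_right[OF t] by (simp add: s_def)
  ultimately show ?thesis using that[of s t] t by (auto simp: bij_betw_def)
qed

text \<open>Points outside the image of \<open>h\<close> go to the default \<open>t k0\<close>. So
  the values of \<open>b\<close> stay among those of \<open>t\<close> on \<open>K\<close>, which
  bounds the rank of \<open>b\<close> and keeps it usable as a multiplier.\<close>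

lemma extend_from_image:
  assumes "inj_on h K" "K \<noteq> {}"
  obtains b where "\<And>k. k \<in> K \<Longrightarrow> b (h k) = t k" "range b \<subseteq> t ` K"
proof -
  from assms(2) obtain k0 where k0: "k0 \<in> K" by blast
  let ?b = "\<lambda>y. if y \<in> h ` K then t (inv_into K h y) else t k0"
  have "?b (h k) = t k" if "k \<in> K" for k using assms(1) that by simp
  moreover have "range ?b \<subseteq> t ` K" using k0 by (auto intro: inv_into_into)
  ultimately show ?thesis by (rule that)
qed

text \<open>Under the hypothesis \<open>f\<close> factors through \<open>g\<close> on
  \<open>A\<close>. The contrapositive matters too: a strictly larger rank of \<open>f\<close>
  yields two points that \<open>g\<close> identifies and \<open>f\<close> separates.\<close>

lemma card_image_le_if_kernel_le:
  assumes "finite A" "\<And>a a'. \<lbrakk>a \<in> A; a' \<in> A; g a = g a'\<rbrakk> \<Longrightarrow> f a = f a'"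
  shows "card (f ` A) \<le> card (g ` A)"
proof -
  have "f a = f (inv_into A g (g a))" if "a \<in> A" for a
    using that by (intro assms(2)) (auto simp: inv_into_into f_inv_into_f)
  then have "f ` A \<subseteq> (\<lambda>y. f (inv_into A g y)) ` (g ` A)" by (auto simp: image_iff)
  then show ?thesis
    using assms(1) by (meson card_image_le card_mono finite_imageI le_trans)
qed

lemma card_image_range_le:
  assumes "range b \<subseteq> t ` {1..p::nat}" "enat p \<le> r"
  shows "enat (card (b ` B)) \<le> r"
proof -
  have "card (b ` B) \<le> card (t ` {1..p})"
    using assms(1) by (intro card_mono) auto
  also have "\<dots> \<le> p" using card_image_le[of "{1..p}" t] by simp
  finally show ?thesis using assms(2) enat_le_trans by blast
qed

text \<open>Any function may be given; cutting it down to the domain makes two morphisms equal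
  exactly when the functions agree there. Composites and multipliers can then be written as plain
  lambda terms, with no extensionality conditions carried along.\<close>

definition mor :: "'a set \<Rightarrow> ('a \<Rightarrow> 'a) \<Rightarrow> 'a set \<Rightarrow> 'a morph" where
  "mor A f B = (A, restrict f A, B)"

lemma mor_eq_iff: "mor A f B = mor A' g B' \<longleftrightarrow> A = A' \<and> B = B' \<and> (\<forall>a\<in>A. f a = g a)"
  by (auto simp: mor_def restrict_def fun_eq_iff)

lemma mor_cong: "(\<And>a. a \<in> A \<Longrightarrow> f a = g a) \<Longrightarrow> mor A f B = mor A g B"
  by (simp add: mor_eq_iff)

lemma rank_mor [simp]: "rank (mor A f B) = card (f ` A)"
  by (simp add: rank_def mor_def)

lemma I_psg_simps [simp]:
  "carrier (I_psg \<C> r) = I_set \<C> r" "objs (I_psg \<C> r) = \<C>"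
  "dm (I_psg \<C> r) (mor A f B) = A" "rg (I_psg \<C> r) (mor A f B) = B"
  by (simp_all add: I_psg_def trans_cat_def mor_def)

lemma trans_cat_simps [simp]:
  "objs (trans_cat \<C>) = \<C>"
  "dm (trans_cat \<C>) (mor A f B) = A" "rg (trans_cat \<C>) (mor A f B) = B"
  by (simp_all add: trans_cat_def mor_def)

lemma mor_mult_trans_cat [simp]:
  "f ` A \<subseteq> B \<Longrightarrow> mor A f B \<cdot>\<^bsub>trans_cat \<C>\<^esub> mor B g D = mor A (g \<circ> f) D"
  by (auto simp: trans_cat_def mor_def compose_def fun_eq_iff)

lemma mor_mult_I_psg [simp]:
  "f ` A \<subseteq> B \<Longrightarrow> mor A f B \<cdot>\<^bsub>I_psg \<C> r\<^esub> mor B g D = mor A (g \<circ> f) D"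
  using mor_mult_trans_cat[of f A B \<C> g D] by (simp add: I_psg_def)

lemma mor_in_trans_cat [simp]:
  "mor A f B \<in> carrier (trans_cat \<C>) \<longleftrightarrow> A \<in> \<C> \<and> B \<in> \<C> \<and> f ` A \<subseteq> B"
  by (auto simp: trans_cat_def mor_def)

lemma mor_in_I_set [simp]:
  "mor A f B \<in> I_set \<C> r \<longleftrightarrow> A \<in> \<C> \<and> B \<in> \<C> \<and> f ` A \<subseteq> B \<and> enat (card (f ` A)) \<le> r"
  by (simp add: I_set_def)

lemma trans_catE:
  assumes "m \<in> carrier (trans_cat \<C>)"
  obtains A f B where "m = mor A f B" "A \<in> \<C>" "B \<in> \<C>" "f ` A \<subseteq> B"
proof -
  obtain A f B where m: "m = (A, f, B)" by (cases m)
  then have *: "A \<in> \<C>" "B \<in> \<C>" "f \<in> A \<rightarrow>\<^sub>E B" using assms by (auto simp: trans_cat_def)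
  then have "m = mor A f B" using m by (auto simp: mor_def extensional_restrict PiE_def)
  then show ?thesis using that * by blast
qed

lemma I_setE:
  assumes "m \<in> I_set \<C> r"
  obtains A f B where "m = mor A f B" "A \<in> \<C>" "B \<in> \<C>" "f ` A \<subseteq> B" "enat (card (f ` A)) \<le> r"
proof -
  from assms have "m \<in> carrier (trans_cat \<C>)" "enat (rank m) \<le> r" by (simp_all add: I_set_def)
  then show ?thesis using that by (elim trans_catE) auto
qed

lemma psg_sim_mor [simp]: "psg_sim (I_psg \<C> r) (mor A f B) (mor A' g B') \<longleftrightarrow> A = A' \<and> B = B'"
  by (simp add: psg_sim_def)

lemma Cong_I_psgI:
  assumes "equiv (I_set \<C> r) \<sigma>"
    and "\<And>A B A' B' f g. (mor A f B, mor A' g B') \<in> \<sigma> \<Longrightarrow> A = A' \<and> B = B'"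
    and "\<And>A B Z f g h. \<lbrakk>(mor A f B, mor A g B) \<in> \<sigma>; Z \<in> \<C>; h ` Z \<subseteq> A; enat (card (h ` Z)) \<le> r\<rbrakk>
      \<Longrightarrow> (mor Z (f \<circ> h) B, mor Z (g \<circ> h) B) \<in> \<sigma>"
    and "\<And>A B D f g b. \<lbrakk>(mor A f B, mor A g B) \<in> \<sigma>; D \<in> \<C>; b ` B \<subseteq> D; enat (card (b ` B)) \<le> r\<rbrakk>
      \<Longrightarrow> (mor A (b \<circ> f) D, mor A (b \<circ> g) D) \<in> \<sigma>"
  shows "\<sigma> \<in> Cong (I_psg \<C> r)"
proof -
  have "psg_sim (I_psg \<C> r) x y \<and>
      (\<forall>a\<in>carrier (I_psg \<C> r).
        (rg (I_psg \<C> r) a = dm (I_psg \<C> r) x \<longrightarrow> (a \<cdot>\<^bsub>I_psg \<C> r\<^esub> x, a \<cdot>\<^bsub>I_psg \<C> r\<^esub> y) \<in> \<sigma>) \<and>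
        (rg (I_psg \<C> r) x = dm (I_psg \<C> r) a \<longrightarrow> (x \<cdot>\<^bsub>I_psg \<C> r\<^esub> a, y \<cdot>\<^bsub>I_psg \<C> r\<^esub> a) \<in> \<sigma>))"
    if xy: "(x, y) \<in> \<sigma>" for x y
  proof -
    have "x \<in> I_set \<C> r" "y \<in> I_set \<C> r" using equiv_type[OF assms(1)] xy by auto
    then obtain A f B A' g B' where x: "x = mor A f B" "f ` A \<subseteq> B" and y: "y = mor A' g B'" "g ` A' \<subseteq> B'"
      by (elim I_setE) blast
    with xy assms(2) have eq: "A' = A" "B' = B" by blast+
    show ?thesis
    proof (intro conjI ballI impI)
      fix a assume "a \<in> carrier (I_psg \<C> r)"
      then obtain Z h D where a: "a = mor Z h D" "Z \<in> \<C>" "D \<in> \<C>" "h ` Z \<subseteq> D" "enat (card (h ` Z)) \<le> r"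
        by (auto elim: I_setE)
      show "(a \<cdot>\<^bsub>I_psg \<C> r\<^esub> x, a \<cdot>\<^bsub>I_psg \<C> r\<^esub> y) \<in> \<sigma>" if "rg (I_psg \<C> r) a = dm (I_psg \<C> r) x"
        using that a x y eq assms(3)[of A f B g Z h] xy by simp
      show "(x \<cdot>\<^bsub>I_psg \<C> r\<^esub> a, y \<cdot>\<^bsub>I_psg \<C> r\<^esub> a) \<in> \<sigma>" if "rg (I_psg \<C> r) x = dm (I_psg \<C> r) a"
        using that a x y eq assms(4)[of A f B g D h] xy by simp
    qed (use x y eq in simp)
  qed
  then show ?thesis using assms(1) by (auto simp: Cong_def)
qed

section \<open>Elementary properties of a congruence on \<open>I_psg \<C> r\<close>\<close>

context
  fixes \<C> :: "'a set set" and r :: enat and \<sigma> :: "'a morph rel"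
  assumes \<sigma>: "\<sigma> \<in> Cong (I_psg \<C> r)"
begin

lemma Cong_equiv: "equiv (I_set \<C> r) \<sigma>"
  using \<sigma> by (simp add: Cong_def)

lemma Cong_refl: "m \<in> I_set \<C> r \<Longrightarrow> (m, m) \<in> \<sigma>"
  using Cong_equiv by (auto simp: equiv_def dest: refl_onD)

lemma Cong_sym: "(m, m') \<in> \<sigma> \<Longrightarrow> (m', m) \<in> \<sigma>"
  using Cong_equiv by (auto simp: equiv_def dest: symD)

lemma Cong_trans: "(m, m') \<in> \<sigma> \<Longrightarrow> (m', m'') \<in> \<sigma> \<Longrightarrow> (m, m'') \<in> \<sigma>"
  using Cong_equiv by (auto simp: equiv_def dest: transD)

lemma Cong_pairE:
  assumes "(m, m') \<in> \<sigma>"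
  obtains A f B g where "m = mor A f B" "m' = mor A g B" "A \<in> \<C>" "B \<in> \<C>" "f ` A \<subseteq> B" "g ` A \<subseteq> B"
    "enat (card (f ` A)) \<le> r" "enat (card (g ` A)) \<le> r"
proof -
  have "m \<in> I_set \<C> r" "m' \<in> I_set \<C> r" using equiv_type[OF Cong_equiv] assms by auto
  moreover have "psg_sim (I_psg \<C> r) m m'" using \<sigma> assms by (auto simp: Cong_def)
  ultimately show ?thesis using that by (elim I_setE) auto
qed

lemma Cong_memD:
  assumes "(mor A f B, mor A g B) \<in> \<sigma>"
  shows "A \<in> \<C>" "B \<in> \<C>" "f ` A \<subseteq> B" "g ` A \<subseteq> B"
    "enat (card (f ` A)) \<le> r" "enat (card (g ` A)) \<le> r"
proof -
  have "mor A f B \<in> I_set \<C> r" "mor A g B \<in> I_set \<C> r" using equiv_type[OF Cong_equiv] assms by blast+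
  then show "A \<in> \<C>" "B \<in> \<C>" "f ` A \<subseteq> B" "g ` A \<subseteq> B"
    "enat (card (f ` A)) \<le> r" "enat (card (g ` A)) \<le> r" unfolding mor_in_I_set by blast+
qed

lemma Cong_left:
  assumes fg: "(mor A f B, mor A g B) \<in> \<sigma>" and "Z \<in> \<C>" "h ` Z \<subseteq> A" "enat (card (h ` Z)) \<le> r"
  shows "(mor Z (f \<circ> h) B, mor Z (g \<circ> h) B) \<in> \<sigma>"
proof -
  note mem = Cong_memD[OF fg]
  have "mor Z h A \<in> carrier (I_psg \<C> r)" using assms mem by simp
  then have "(mor Z h A \<cdot>\<^bsub>I_psg \<C> r\<^esub> mor A f B, mor Z h A \<cdot>\<^bsub>I_psg \<C> r\<^esub> mor A g B) \<in> \<sigma>"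
    using \<sigma> fg unfolding Cong_def by fastforce
  then show ?thesis using assms by simp
qed

lemma Cong_right:
  assumes fg: "(mor A f B, mor A g B) \<in> \<sigma>" and "D \<in> \<C>" "b ` B \<subseteq> D" "enat (card (b ` B)) \<le> r"
  shows "(mor A (b \<circ> f) D, mor A (b \<circ> g) D) \<in> \<sigma>"
proof -
  note mem = Cong_memD[OF fg]
  have "mor B b D \<in> carrier (I_psg \<C> r)" using assms mem by simp
  then have "(mor A f B \<cdot>\<^bsub>I_psg \<C> r\<^esub> mor B b D, mor A g B \<cdot>\<^bsub>I_psg \<C> r\<^esub> mor B b D) \<in> \<sigma>"
    using \<sigma> fg unfolding Cong_def by fastforce
  then show ?thesis using mem by simp
qed

lemma Cong_two_sided:
  assumes fg: "(mor A f B, mor A g B) \<in> \<sigma>"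
    and "Z \<in> \<C>" "h ` Z \<subseteq> A" "enat (card (h ` Z)) \<le> r"
    and "D \<in> \<C>" "b ` B \<subseteq> D" "enat (card (b ` B)) \<le> r"
  shows "(mor Z (\<lambda>z. b (f (h z))) D, mor Z (\<lambda>z. b (g (h z))) D) \<in> \<sigma>"
  using Cong_left[OF Cong_right[OF fg assms(5-7)] assms(2-4)] by (simp add: comp_def)

end

text \<open>Inclusion of a Rees congruence in \<sigma>: that of the ideal of maps of rank at most
  \<open>k\<close>, cut down to \<open>I_set \<C> r\<close>. The two maps may have different
  ranks.\<close>

definition collapsed :: "'a set set \<Rightarrow> enat \<Rightarrow> 'a morph rel \<Rightarrow> nat \<Rightarrow> bool" where
  "collapsed \<C> r \<sigma> k \<longleftrightarrow>
     (\<forall>A B f g. mor A f B \<in> I_set \<C> r \<longrightarrow> mor A g B \<in> I_set \<C> r \<longrightarrow>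
        card (f ` A) \<le> k \<longrightarrow> card (g ` A) \<le> k \<longrightarrow> (mor A f B, mor A g B) \<in> \<sigma>)"

lemma collapsed_mono: "collapsed \<C> r \<sigma> k \<Longrightarrow> j \<le> k \<Longrightarrow> collapsed \<C> r \<sigma> j"
  unfolding collapsed_def by (meson le_trans)

section \<open>How far a single related pair collapses the ranks\<close>

context
  fixes \<C> :: "'a set set" and r :: enat and \<sigma> :: "'a morph rel"
  assumes members: "\<And>A. A \<in> \<C> \<Longrightarrow> finite A \<and> A \<noteq> {}"
    and r2: "2 \<le> r"
    and \<sigma>: "\<sigma> \<in> Cong (I_psg \<C> r)"
begin

lemma collapsed_0: "collapsed \<C> r \<sigma> 0"
  using members by (auto simp: collapsed_def)

text \<open>Precomposing with the constant map to \<open>a\<close> turns the pair into constants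
  with values \<open>f a\<close> and \<open>g a\<close>; the two-valued map \<open>?b\<close> sends
  these to any two prescribed values. As \<open>?b\<close> can have rank 2, this is where
  \<open>2 \<le> r\<close> enters.\<close>

lemma collapsed_1_if_neq:
  assumes fg: "(mor A f B, mor A g B) \<in> \<sigma>" and a: "a \<in> A" "f a \<noteq> g a"
  shows "collapsed \<C> r \<sigma> 1"
  unfolding collapsed_def
proof (intro allI impI)
  fix Z D :: "'a set" and u v
  assume uv: "mor Z u D \<in> I_set \<C> r" "mor Z v D \<in> I_set \<C> r" "card (u ` Z) \<le> 1" "card (v ` Z) \<le> 1"
  then have Z: "finite Z" "Z \<noteq> {}" using members[of Z] by auto
  then obtain z where z: "z \<in> Z" by blast
  have const: "w z' = w z" if "card (w ` Z) \<le> 1" "z' \<in> Z" for w :: "'a \<Rightarrow> 'a" and z'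
  proof -
    have "\<forall>y\<in>w ` Z. \<forall>y'\<in>w ` Z. y = y'"
      using that(1) unfolding One_nat_def card_le_Suc0_iff_eq[OF finite_imageI[OF Z(1)]] .
    then show ?thesis using that(2) z by blast
  qed
  let ?b = "\<lambda>y. if y = f a then u z else v z"
  have "?b ` B \<subseteq> {u z, v z}" by auto
  then have "card (?b ` B) \<le> card {u z, v z}" by (intro card_mono) auto
  also have "\<dots> \<le> 2" by (simp add: card_insert_if)
  finally have "enat (card (?b ` B)) \<le> 2" by (simp add: numeral_eq_enat)
  then have b: "enat (card (?b ` B)) \<le> r" using r2 by (rule order_trans)
  have "1 \<le> r" using r2 order_trans[of 1 2 r] by (simp add: numeral_eq_enat one_enat_def)
  moreover have "card ((\<lambda>_::'a. a) ` Z) = 1" using Z by (simp add: image_constant_conv)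
  ultimately have h: "enat (card ((\<lambda>_. a) ` Z)) \<le> r" by (simp add: one_enat_def)
  have "u z \<in> D" "v z \<in> D" using uv z by auto
  then have "(mor Z (\<lambda>y. ?b (f a)) D, mor Z (\<lambda>y. ?b (g a)) D) \<in> \<sigma>"
    using a uv by (intro Cong_two_sided[OF \<sigma> fg _ _ h _ _ b]) auto
  also have "mor Z (\<lambda>y. ?b (f a)) D = mor Z u D"
    using const[OF uv(3)] by (simp add: mor_eq_iff)
  also have "mor Z (\<lambda>y. ?b (g a)) D = mor Z v D"
    using const[OF uv(4)] not_sym[OF a(2)] by (simp add: mor_eq_iff)
  finally show "(mor Z u D, mor Z v D) \<in> \<sigma>" .
qed

text \<open>The points of \<open>E\<close> are separated by \<open>f\<close> but not by
  \<open>g\<close>. The map \<open>w\<close> is recovered from \<open>f\<close> as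
  \<open>b \<circ> f \<circ> e \<circ> s\<close>: \<open>s\<close> labels the kernel classes of
  \<open>w\<close>, \<open>e\<close> enumerates \<open>E\<close>, and \<open>b\<close> undoes
  \<open>f\<close> on \<open>E\<close> before applying the injection \<open>t\<close>. Both
  multipliers have at most the rank of \<open>w\<close>, hence are admissible. With \<open>g\<close>
  in place of \<open>f\<close> rank is lost, because \<open>g\<close> maps \<open>E\<close> to fewer
  points.\<close>

lemma related_to_lower_rank:
  assumes fg: "(mor A f B, mor A g B) \<in> \<sigma>"
    and E: "E \<subseteq> A" "inj_on f E" "\<not> inj_on g E"
    and w: "mor Z w D \<in> I_set \<C> r" "card (w ` Z) = card E"
  obtains w' where "(mor Z w D, mor Z w' D) \<in> \<sigma>" "card (w' ` Z) < card E"
proof -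
  note mem = Cong_memD[OF \<sigma> fg]
  define p where "p = card E"
  have fin: "finite A" "finite Z" "Z \<noteq> {}" "finite B" using mem w members by auto
  have finE: "finite E" using E(1) fin(1) by (rule finite_subset)
  obtain s t where st: "s ` Z = {1..p}" "inj_on t {1..p}" "t ` {1..p} = w ` Z"
      "\<And>z. z \<in> Z \<Longrightarrow> w z = t (s z)"
    using factor_through_interval[OF fin(2), of w p] w(2) p_def by metis
  have ne: "{1..p} \<noteq> {}" using st(1) fin(3) by blast
  obtain e where e: "bij_betw e {1..p} E"
    using finE finite_same_card_bij[of "{1..p}" E] p_def by auto
  have injfe: "inj_on (\<lambda>i. f (e i)) {1..p}"
    using comp_inj_on[of e "{1..p}" f] e E(2) by (simp add: bij_betw_def comp_def)
  obtain b where b: "\<And>i. i \<in> {1..p} \<Longrightarrow> b (f (e i)) = t i" "range b \<subseteq> t ` {1..p}"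
    using extend_from_image[OF injfe ne, of t] by metis
  have pr: "enat p \<le> r" using w p_def by simp
  have es: "(\<lambda>z. e (s z)) ` Z = E"
    using st(1) e by (simp add: bij_betw_def flip: image_image)
  have "b ` B \<subseteq> w ` Z" using b(2) st(3) by blast
  moreover have "w ` Z \<subseteq> D" using w(1) by simp
  ultimately have "b ` B \<subseteq> D" by blast
  then have "(mor Z (\<lambda>z. b (f (e (s z)))) D, mor Z (\<lambda>z. b (g (e (s z)))) D) \<in> \<sigma>"
    using w(1) E(1) es pr p_def card_image_range_le[OF b(2) pr]
    by (intro Cong_two_sided[OF \<sigma> fg, where h = "\<lambda>z. e (s z)"]) auto
  also have "mor Z (\<lambda>z. b (f (e (s z)))) D = mor Z w D"
  proof (rule mor_cong)
    fix z assume z: "z \<in> Z"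
    then have "s z \<in> {1..p}" using st(1) by blast
    then show "b (f (e (s z))) = w z" using b(1) st(4)[OF z] by simp
  qed
  finally have "(mor Z w D, mor Z (\<lambda>z. b (g (e (s z)))) D) \<in> \<sigma>" .
  moreover have "card ((\<lambda>z. b (g (e (s z)))) ` Z) < card E"
  proof -
    have "(\<lambda>z. b (g (e (s z)))) ` Z = b ` g ` (\<lambda>z. e (s z)) ` Z" by (simp add: image_image)
    then have "card ((\<lambda>z. b (g (e (s z)))) ` Z) \<le> card (g ` E)"
      using es finE by (simp add: card_image_le)
    also have "\<dots> < card E"
      using E(3) finE card_image_le[of E g] eq_card_imp_inj_on[of E g] by force
    finally show ?thesis .
  qed
  ultimately show ?thesis by (rule that)
qed

text \<open>Induction on the rank. A set \<open>E\<close> of \<open>Suc k\<close> points separated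
  by \<open>f\<close> and containing both \<open>a\<close> and \<open>a'\<close> moves every map of
  rank \<open>Suc k\<close> to a related one of rank at most \<open>k\<close>, where the induction
  hypothesis connects any two. Such an \<open>E\<close> has at least two points, so rank 1 is
  treated apart, by the argument on constants.\<close>

lemma collapsed_if_kernel_not_le:
  assumes fg: "(mor A f B, mor A g B) \<in> \<sigma>"
    and a: "a \<in> A" "a' \<in> A" "f a \<noteq> f a'" "g a = g a'"
  shows "collapsed \<C> r \<sigma> (card (f ` A))"
proof -
  note mem = Cong_memD[OF \<sigma> fg]
  have finA: "finite A" using mem members by auto
  have "collapsed \<C> r \<sigma> k" if "k \<le> card (f ` A)" for k
    using that
  proof (induction k)
    case 0
    show ?case by (rule collapsed_0)
  next
    case (Suc k)
    show ?case
    proof (cases "k = 0")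
      case True
      have "f a \<noteq> g a \<or> f a' \<noteq> g a'" using a by auto
      then show ?thesis using collapsed_1_if_neq[OF fg] a True by auto
    next
      case False
      have "card {f a, f a'} \<le> Suc k" using False by (simp add: card_insert_if)
      moreover have "{f a, f a'} \<subseteq> f ` A" using a by auto
      ultimately obtain T where T: "{f a, f a'} \<subseteq> T" "T \<subseteq> f ` A" "card T = Suc k"
        using exists_subset_between[of "{f a, f a'}" "Suc k" "f ` A"] Suc.prems finA by auto
      \<comment> \<open>A blind choice of preimages could miss \<open>a\<close> or
        \<open>a'\<close>; prescribing them makes \<open>g\<close> fail to be injective on
        \<open>E\<close>.\<close>
      define e where "e = (\<lambda>y. if y = f a then a else if y = f a' then a' else inv_into A f y)"
      have e: "e y \<in> A \<and> f (e y) = y" if "y \<in> T" for y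
        using that T(2) a by (auto simp: e_def inv_into_into f_inv_into_f)
      define E where "E = e ` T"
      have "E \<subseteq> A" using e by (auto simp: E_def)
      have "inj_on f E" using e by (auto simp: E_def inj_on_def)
      have "inj_on e T" using e by (metis inj_onI)
      then have cE: "card E = Suc k" using T(3) by (simp add: E_def card_image)
      have "e (f a) = a" "e (f a') = a'" using a by (auto simp: e_def)
      then have "a \<in> E" "a' \<in> E" using T(1) unfolding E_def by (metis image_eqI insert_subset)+
      then have "\<not> inj_on g E" using a by (auto dest: inj_onD)
      note lower = related_to_lower_rank[OF fg \<open>E \<subseteq> A\<close> \<open>inj_on f E\<close> \<open>\<not> inj_on g E\<close>]
      have lower': "\<exists>w'. (mor Z w D, mor Z w' D) \<in> \<sigma> \<and> card (w' ` Z) \<le> k"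
        if w: "mor Z w D \<in> I_set \<C> r" "card (w ` Z) \<le> Suc k" for Z D w
      proof (cases "card (w ` Z) = Suc k")
        case True
        then obtain w' where "(mor Z w D, mor Z w' D) \<in> \<sigma>" "card (w' ` Z) < card E"
          using lower[OF w(1)] cE by metis
        then show ?thesis using cE by auto
      next
        case False
        then show ?thesis using w Cong_refl[OF \<sigma> w(1)] by (intro exI[of _ w]) auto
      qed
      show ?thesis
        unfolding collapsed_def
      proof (intro allI impI)
        fix Z D :: "'a set" and u v
        assume uv: "mor Z u D \<in> I_set \<C> r" "mor Z v D \<in> I_set \<C> r"
          "card (u ` Z) \<le> Suc k" "card (v ` Z) \<le> Suc k"
        obtain u' where u': "(mor Z u D, mor Z u' D) \<in> \<sigma>" "card (u' ` Z) \<le> k"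
          using lower'[OF uv(1,3)] by blast
        obtain v' where v': "(mor Z v D, mor Z v' D) \<in> \<sigma>" "card (v' ` Z) \<le> k"
          using lower'[OF uv(2,4)] by blast
        have "mor Z u' D \<in> I_set \<C> r" "mor Z v' D \<in> I_set \<C> r"
          using Cong_memD[OF \<sigma> u'(1)] Cong_memD[OF \<sigma> v'(1)] by simp_all
        then have "(mor Z u' D, mor Z v' D) \<in> \<sigma>"
          using Suc.IH Suc.prems u'(2) v'(2) by (simp add: collapsed_def)
        then show "(mor Z u D, mor Z v D) \<in> \<sigma>"
          using u'(1) Cong_sym[OF \<sigma> v'(1)] Cong_trans[OF \<sigma>] by blast
      qed
    qed
  qed
  then show ?thesis by simp
qed

text \<open>As the rank of \<open>f\<close> is not collapsed, no two points are identified by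
  \<open>g\<close> and separated by \<open>f\<close>; and as \<open>f\<close> has at least the rank
  of \<open>g\<close>, the induced surjection between the images is a bijection, so the kernels
  agree. If the images differed, a retraction onto the image of \<open>f\<close> would fix
  \<open>f\<close> and lower the rank of \<open>g\<close>, giving a related pair with different
  kernels.\<close>

lemma collapsed_or_H_related:
  assumes fg: "(mor A f B, mor A g B) \<in> \<sigma>" and neq: "mor A f B \<noteq> mor A g B"
    and le: "card (g ` A) \<le> card (f ` A)"
    and not: "\<not> collapsed \<C> r \<sigma> (card (f ` A))"
  shows "f ` A = g ` A" "\<And>a a'. \<lbrakk>a \<in> A; a' \<in> A\<rbrakk> \<Longrightarrow> f a = f a' \<longleftrightarrow> g a = g a'"
proof -
  note mem = Cong_memD[OF \<sigma> fg]
  have finA: "finite A" "A \<noteq> {}" using mem members by auto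
  have ker: "f a = f a'" if "a \<in> A" "a' \<in> A" "g a = g a'" for a a'
    using collapsed_if_kernel_not_le[OF fg that(1,2) _ that(3)] not by blast
  then have "card (f ` A) \<le> card (g ` A)" by (intro card_image_le_if_kernel_le finA)
  then have card: "card (f ` A) = card (g ` A)" using le by simp
  define \<phi> where "\<phi> = (\<lambda>y. f (inv_into A g y))"
  have \<phi>: "\<phi> (g a) = f a" if "a \<in> A" for a
    unfolding \<phi>_def using that by (intro ker) (auto simp: inv_into_into f_inv_into_f)
  then have "\<phi> ` g ` A = f ` A" by (simp add: image_image)
  then have "inj_on \<phi> (g ` A)" using card finA by (intro eq_card_imp_inj_on) auto
  then show "f a = f a' \<longleftrightarrow> g a = g a'" if "a \<in> A" "a' \<in> A" for a a'
    using that \<phi> ker by (metis imageI inj_onD)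
  show "f ` A = g ` A"
  proof (rule ccontr)
    assume "f ` A \<noteq> g ` A"
    then have "\<not> f ` A \<subseteq> g ` A" using card finA by (metis card_subset_eq finite_imageI)
    then obtain b where b: "b \<in> f ` A" "b \<notin> g ` A" by blast
    obtain a where a: "a \<in> A" "f a \<noteq> g a" using neq by (auto simp: mor_eq_iff)
    have one: "collapsed \<C> r \<sigma> 1" by (rule collapsed_1_if_neq[OF fg a])
    then have "\<not> card (f ` A) \<le> 1" using not collapsed_mono by blast
    then have "\<not> f ` A \<subseteq> {b}" using card_mono[of "{b}" "f ` A"] by auto
    then obtain b' where b': "b' \<in> f ` A" "b' \<noteq> b" by blast
    \<comment> \<open>Everything outside the image of \<open>f\<close> goes to \<open>b'\<close>,
      which differs from \<open>b\<close>; hence \<open>c \<circ> g\<close> misses \<open>b\<close>.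
      Such a \<open>b'\<close> exists because rank 1 is already collapsed, so \<open>f\<close> has
      rank at least 2.\<close>
    define c where "c = (\<lambda>y. if y \<in> f ` A then y else b')"
    have cB: "c ` B \<subseteq> f ` A" using b' by (auto simp: c_def)
    then have "card (c ` B) \<le> card (f ` A)" using finA by (intro card_mono) auto
    then have "enat (card (c ` B)) \<le> r" using mem(5) enat_le_trans by blast
    then have "(mor A (c \<circ> f) B, mor A (c \<circ> g) B) \<in> \<sigma>"
      using cB mem by (intro Cong_right[OF \<sigma> fg]) auto
    also have "mor A (c \<circ> f) B = mor A f B" by (rule mor_cong) (simp add: c_def)
    finally have fcg: "(mor A f B, mor A (c \<circ> g) B) \<in> \<sigma>" .
    have "(c \<circ> g) ` A \<subset> f ` A" using b b' by (auto simp: c_def)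
    then have "card ((c \<circ> g) ` A) < card (f ` A)" using finA by (intro psubset_card_mono) auto
    then have "\<not> card (f ` A) \<le> card ((c \<circ> g) ` A)" by simp
    then obtain a1 a2 where "a1 \<in> A" "a2 \<in> A" "(c \<circ> g) a1 = (c \<circ> g) a2" "f a1 \<noteq> f a2"
      using card_image_le_if_kernel_le[OF finA(1), of "c \<circ> g" f] by blast
    then show False using collapsed_if_kernel_not_le[OF fcg] not by blast
  qed
qed

text \<open>From rank 3 on there is a value \<open>f a'\<close> other than \<open>f a\<close> and
  \<open>g a\<close>. A map \<open>c\<close> that moves \<open>f a\<close> to \<open>f a'\<close>
  and fixes the other values makes \<open>a\<close> and \<open>a'\<close> agree under
  \<open>c \<circ> f\<close>, while \<open>c \<circ> g\<close> keeps them apart. The kernel lemma is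
  applied with \<open>c \<circ> g\<close> first, as the separating map; its image is that of
  \<open>f\<close> without \<open>f a\<close>. Up to rank 2 only ranks at most 1 are claimed, and
  the constants suffice.\<close>

lemma collapsed_if_H_related:
  assumes fg: "(mor A f B, mor A g B) \<in> \<sigma>" and a: "a \<in> A" "f a \<noteq> g a"
    and im: "f ` A = g ` A"
    and ker: "\<And>a a'. \<lbrakk>a \<in> A; a' \<in> A\<rbrakk> \<Longrightarrow> f a = f a' \<longleftrightarrow> g a = g a'"
  shows "collapsed \<C> r \<sigma> (card (f ` A) - 1)"
proof (cases "card (f ` A) \<le> 2")
  case True
  then show ?thesis using collapsed_mono[OF collapsed_1_if_neq[OF fg a]] by simp
next
  case False
  note mem = Cong_memD[OF \<sigma> fg]
  have finA: "finite A" using mem members by auto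
  have "\<not> f ` A \<subseteq> {f a, g a}"
  proof
    assume "f ` A \<subseteq> {f a, g a}"
    then have "card (f ` A) \<le> card {f a, g a}" by (intro card_mono) auto
    then show False using False by (simp add: card_insert_if split: if_splits)
  qed
  then obtain a' where a': "a' \<in> A" "f a' \<noteq> f a" "f a' \<noteq> g a" by blast
  define c where "c = (\<lambda>y. if y \<in> f ` A - {f a} then y else f a')"
  have cB: "c ` B \<subseteq> f ` A - {f a}" using a' by (auto simp: c_def)
  have cid: "c y = y" if "y \<in> f ` A - {f a}" for y using that by (simp add: c_def)
  have card1: "card (f ` A - {f a}) = card (f ` A) - 1"
    using a finA by (simp add: card_Diff_singleton)
  have "card (c ` B) \<le> card (f ` A - {f a})" using finA cB by (intro card_mono) auto
  also have "\<dots> \<le> card (f ` A)" using finA by (intro card_mono) auto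
  finally have cr: "enat (card (c ` B)) \<le> r" using mem(5) enat_le_trans by blast
  have cg: "(mor A (c \<circ> g) B, mor A (c \<circ> f) B) \<in> \<sigma>"
    using cB cr mem by (intro Cong_right[OF \<sigma> Cong_sym[OF \<sigma> fg]]) auto
  have "(c \<circ> g) ` A = f ` A - {f a}"
  proof -
    have "(c \<circ> g) ` A = c ` f ` A" by (simp add: im image_comp)
    also have "\<dots> = f ` A - {f a}"
    proof
      show "c ` f ` A \<subseteq> f ` A - {f a}" using a' by (auto simp: c_def)
      show "f ` A - {f a} \<subseteq> c ` f ` A" using cid by (metis DiffD1 image_eqI subsetI)
    qed
    finally show ?thesis .
  qed
  moreover have "collapsed \<C> r \<sigma> (card ((c \<circ> g) ` A))"
  proof (rule collapsed_if_kernel_not_le[OF cg a(1) a'(1)])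
    show "(c \<circ> f) a = (c \<circ> f) a'" using a' a by (auto simp: c_def)
    have ga: "g a \<in> f ` A" "g a' \<in> f ` A" using im a a' by auto
    have "g a \<noteq> g a'" using ker[OF a(1) a'(1)] a' by auto
    then show "(c \<circ> g) a \<noteq> (c \<circ> g) a'" using a a' ga by (auto simp: c_def)
  qed
  ultimately show ?thesis using card1 by simp
qed

end

section \<open>The relation \<open>\<nu>\<^sub>N\<close>\<close>

lemma min_index_mem:
  assumes "bij_betw x {1..n} X" "1 \<le> p" "v \<in> X"
  shows "min (inv_into {1..n} x v) p \<in> {1..p::nat}"
proof -
  have "inv_into {1..n} x v \<in> {1..n}"
    using assms by (intro inv_into_into) (simp add: bij_betw_def)
  then show ?thesis using assms(2) by auto
qed

text \<open>The case distinction in \<open>natural\<close> is a truncation of the index at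
  \<open>p\<close>: all points from \<open>x p\<close> on behave like \<open>x p\<close>.\<close>

lemma natural_eq_mor:
  "natural p X x \<pi> = mor X (\<lambda>v. x (\<pi> (min (inv_into {1..card X} x v) p))) X"
  by (auto simp: natural_def mor_def Let_def min_def restrict_def fun_eq_iff)

lemma relabel_injections:
  assumes "inj_on t {1..p::nat}" "inj_on t' {1..p}" "t ` {1..p} = t' ` {1..p}"
  obtains \<rho> where "\<rho> permutes {1..p}" "\<And>i. i \<in> {1..p} \<Longrightarrow> t' (\<rho> i) = t i"
proof -
  define \<rho> where "\<rho> = (\<lambda>i. if i \<in> {1..p} then inv_into {1..p} t' (t i) else i)"
  have b: "bij_betw (inv_into {1..p} t') (t ` {1..p}) {1..p}"
    using assms by (intro bij_betw_inv_into) (simp add: bij_betw_def)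
  have "bij_betw t {1..p} (t ` {1..p})" using assms by (simp add: bij_betw_def)
  from bij_betw_trans[OF this b] have "bij_betw \<rho> {1..p} {1..p}"
    by (rule bij_betw_cong[THEN iffD1, rotated]) (simp add: \<rho>_def)
  then have "\<rho> permutes {1..p}" by (rule bij_imp_permutes) (unfold \<rho>_def, rule if_not_P)
  moreover have "t' (\<rho> i) = t i" if i: "i \<in> {1..p}" for i
  proof -
    have "t i \<in> t' ` {1..p}" using i assms(3) by blast
    then show ?thesis using i by (simp add: \<rho>_def f_inv_into_f)
  qed
  ultimately show ?thesis by (rule that)
qed

text \<open>Equal kernels make \<open>f a \<mapsto> g a\<close> well defined, and equal images make
  it a permutation of the image; the labelling \<open>t\<close> carries it to \<pi>.\<close>

lemma H_related_factor:
  assumes A: "finite A" and p: "card (f ` A) = p" and im: "f ` A = g ` A"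
    and ker: "\<And>a a'. \<lbrakk>a \<in> A; a' \<in> A\<rbrakk> \<Longrightarrow> f a = f a' \<longleftrightarrow> g a = g a'"
  obtains s t \<pi> where "s ` A = {1..p}" "inj_on t {1..p}" "t ` {1..p} = f ` A" "\<pi> permutes {1..p}"
    "\<And>a. a \<in> A \<Longrightarrow> f a = t (s a)" "\<And>a. a \<in> A \<Longrightarrow> g a = t (\<pi> (s a))"
proof -
  obtain s t where st: "s ` A = {1..p}" "inj_on t {1..p}" "t ` {1..p} = f ` A"
      "\<And>a. a \<in> A \<Longrightarrow> f a = t (s a)"
    using factor_through_interval[OF A p] by metis
  define \<phi> where "\<phi> = (\<lambda>y. g (inv_into A f y))"
  have \<phi>: "\<phi> (f a) = g a" if "a \<in> A" for a
    unfolding \<phi>_def using that ker[of "inv_into A f (f a)" a]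
    by (simp add: inv_into_into f_inv_into_f)
  then have im\<phi>: "\<phi> ` f ` A = f ` A" unfolding im by (simp add: image_image flip: im)
  then have inj\<phi>: "inj_on \<phi> (f ` A)" using A by (intro eq_card_imp_inj_on) auto
  have "inj_on (\<lambda>i. \<phi> (t i)) {1..p}"
    using comp_inj_on[OF st(2), of \<phi>] inj\<phi> st(3) by (simp add: comp_def)
  moreover have "(\<lambda>i. \<phi> (t i)) ` {1..p} = t ` {1..p}"
    using im\<phi> st(3) by (simp flip: image_image)
  ultimately obtain \<rho> where \<rho>: "\<rho> permutes {1..p}" "\<And>i. i \<in> {1..p} \<Longrightarrow> t (\<rho> i) = \<phi> (t i)"
    using relabel_injections[OF _ st(2)] by metis
  have "g a = t (\<rho> (s a))" if "a \<in> A" for a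
  proof -
    have "s a \<in> {1..p}" using that st(1) by blast
    then show ?thesis using \<rho>(2) \<phi>[OF that] st(4)[OF that] by simp
  qed
  then show ?thesis using that st \<rho>(1) by blast
qed

text \<open>Coordinates on an H-class of rank \<open>p\<close>: for a fixed chart the permutations
  \<pi> of \<open>{1..p}\<close> correspond to the maps \<open>t \<circ> \<pi> \<circ> s\<close>,
  which share kernel and image with \<open>t \<circ> s\<close>.\<close>

definition chart :: "'a set set \<Rightarrow> nat \<Rightarrow> 'a set \<Rightarrow> 'a set \<Rightarrow> ('a \<Rightarrow> nat) \<Rightarrow> (nat \<Rightarrow> 'a) \<Rightarrow> bool" where
  "chart \<C> p A B s t \<longleftrightarrow>
     A \<in> \<C> \<and> B \<in> \<C> \<and> s ` A = {1..p} \<and> inj_on t {1..p} \<and> t ` {1..p} \<subseteq> B"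

definition twist :: "'a set set \<Rightarrow> nat \<Rightarrow> (nat \<Rightarrow> nat) set \<Rightarrow> 'a morph rel" where
  "twist \<C> p N = {(mor A (\<lambda>a. t (s a)) B, mor A (\<lambda>a. t (\<pi> (s a))) B) | A B s t \<pi>.
     chart \<C> p A B s t \<and> \<pi> \<in> N}"

lemma twistI:
  assumes "chart \<C> p A B s t" "\<pi> \<in> N" "\<And>a. a \<in> A \<Longrightarrow> f a = t (s a)" "\<And>a. a \<in> A \<Longrightarrow> g a = t (\<pi> (s a))"
  shows "(mor A f B, mor A g B) \<in> twist \<C> p N"
proof -
  have "mor A f B = mor A (\<lambda>a. t (s a)) B" "mor A g B = mor A (\<lambda>a. t (\<pi> (s a))) B"
    using assms by (auto intro: mor_cong)
  then show ?thesis using assms unfolding twist_def by blast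
qed

lemma twist_memD:
  assumes "(mor A f B, mor A' g B') \<in> twist \<C> p N"
  obtains s t \<pi> where "A' = A" "B' = B" "chart \<C> p A B s t" "\<pi> \<in> N"
    "\<And>a. a \<in> A \<Longrightarrow> f a = t (s a)" "\<And>a. a \<in> A \<Longrightarrow> g a = t (\<pi> (s a))"
  using assms unfolding twist_def by (auto simp: mor_eq_iff)

lemma chart_image:
  assumes "chart \<C> p A B s t" "\<pi> permutes {1..p}"
  shows "(\<lambda>a. t (\<pi> (s a))) ` A = t ` {1..p}" "card (t ` {1..p}) = p"
proof -
  have "(\<lambda>a. t (\<pi> (s a))) ` A = t ` \<pi> ` s ` A" by (simp add: image_image)
  also have "\<dots> = t ` {1..p}" using assms permutes_image[OF assms(2)] by (simp add: chart_def)
  finally show "(\<lambda>a. t (\<pi> (s a))) ` A = t ` {1..p}" .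
  show "card (t ` {1..p}) = p" using assms by (simp add: chart_def card_image)
qed

lemma chart_image_id:
  assumes "chart \<C> p A B s t"
  shows "(\<lambda>a. t (s a)) ` A = t ` {1..p}"
  using chart_image(1)[OF assms permutes_id] by simp

lemma chart_permute:
  assumes "chart \<C> p A B s t" "\<pi> permutes {1..p}"
  shows "chart \<C> p A B s (\<lambda>i. t (\<pi> i))" "chart \<C> p A B (\<lambda>a. \<pi> (s a)) t"
proof -
  have im: "\<pi> ` {1..p} = {1..p}" by (rule permutes_image[OF assms(2)])
  have "inj_on (\<lambda>i. t (\<pi> i)) {1..p}"
    using comp_inj_on[of \<pi> "{1..p}" t] permutes_inj_on[OF assms(2)] im assms(1)
    by (simp add: chart_def comp_def)
  moreover have "(\<lambda>i. t (\<pi> i)) ` {1..p} = t ` {1..p}" using im by (simp flip: image_image)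
  moreover have "(\<lambda>a. \<pi> (s a)) ` A = {1..p}" using im assms(1) by (simp add: chart_def flip: image_image)
  ultimately show "chart \<C> p A B s (\<lambda>i. t (\<pi> i))" "chart \<C> p A B (\<lambda>a. \<pi> (s a)) t"
    using assms(1) by (simp_all add: chart_def)
qed

lemma twist_in_I_set:
  assumes "(u, v) \<in> twist \<C> p N" "\<forall>\<pi>\<in>N. \<pi> permutes {1..p}" "enat p \<le> r"
  shows "u \<in> I_set \<C> r" "v \<in> I_set \<C> r" "rank u = p" "rank v = p" "psg_sim (I_psg \<C> r) u v"
proof -
  obtain A B s t \<pi> where *: "u = mor A (\<lambda>a. t (s a)) B" "v = mor A (\<lambda>a. t (\<pi> (s a))) B"
      "chart \<C> p A B s t" "\<pi> \<in> N"
    using assms(1) unfolding twist_def by blast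
  note c = chart_image_id[OF *(3)] chart_image[OF *(3) bspec[OF assms(2) *(4)]]
  show "u \<in> I_set \<C> r" "v \<in> I_set \<C> r" "rank u = p" "rank v = p" "psg_sim (I_psg \<C> r) u v"
    using * assms(3) by (simp_all add: c chart_def del: One_nat_def)
qed

section \<open>Closure properties of the twist relation\<close>

context
  fixes \<C> :: "'a set set" and p :: nat and N :: "(nat \<Rightarrow> nat) set"
  assumes N: "N \<lhd> sym_group p"
begin

lemma twist_sym:
  assumes "(u, v) \<in> twist \<C> p N"
  shows "(v, u) \<in> twist \<C> p N"
proof -
  obtain A B s t \<pi> where *: "u = mor A (\<lambda>a. t (s a)) B" "v = mor A (\<lambda>a. t (\<pi> (s a))) B"
      "chart \<C> p A B s t" "\<pi> \<in> N"
    using assms unfolding twist_def by blast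
  have \<pi>: "\<pi> permutes {1..p}" by (rule normal_sym_permutes[OF N *(4)])
  show ?thesis
    unfolding *(1,2)
    by (rule twistI[OF chart_permute(1)[OF *(3) \<pi>] normal_sym_inv[OF N *(4)]])
      (simp_all add: permutes_inverses[OF \<pi>])
qed

text \<open>The two pairs may come with different charts of the middle map. Comparing these gives a
  relabelling \<rho> with \<open>s' = \<rho> \<circ> s\<close> on \<open>A\<close>, and in the first
  chart the second twist reads \<open>inv' \<rho> \<circ> \<pi>' \<circ> \<rho>\<close>. Normality
  keeps this conjugate in \<open>N\<close>.\<close>

lemma twist_trans:
  assumes "(u, v) \<in> twist \<C> p N" "(v, w) \<in> twist \<C> p N"
  shows "(u, w) \<in> twist \<C> p N"
proof -
  obtain A B s t \<pi> where *: "u = mor A (\<lambda>a. t (s a)) B" "v = mor A (\<lambda>a. t (\<pi> (s a))) B"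
      "chart \<C> p A B s t" "\<pi> \<in> N"
    using assms(1) unfolding twist_def by blast
  obtain A' B' s' t' \<pi>' where v: "v = mor A' (\<lambda>a. t' (s' a)) B'" and w: "w = mor A' (\<lambda>a. t' (\<pi>' (s' a))) B'"
      and c': "chart \<C> p A' B' s' t'" and \<pi>'N: "\<pi>' \<in> N"
    using assms(2) unfolding twist_def by blast
  have A': "A' = A" "B' = B" and eq: "\<And>a. a \<in> A \<Longrightarrow> t (\<pi> (s a)) = t' (s' a)"
    using v *(2) by (simp_all add: mor_eq_iff)
  have \<pi>: "\<pi> permutes {1..p}" by (rule normal_sym_permutes[OF N *(4)])
  note c = chart_permute(1)[OF *(3) \<pi>]
  have "(\<lambda>a. t (\<pi> (s a))) ` A = (\<lambda>a. t' (s' a)) ` A" using eq by (intro image_cong) auto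
  then have "(\<lambda>i. t (\<pi> i)) ` {1..p} = t' ` {1..p}"
    using chart_image_id[OF c] chart_image_id[OF c'] A' by simp
  then obtain \<rho> where \<rho>: "\<rho> permutes {1..p}" "\<And>i. i \<in> {1..p} \<Longrightarrow> t' (\<rho> i) = t (\<pi> i)"
    using relabel_injections[of "\<lambda>i. t (\<pi> i)" p t'] c c' unfolding chart_def by metis
  have s': "s' a = \<rho> (s a)" if a: "a \<in> A" for a
  proof -
    have sa: "s a \<in> {1..p}" "s' a \<in> {1..p}" using *(3) c' a A' by (auto simp: chart_def)
    then have "\<rho> (s a) \<in> {1..p}" using permutes_in_image[OF \<rho>(1)] by blast
    moreover have "t' (s' a) = t' (\<rho> (s a))" using eq[OF a] \<rho>(2) sa by simp
    ultimately show ?thesis using c' sa by (auto simp: chart_def dest: inj_onD)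
  qed
  have conj: "inv' \<rho> \<circ> \<pi>' \<circ> \<rho> \<in> N"
    using normal_sym_conj[OF N \<pi>'N permutes_inv[OF \<rho>(1)]] permutes_inv_inv[OF \<rho>(1)] by simp
  have \<pi>': "\<pi>' permutes {1..p}" by (rule normal_sym_permutes[OF N \<pi>'N])
  show ?thesis
    unfolding *(1) w A'
  proof (rule twistI[OF *(3) normal_sym_comp[OF N *(4) conj]])
    fix a assume a: "a \<in> A"
    let ?i = "inv' \<rho> (\<pi>' (\<rho> (s a)))"
    have "s a \<in> {1..p}" using *(3) a by (auto simp: chart_def)
    then have "?i \<in> {1..p}"
      using permutes_in_image[OF \<rho>(1)] permutes_in_image[OF \<pi>'] permutes_in_image[OF permutes_inv[OF \<rho>(1)]]
      by blast
    from \<rho>(2)[OF this] show "t' (\<pi>' (s' a)) = t ((\<pi> \<circ> (inv' \<rho> \<circ> \<pi>' \<circ> \<rho>)) (s a))"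
      using s'[OF a] permutes_inverses(1)[OF \<rho>(1)] by simp
  qed simp
qed

text \<open>Whether the rank drops is decided by \<open>s \<circ> h\<close> alone, so it drops for
  both maps or for neither. If \<open>s \<circ> h\<close> is still onto, it gives a chart with the
  same \<pi>.\<close>

lemma twist_left:
  assumes tw: "(mor A f B, mor A g B) \<in> twist \<C> p N" and Z: "Z \<in> \<C>" "finite Z" "h ` Z \<subseteq> A"
  shows "(mor Z (f \<circ> h) B, mor Z (g \<circ> h) B) \<in> twist \<C> p N \<or>
    card ((f \<circ> h) ` Z) < p \<and> card ((g \<circ> h) ` Z) < p"
proof -
  obtain s t \<pi> where *: "chart \<C> p A B s t" "\<pi> \<in> N"
    "\<And>a. a \<in> A \<Longrightarrow> f a = t (s a)" "\<And>a. a \<in> A \<Longrightarrow> g a = t (\<pi> (s a))"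
    using tw by (elim twist_memD) auto
  have fh: "(f \<circ> h) z = t (s (h z))" "(g \<circ> h) z = t (\<pi> (s (h z)))" if "z \<in> Z" for z
    using that Z(3) * by auto
  show ?thesis
  proof (cases "(\<lambda>z. s (h z)) ` Z = {1..p}")
    case True
    then have "chart \<C> p Z B (\<lambda>z. s (h z)) t" using *(1) Z by (simp add: chart_def)
    then have "(mor Z (f \<circ> h) B, mor Z (g \<circ> h) B) \<in> twist \<C> p N"
      by (rule twistI[OF _ *(2)]) (use fh in auto)
    then show ?thesis ..
  next
    case False
    moreover have "(\<lambda>z. s (h z)) ` Z \<subseteq> {1..p}" using *(1) Z by (auto simp: chart_def)
    ultimately have "card ((\<lambda>z. s (h z)) ` Z) < card {1..p}" by (intro psubset_card_mono) auto
    then have lt: "card ((\<lambda>z. s (h z)) ` Z) < p" by simp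
    have "(f \<circ> h) ` Z = t ` (\<lambda>z. s (h z)) ` Z" "(g \<circ> h) ` Z = (\<lambda>i. t (\<pi> i)) ` (\<lambda>z. s (h z)) ` Z"
      using fh by (auto simp: image_image intro!: image_cong)
    then show ?thesis
      using lt Z(2) by (auto intro: le_less_trans[OF card_image_le])
  qed
qed

text \<open>Both maps have the same image. If \<open>b\<close> is injective there,
  \<open>b \<circ> t\<close> gives a chart with the same \<pi>; otherwise both ranks drop.\<close>

lemma twist_right:
  assumes tw: "(mor A f B, mor A g B) \<in> twist \<C> p N" and D: "D \<in> \<C>" "b ` B \<subseteq> D"
  shows "(mor A (b \<circ> f) D, mor A (b \<circ> g) D) \<in> twist \<C> p N \<or>
    card ((b \<circ> f) ` A) < p \<and> card ((b \<circ> g) ` A) < p"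
proof -
  obtain s t \<pi> where *: "chart \<C> p A B s t" "\<pi> \<in> N"
    "\<And>a. a \<in> A \<Longrightarrow> f a = t (s a)" "\<And>a. a \<in> A \<Longrightarrow> g a = t (\<pi> (s a))"
    using tw by (elim twist_memD) auto
  have \<pi>: "\<pi> permutes {1..p}" by (rule normal_sym_permutes[OF N *(2)])
  have bf: "(b \<circ> f) a = b (t (s a))" "(b \<circ> g) a = b (t (\<pi> (s a)))" if "a \<in> A" for a
    using that * by auto
  show ?thesis
  proof (cases "inj_on b (t ` {1..p})")
    case True
    then have "chart \<C> p A D s (\<lambda>i. b (t i))"
      using *(1) D comp_inj_on[of t "{1..p}" b] unfolding chart_def comp_def image_subset_iff by blast
    then have "(mor A (b \<circ> f) D, mor A (b \<circ> g) D) \<in> twist \<C> p N"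
      by (rule twistI[OF _ *(2)]) (use bf in auto)
    then show ?thesis ..
  next
    case False
    then have "card (b ` t ` {1..p}) \<noteq> card (t ` {1..p})" using eq_card_imp_inj_on by blast
    moreover have "card (b ` t ` {1..p}) \<le> card (t ` {1..p})" by (intro card_image_le) simp
    ultimately have lt: "card (b ` t ` {1..p}) < p" using chart_image(2)[OF *(1) \<pi>] by simp
    have "(b \<circ> f) ` A = b ` (\<lambda>a. t (s a)) ` A" "(b \<circ> g) ` A = b ` (\<lambda>a. t (\<pi> (s a))) ` A"
      using bf by (auto simp: image_image intro!: image_cong)
    then show ?thesis
      using lt chart_image_id[OF *(1)] chart_image(1)[OF *(1) \<pi>] by simp
  qed
qed

end

text \<open>An adjoined identity acts as the identity function. Hence no rank bound is claimed for
  \<open>h\<close>: identities are adjoined where the ideal has none of its own, and the identity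
  function there may well exceed rank \<open>r\<close>.\<close>

lemma adjoin_ids_left:
  assumes "a \<in> carrier (adjoin_ids (I_psg \<C> r))" "rg (adjoin_ids (I_psg \<C> r)) a = A" "A \<in> \<C>"
  obtains Z h where "Z \<in> \<C>" "h ` Z \<subseteq> A"
    "\<And>f B. f ` A \<subseteq> B \<Longrightarrow>
      a \<cdot>\<^bsub>adjoin_ids (I_psg \<C> r)\<^esub> Inl (mor A f B) = Inl (mor Z (\<lambda>z. f (h z)) B)"
proof -
  from assms(1) consider m where "m \<in> I_set \<C> r" "a = Inl m" | A' where "a = Inr A'" "A' \<in> \<C>"
    by (auto simp: adjoin_ids_def)
  then show ?thesis
  proof cases
    case 1
    then obtain Z h D where m: "m = mor Z h D" "Z \<in> \<C>" "h ` Z \<subseteq> D" by (auto elim: I_setE)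
    then have "D = A" using assms(2) 1 by (simp add: adjoin_ids_def)
    then show ?thesis using m 1 by (intro that[of Z h]) (simp_all add: adjoin_ids_def comp_def)
  next
    case 2
    then have "A' = A" using assms(2) by (simp add: adjoin_ids_def)
    then show ?thesis using 2 assms by (intro that[of A "\<lambda>z. z"]) (simp_all add: adjoin_ids_def)
  qed
qed

lemma adjoin_ids_right:
  assumes "b \<in> carrier (adjoin_ids (I_psg \<C> r))" "dm (adjoin_ids (I_psg \<C> r)) b = B" "B \<in> \<C>"
  obtains D k where "D \<in> \<C>" "k ` B \<subseteq> D"
    "\<And>A f. f ` A \<subseteq> B \<Longrightarrow>
      Inl (mor A f B) \<cdot>\<^bsub>adjoin_ids (I_psg \<C> r)\<^esub> b = Inl (mor A (\<lambda>z. k (f z)) D)"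
proof -
  from assms(1) consider m where "m \<in> I_set \<C> r" "b = Inl m" | B' where "b = Inr B'" "B' \<in> \<C>"
    by (auto simp: adjoin_ids_def)
  then show ?thesis
  proof cases
    case 1
    then obtain B' k D where m: "m = mor B' k D" "D \<in> \<C>" "k ` B' \<subseteq> D" by (auto elim: I_setE)
    then have "B' = B" using assms(2) 1 by (simp add: adjoin_ids_def)
    then show ?thesis using m 1 by (intro that[of D k]) (simp_all add: adjoin_ids_def comp_def)
  next
    case 2
    then have "B' = B" using assms(2) by (simp add: adjoin_ids_def)
    then show ?thesis using 2 assms by (intro that[of B "\<lambda>z. z"]) (simp_all add: adjoin_ids_def)
  qed
qed

text \<open>The functions \<open>h\<close> and \<open>k\<close> come from the multipliers alone, so
  one choice computes the products for all middle factors. This is what \<open>nu\<close> asks for,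
  which compares two products with the same \<open>a\<close> and \<open>b\<close>.\<close>

lemma two_sidedE:
  assumes "a \<in> carrier (adjoin_ids (I_psg \<C> r))" "b \<in> carrier (adjoin_ids (I_psg \<C> r))"
    and "two_sided (I_psg \<C> r) a (mor A f B) b z" "A \<in> \<C>" "B \<in> \<C>" "f ` A \<subseteq> B"
  obtains Z h D k where "Z \<in> \<C>" "h ` Z \<subseteq> A" "D \<in> \<C>" "k ` B \<subseteq> D"
    "\<And>g w. g ` A \<subseteq> B \<Longrightarrow> two_sided (I_psg \<C> r) a (mor A g B) b w \<Longrightarrow>
       w = mor Z (\<lambda>z. k (g (h z))) D"
proof -
  from assms(3) have ra: "rg (adjoin_ids (I_psg \<C> r)) a = A" and db: "dm (adjoin_ids (I_psg \<C> r)) b = B"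
    by (simp_all add: two_sided_def)
  obtain Z h where Zh: "Z \<in> \<C>" "h ` Z \<subseteq> A" "\<And>f B. f ` A \<subseteq> B \<Longrightarrow>
      a \<cdot>\<^bsub>adjoin_ids (I_psg \<C> r)\<^esub> Inl (mor A f B) = Inl (mor Z (\<lambda>z. f (h z)) B)"
    using adjoin_ids_left[OF assms(1) ra assms(4)] by metis
  obtain D k where Dk: "D \<in> \<C>" "k ` B \<subseteq> D" "\<And>A f. f ` A \<subseteq> B \<Longrightarrow>
      Inl (mor A f B) \<cdot>\<^bsub>adjoin_ids (I_psg \<C> r)\<^esub> b = Inl (mor A (\<lambda>z. k (f z)) D)"
    using adjoin_ids_right[OF assms(2) db assms(5)] by metis
  have "w = mor Z (\<lambda>z. k (g (h z))) D"
    if "g ` A \<subseteq> B" "two_sided (I_psg \<C> r) a (mor A g B) b w" for g w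
  proof -
    have "(\<lambda>z. g (h z)) ` Z \<subseteq> B" using that(1) Zh(2) by auto
    then show ?thesis using that Zh(3)[OF that(1)] Dk(3) by (simp add: two_sided_def)
  qed
  then show ?thesis using that Zh(1,2) Dk(1,2) by blast
qed

lemma nuI:
  assumes "x \<in> N" "y \<in> N" "a \<in> carrier (adjoin_ids S)" "b \<in> carrier (adjoin_ids S)"
    and "two_sided S a x b u" "two_sided S a y b v"
    and "u \<in> (\<Union>n\<in>N. J_class S n)" "v \<in> (\<Union>n\<in>N. J_class S n)"
  shows "(u, v) \<in> nu S N"
  unfolding nu_def using assms by (simp del: UN_iff) blast

lemma two_sidedI:
  assumes "mor Z h A \<in> I_set \<C> r" "mor B k D \<in> I_set \<C> r" "f ` A \<subseteq> B"
  shows "two_sided (I_psg \<C> r) (Inl (mor Z h A)) (mor A f B) (Inl (mor B k D)) (mor Z (\<lambda>z. k (f (h z))) D)"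
proof -
  have "(f \<circ> h) ` Z \<subseteq> B" using assms by auto
  then show ?thesis using assms by (simp add: two_sided_def adjoin_ids_def comp_def)
qed

section \<open>Principal ideals, J-classes and the identification of \<open>nu\<close>\<close>

context
  fixes \<C> :: "'a set set" and r :: enat
  assumes members: "\<And>A. A \<in> \<C> \<Longrightarrow> finite A \<and> A \<noteq> {}"
begin

text \<open>Rank cannot grow under multiplication. Conversely, a map \<open>w\<close> of rank
  \<open>l\<close>, not above that of \<open>f\<close>, is recovered as
  \<open>b \<circ> f \<circ> e \<circ> s\<close>, where \<open>e\<close> picks \<open>l\<close>
  points separated by \<open>f\<close>. Both multipliers have rank at most \<open>l\<close>, so they
  lie in \<open>I_set \<C> r\<close>.\<close>

lemma principal_ideal_mor:
  assumes f: "mor A f B \<in> I_set \<C> r"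
  shows "principal_ideal (I_psg \<C> r) (mor A f B) = {w \<in> I_set \<C> r. rank w \<le> card (f ` A)}"
proof
  have fin: "finite A" using f members by auto
  show "principal_ideal (I_psg \<C> r) (mor A f B) \<subseteq> {w \<in> I_set \<C> r. rank w \<le> card (f ` A)}"
  proof
    fix w assume "w \<in> principal_ideal (I_psg \<C> r) (mor A f B)"
    then obtain a b where ab: "a \<in> carrier (adjoin_ids (I_psg \<C> r))" "b \<in> carrier (adjoin_ids (I_psg \<C> r))"
        "two_sided (I_psg \<C> r) a (mor A f B) b w"
      by (auto simp: principal_ideal_def)
    obtain Z h D k where *: "Z \<in> \<C>" "h ` Z \<subseteq> A" "D \<in> \<C>" "k ` B \<subseteq> D" and w: "w = mor Z (\<lambda>z. k (f (h z))) D"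
      using two_sidedE[OF ab] f ab(3) by (metis mor_in_I_set)
    have "(\<lambda>z. k (f (h z))) ` Z \<subseteq> k ` f ` A" using * by auto
    then have "card ((\<lambda>z. k (f (h z))) ` Z) \<le> card (k ` f ` A)" using fin by (intro card_mono) auto
    also have "\<dots> \<le> card (f ` A)" using fin by (intro card_image_le) auto
    finally have le: "card ((\<lambda>z. k (f (h z))) ` Z) \<le> card (f ` A)" .
    moreover have "(\<lambda>z. k (f (h z))) ` Z \<subseteq> D"
      using * f unfolding mor_in_I_set image_subset_iff by blast
    ultimately show "w \<in> {w \<in> I_set \<C> r. rank w \<le> card (f ` A)}"
      using w * f enat_le_trans[OF le] by simp
  qed
  show "{w \<in> I_set \<C> r. rank w \<le> card (f ` A)} \<subseteq> principal_ideal (I_psg \<C> r) (mor A f B)"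
  proof
    fix m assume "m \<in> {w \<in> I_set \<C> r. rank w \<le> card (f ` A)}"
    then obtain Z w D where m: "m = mor Z w D" and w: "Z \<in> \<C>" "D \<in> \<C>" "w ` Z \<subseteq> D" "enat (card (w ` Z)) \<le> r"
        "card (w ` Z) \<le> card (f ` A)"
      by (auto elim!: I_setE)
    define l where "l = card (w ` Z)"
    have Z: "finite Z" "Z \<noteq> {}" using w members by auto
    obtain s t where st: "s ` Z = {1..l}" "inj_on t {1..l}" "t ` {1..l} = w ` Z" "\<And>z. z \<in> Z \<Longrightarrow> w z = t (s z)"
      using factor_through_interval[OF Z(1) l_def[symmetric]] by metis
    have ne: "{1..l} \<noteq> {}" using Z(2) st(1) by blast
    obtain T where T: "T \<subseteq> f ` A" "card T = l" using w(5) l_def by (metis obtain_subset_with_card_n)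
    then have "finite T" using fin by (metis finite_imageI finite_subset)
    then obtain y where y: "bij_betw y {1..l} T"
      using T(2) finite_same_card_bij[of "{1..l}" T] by auto
    define e where "e = (\<lambda>i. inv_into A f (y i))"
    have e: "e i \<in> A" "f (e i) = y i" if "i \<in> {1..l}" for i
    proof -
      have "y i \<in> f ` A" using that y T(1) by (auto simp: bij_betw_def)
      then show "e i \<in> A" "f (e i) = y i" by (simp_all add: e_def inv_into_into f_inv_into_f)
    qed
    have "inj_on (\<lambda>i. f (e i)) {1..l}"
      using bij_betw_imp_inj_on[OF y] by (rule inj_on_cong[THEN iffD1, rotated]) (simp add: e(2))
    then obtain b where b: "\<And>i. i \<in> {1..l} \<Longrightarrow> b (f (e i)) = t i" "range b \<subseteq> t ` {1..l}"
      using extend_from_image[OF _ ne, of "\<lambda>i. f (e i)" t] by metis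
    have "(\<lambda>z. e (s z)) ` Z = e ` {1..l}" using st(1) by (simp flip: image_image)
    moreover have "card (e ` {1..l}) \<le> l" using card_image_le[of "{1..l}" e] by simp
    moreover have "e ` {1..l} \<subseteq> A" using e(1) by blast
    ultimately have h: "mor Z (\<lambda>z. e (s z)) A \<in> I_set \<C> r"
      using f w enat_le_trans[of "card (e ` {1..l})" l r] l_def by simp
    have "b ` B \<subseteq> D" using b(2) st(3) w(3) by blast
    then have k: "mor B b D \<in> I_set \<C> r"
      using f w l_def card_image_range_le[OF b(2), of r B] by simp
    have "b (f (e (s z))) = w z" if "z \<in> Z" for z
    proof -
      have "s z \<in> {1..l}" using that st(1) by blast
      then show ?thesis using b(1) st(4)[OF that] by simp
    qed
    then have "mor Z (\<lambda>z. b (f (e (s z)))) D = m" unfolding m by (rule mor_cong)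
    then have "two_sided (I_psg \<C> r) (Inl (mor Z (\<lambda>z. e (s z)) A)) (mor A f B) (Inl (mor B b D)) m"
      using two_sidedI[OF h k, of f] f by simp
    moreover have "Inl (mor Z (\<lambda>z. e (s z)) A) \<in> carrier (adjoin_ids (I_psg \<C> r))"
      "Inl (mor B b D) \<in> carrier (adjoin_ids (I_psg \<C> r))"
      using h k by (simp_all add: adjoin_ids_def del: mor_in_I_set)
    ultimately show "m \<in> principal_ideal (I_psg \<C> r) (mor A f B)"
      unfolding principal_ideal_def by blast
  qed
qed

lemma J_class_eq:
  assumes "m \<in> I_set \<C> r"
  shows "J_class (I_psg \<C> r) m = {w \<in> I_set \<C> r. rank w = rank m}"
proof -
  have pi: "principal_ideal (I_psg \<C> r) w = {u \<in> I_set \<C> r. rank u \<le> rank w}" if wI: "w \<in> I_set \<C> r" for w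
  proof -
      obtain A f B where w: "w = mor A f B" using I_setE[OF wI] by metis
    show ?thesis using principal_ideal_mor[of A f B] wI unfolding w by simp
  qed
  have "principal_ideal (I_psg \<C> r) w = principal_ideal (I_psg \<C> r) m \<longleftrightarrow> rank w = rank m"
    if w: "w \<in> I_set \<C> r" for w
  proof
    assume "principal_ideal (I_psg \<C> r) w = principal_ideal (I_psg \<C> r) m"
    then have eq: "u \<in> I_set \<C> r \<and> rank u \<le> rank w \<longleftrightarrow> u \<in> I_set \<C> r \<and> rank u \<le> rank m" for u
      unfolding pi[OF w] pi[OF assms] by blast
    show "rank w = rank m" using eq[of w] eq[of m] w assms by simp
  qed (simp add: pi w assms)
  then show ?thesis by (auto simp: J_class_def)
qed

text \<open>The truncated index \<open>c\<close> is a left inverse of \<open>x\<close> on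
  \<open>{1..p}\<close>, so each member of the group is \<open>x \<circ> \<pi> \<circ> c\<close>.
  Multipliers with functions \<open>h\<close> and \<open>k\<close> turn it into
  \<open>k \<circ> x \<circ> \<pi> \<circ> c \<circ> h\<close>, and rank \<open>p\<close> of the
  product forces a chart. Conversely, a chart \<open>s\<close>, \<open>t\<close> is reached by
  multiplying with \<open>x \<circ> s\<close> on the left and \<open>t \<circ> c\<close> on the
  right.\<close>

lemma nu_eq_twist:
  assumes X: "X \<in> \<C>" "p \<le> card X" "bij_betw x {1..card X} X" and p: "1 \<le> p" "enat p \<le> r"
    and N: "N \<lhd> sym_group p"
  shows "nu (I_psg \<C> r) (natural p X x ` N) = twist \<C> p N"
proof -
  define c where "c = (\<lambda>v. min (inv_into {1..card X} x v) p)"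
  have nat: "natural p X x \<pi> = mor X (\<lambda>v. x (\<pi> (c v))) X" for \<pi>
    by (simp add: natural_eq_mor c_def)
  have c_mem: "c v \<in> {1..p}" if "v \<in> X" for v
    unfolding c_def by (rule min_index_mem[OF X(3) p(1) that])
  have sub: "{1..p} \<subseteq> {1..card X}" using X(2) by auto
  have cx: "c (x i) = i" if "i \<in> {1..p}" for i
    using that sub X(3) by (auto simp: c_def bij_betw_def inv_into_f_f)
  have xX: "x i \<in> X" if "i \<in> {1..p}" for i
    using that sub X(3) by (auto simp: bij_betw_def)
  have cX: "c ` X = {1..p}"
  proof
    show "c ` X \<subseteq> {1..p}" using c_mem by blast
    show "{1..p} \<subseteq> c ` X" using cx xX by (metis image_eqI subsetI)
  qed
  have injx: "inj_on x {1..p}" using X(3) sub by (auto simp: bij_betw_def intro: inj_on_subset)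
  have ch: "chart \<C> p X X c x" using X(1) cX injx xX by (auto simp: chart_def)
  have perm: "\<pi> permutes {1..p}" if "\<pi> \<in> N" for \<pi> by (rule normal_sym_permutes[OF N that])
  have nat_img: "(\<lambda>v. x (\<pi> (c v))) ` X = x ` {1..p}" and cardx: "card (x ` {1..p}) = p" if "\<pi> \<in> N" for \<pi>
    using chart_image[OF ch perm[OF that]] by simp_all
  have natI: "natural p X x \<pi> \<in> I_set \<C> r" "rank (natural p X x \<pi>) = p" if "\<pi> \<in> N" for \<pi>
    unfolding nat using nat_img[OF that] cardx[OF that] X(1) p(2) xX by auto
  have D: "(\<Union>n\<in>natural p X x ` N. J_class (I_psg \<C> r) n) = {w \<in> I_set \<C> r. rank w = p}"
    using normal_sym_id[OF N] natI by (auto simp: J_class_eq)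
  show ?thesis
  proof
    show "nu (I_psg \<C> r) (natural p X x ` N) \<subseteq> twist \<C> p N"
    proof
      fix uv assume "uv \<in> nu (I_psg \<C> r) (natural p X x ` N)"
      then obtain u v \<pi>1 \<pi>2 a b where uv: "uv = (u, v)" and \<pi>: "\<pi>1 \<in> N" "\<pi>2 \<in> N"
        and ab: "a \<in> carrier (adjoin_ids (I_psg \<C> r))" "b \<in> carrier (adjoin_ids (I_psg \<C> r))"
        and ts: "two_sided (I_psg \<C> r) a (mor X (\<lambda>v. x (\<pi>1 (c v))) X) b u"
          "two_sided (I_psg \<C> r) a (mor X (\<lambda>v. x (\<pi>2 (c v))) X) b v"
        and u: "u \<in> I_set \<C> r" "rank u = p"
        unfolding nu_def D by (auto simp: nat)
      have im: "(\<lambda>v. x (\<pi> (c v))) ` X \<subseteq> X" if "\<pi> \<in> N" for \<pi>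
        using nat_img[OF that] xX by auto
      obtain Z h E k where Z: "Z \<in> \<C>" "h ` Z \<subseteq> X" and E: "E \<in> \<C>" "k ` X \<subseteq> E"
        and prod: "\<And>g w. g ` X \<subseteq> X \<Longrightarrow> two_sided (I_psg \<C> r) a (mor X g X) b w \<Longrightarrow>
          w = mor Z (\<lambda>z. k (g (h z))) E"
        by (rule two_sidedE[OF ab ts(1) X(1) X(1) im[OF \<pi>(1)]]) blast
      note u' = prod[OF im[OF \<pi>(1)] ts(1)] and v' = prod[OF im[OF \<pi>(2)] ts(2)]
      \<comment> \<open>The first permutation is absorbed into \<open>s\<close>, so that
        \<open>u\<close> is the untwisted map of the chart and \<open>v\<close> its twist by
        \<open>\<pi>2 \<circ> inv' \<pi>1\<close>.\<close>
      define s where "s = (\<lambda>z. \<pi>1 (c (h z)))"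
      have sZ: "s ` Z \<subseteq> {1..p}"
        using Z(2) c_mem permutes_in_image[OF perm[OF \<pi>(1)]] by (auto simp: s_def)
      have "card ((\<lambda>i. k (x i)) ` s ` Z) = p" using u(2) u' by (simp add: s_def image_image)
      moreover have fs: "finite (s ` Z)" using sZ finite_subset by blast
      ultimately have "p \<le> card (s ` Z)" using card_image_le[OF fs, of "\<lambda>i. k (x i)"] by simp
      then have sZ': "s ` Z = {1..p}" using sZ by (intro card_seteq) auto
      then have "inj_on (\<lambda>i. k (x i)) {1..p}"
        using \<open>card ((\<lambda>i. k (x i)) ` s ` Z) = p\<close> by (intro eq_card_imp_inj_on) auto
      then have ch': "chart \<C> p Z E s (\<lambda>i. k (x i))"
        using Z E sZ' xX by (auto simp: chart_def)
      show "uv \<in> twist \<C> p N"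
        unfolding uv u' v'
        by (rule twistI[OF ch' normal_sym_comp[OF N \<pi>(2) normal_sym_inv[OF N \<pi>(1)]]])
          (simp_all add: s_def permutes_inverses(2)[OF perm[OF \<pi>(1)]])
    qed
    show "twist \<C> p N \<subseteq> nu (I_psg \<C> r) (natural p X x ` N)"
    proof
      fix uv assume tw: "uv \<in> twist \<C> p N"
      then obtain A B s t \<pi> where uv: "uv = (mor A (\<lambda>a. t (s a)) B, mor A (\<lambda>a. t (\<pi> (s a))) B)"
          and ct: "chart \<C> p A B s t" and \<pi>: "\<pi> \<in> N"
        unfolding twist_def by blast
      have st: "A \<in> \<C>" "B \<in> \<C>" "s ` A = {1..p}" "inj_on t {1..p}" "t ` {1..p} \<subseteq> B"
        using ct by (simp_all add: chart_def)
      have "(\<lambda>a. x (s a)) ` A = x ` {1..p}" using st(3) by (simp flip: image_image)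
      then have h: "mor A (\<lambda>a. x (s a)) X \<in> I_set \<C> r"
        using st X(1) xX cardx[OF \<pi>] p(2) by auto
      have "(\<lambda>v. t (c v)) ` X = t ` {1..p}" using cX by (simp flip: image_image)
      then have k: "mor X (\<lambda>v. t (c v)) B \<in> I_set \<C> r"
        using st X(1) p(2) by (simp add: card_image)
      have ts: "two_sided (I_psg \<C> r) (Inl (mor A (\<lambda>a. x (s a)) X)) (natural p X x \<rho>) (Inl (mor X (\<lambda>v. t (c v)) B))
          (mor A (\<lambda>a. t (\<rho> (s a))) B)" if \<rho>: "\<rho> \<in> N" for \<rho>
      proof -
        have eq: "mor A (\<lambda>a. t (c (x (\<rho> (c (x (s a))))))) B = mor A (\<lambda>a. t (\<rho> (s a))) B"
        proof (rule mor_cong)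
          fix a assume "a \<in> A"
          then have "s a \<in> {1..p}" using st(3) by blast
          moreover from this have "\<rho> (s a) \<in> {1..p}" using permutes_in_image[OF perm[OF \<rho>]] by blast
          ultimately show "t (c (x (\<rho> (c (x (s a)))))) = t (\<rho> (s a))" by (simp add: cx)
        qed
        have "(\<lambda>v. x (\<rho> (c v))) ` X \<subseteq> X" using nat_img[OF \<rho>] xX by auto
        from two_sidedI[OF h k this] show ?thesis unfolding nat eq .
      qed
      have ad: "Inl (mor A (\<lambda>a. x (s a)) X) \<in> carrier (adjoin_ids (I_psg \<C> r))"
        "Inl (mor X (\<lambda>v. t (c v)) B) \<in> carrier (adjoin_ids (I_psg \<C> r))"
        using h k by (simp_all add: adjoin_ids_def del: mor_in_I_set)
      have "\<forall>\<pi>\<in>N. \<pi> permutes {1..p}" using perm by blast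
      note mem = twist_in_I_set[OF tw[unfolded uv] this p(2)]
      show "uv \<in> nu (I_psg \<C> r) (natural p X x ` N)"
        unfolding uv
      proof (rule nuI[OF imageI[OF normal_sym_id[OF N]] imageI[OF \<pi>] ad])
        show "two_sided (I_psg \<C> r) (Inl (mor A (\<lambda>a. x (s a)) X)) (natural p X x id)
            (Inl (mor X (\<lambda>v. t (c v)) B)) (mor A (\<lambda>a. t (s a)) B)"
          using ts[OF normal_sym_id[OF N]] by simp
        show "mor A (\<lambda>a. t (s a)) B \<in> (\<Union>n\<in>natural p X x ` N. J_class (I_psg \<C> r) n)"
          unfolding D using mem(1,3) by blast
        show "mor A (\<lambda>a. t (\<pi> (s a))) B \<in> (\<Union>n\<in>natural p X x ` N. J_class (I_psg \<C> r) n)"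
          unfolding D using mem(2,4) by blast
      qed (rule ts[OF \<pi>])
    qed
  qed
qed

end

section \<open>Classification of the congruences\<close>

text \<open>This is \<open>Rees_normal\<close> with \<open>nu\<close> replaced by
  \<open>twist\<close>. The group has degree \<open>q + 1\<close>, the least rank outside the ideal
  of maps of rank at most \<open>q\<close>.\<close>

definition Rees_twist :: "'a set set \<Rightarrow> enat \<Rightarrow> nat \<Rightarrow> (nat \<Rightarrow> nat) set \<Rightarrow> 'a morph rel" where
  "Rees_twist \<C> r q N =
     {(u, v). u \<in> I_set \<C> r \<and> v \<in> I_set \<C> r \<and> psg_sim (I_psg \<C> r) u v \<and>
        (rank u \<le> q \<and> rank v \<le> q \<or> u = v \<or> (u, v) \<in> twist \<C> (q + 1) N)}"

lemma Rees_twist_mor: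
  "(mor A f B, mor A' g B') \<in> Rees_twist \<C> r q N \<longleftrightarrow>
     A' = A \<and> B' = B \<and> mor A f B \<in> I_set \<C> r \<and> mor A g B \<in> I_set \<C> r \<and>
     (card (f ` A) \<le> q \<and> card (g ` A) \<le> q \<or> mor A f B = mor A g B \<or>
      (mor A f B, mor A g B) \<in> twist \<C> (q + 1) N)"
  unfolding Rees_twist_def by (auto simp del: mor_in_I_set)

lemma Rees_twist_subset:
  assumes "q < q'" "\<forall>\<pi>\<in>N. \<pi> permutes {1..q + 1}" "enat q < r"
  shows "Rees_twist \<C> r q N \<subseteq> Rees_twist \<C> r q' N'"
proof -
  have "enat (q + 1) \<le> r" using assms(3) Suc_ile_eq[of q r] by simp
  then have "rank u \<le> q' \<and> rank v \<le> q'" if "(u, v) \<in> twist \<C> (q + 1) N" for u v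
    using twist_in_I_set(3,4)[OF that assms(2)] assms(1) by auto
  then show ?thesis
    using assms(1) unfolding Rees_twist_def by fastforce
qed

lemma twist_mono: "N \<subseteq> N' \<Longrightarrow> twist \<C> p N \<subseteq> twist \<C> p N'"
  unfolding twist_def by blast

lemma Rees_twist_mono: "N \<subseteq> N' \<Longrightarrow> Rees_twist \<C> r q N \<subseteq> Rees_twist \<C> r q N'"
  using twist_mono unfolding Rees_twist_def by blast

lemma Nabla_mor:
  "(mor A f B, mor A' g B') \<in> Nabla (I_psg \<C> r) \<longleftrightarrow>
     A' = A \<and> B' = B \<and> mor A f B \<in> I_set \<C> r \<and> mor A g B \<in> I_set \<C> r"
  unfolding Nabla_def by (auto simp del: mor_in_I_set)

lemma Delta_mor:
  "(mor A f B, mor A' g B') \<in> Delta (I_psg \<C> r) \<longleftrightarrow>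
     A' = A \<and> B' = B \<and> mor A f B \<in> I_set \<C> r \<and> mor A f B = mor A g B"
  unfolding Delta_def Id_on_iff by (auto simp: mor_eq_iff simp del: mor_in_I_set)

section \<open>The listed relations are congruences\<close>

context
  fixes \<C> :: "'a set set" and r :: enat
  assumes members: "\<And>A. A \<in> \<C> \<Longrightarrow> finite A \<and> A \<noteq> {}"
begin

lemma comp_left_in_I_set:
  assumes f: "mor A f B \<in> I_set \<C> r" and h: "Z \<in> \<C>" "h ` Z \<subseteq> A"
  shows "card ((f \<circ> h) ` Z) \<le> card (f ` A)" "mor Z (f \<circ> h) B \<in> I_set \<C> r"
proof -
  have sub: "(f \<circ> h) ` Z \<subseteq> f ` A" using h(2) by auto
  moreover have "finite A" "f ` A \<subseteq> B" using f members by simp_all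
  ultimately show le: "card ((f \<circ> h) ` Z) \<le> card (f ` A)" by (intro card_mono) auto
  show "mor Z (f \<circ> h) B \<in> I_set \<C> r"
    unfolding mor_in_I_set using f h(1) subset_trans[OF sub] enat_le_trans[OF le] by simp
qed

lemma comp_right_in_I_set:
  assumes f: "mor A f B \<in> I_set \<C> r" and b: "D \<in> \<C>" "b ` B \<subseteq> D"
  shows "card ((b \<circ> f) ` A) \<le> card (f ` A)" "mor A (b \<circ> f) D \<in> I_set \<C> r"
proof -
  have "finite A" and fB: "f ` A \<subseteq> B" using f members by simp_all
  then show le: "card ((b \<circ> f) ` A) \<le> card (f ` A)"
    using card_image_le[of "f ` A" b] by (simp add: image_comp)
  have "(b \<circ> f) ` A \<subseteq> D" using fB b(2) by auto
  then show "mor A (b \<circ> f) D \<in> I_set \<C> r"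
    unfolding mor_in_I_set using f b(1) enat_le_trans[OF le] by simp
qed

lemma Rees_normal_eq_Rees_twist:
  assumes q: "enat q < r" and N: "N \<lhd> sym_group (q + 1)"
    and X: "X \<in> \<C>" "q + 1 \<le> card X" "bij_betw x {1..card X} X"
  shows "Rees_normal (I_psg \<C> r) (I_set \<C> (enat q)) (natural (q + 1) X x ` N) = Rees_twist \<C> r q N"
proof -
  have qr: "enat (q + 1) \<le> r" using q Suc_ile_eq[of q r] by simp
  have nu: "nu (I_psg \<C> r) (natural (q + 1) X x ` N) = twist \<C> (q + 1) N"
    by (rule nu_eq_twist[OF members X _ qr N]) auto
  have I: "u \<in> I_set \<C> (enat q) \<longleftrightarrow> u \<in> I_set \<C> r \<and> rank u \<le> q" for u
    using enat_le_trans[of "rank u" q r] q by (auto simp: I_set_def)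
  have perm: "\<forall>\<pi>\<in>N. \<pi> permutes {1..q + 1}" using normal_sym_permutes[OF N] by blast
  have "(u, v) \<in> Rees_normal (I_psg \<C> r) (I_set \<C> (enat q)) (natural (q + 1) X x ` N) \<longleftrightarrow>
      (u, v) \<in> Rees_twist \<C> r q N" for u v
    using twist_in_I_set[OF _ perm qr, of u v]
    unfolding Rees_normal_def nu Rees_def Nabla_def Delta_def Rees_twist_def psg_sim_def
    by (auto simp: I Id_on_iff)
  then show ?thesis by auto
qed

text \<open>Transitivity holds because twisted pairs have rank exactly \<open>q + 1\<close>, so they
  never meet a pair inside the ideal. Under a multiplier a twisted pair stays twisted or falls into
  the ideal on both sides at once.\<close>

lemma Rees_twist_Cong:
  assumes N: "N \<lhd> sym_group (q + 1)"
  shows "Rees_twist \<C> r q N \<in> Cong (I_psg \<C> r)"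
proof (rule Cong_I_psgI)
  show "equiv (I_set \<C> r) (Rees_twist \<C> r q N)"
  proof (rule equivI)
    show "Rees_twist \<C> r q N \<subseteq> I_set \<C> r \<times> I_set \<C> r" by (auto simp: Rees_twist_def)
    show "refl_on (I_set \<C> r) (Rees_twist \<C> r q N)"
      by (rule refl_onI) (auto simp: Rees_twist_def psg_sim_def)
    show "sym (Rees_twist \<C> r q N)"
      by (rule symI) (auto simp: Rees_twist_def psg_sim_def intro: twist_sym[OF N, simplified])
    show "trans (Rees_twist \<C> r q N)"
    proof (rule transI)
      fix u v w assume uv: "(u, v) \<in> Rees_twist \<C> r q N" and vw: "(v, w) \<in> Rees_twist \<C> r q N"
      \<comment> \<open>The rank of a twisted pair does not depend on \<open>r\<close>; as
        \<open>q + 1 \<le> r\<close> is not at hand, \<open>q + 1\<close> itself is taken as the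
        bound.\<close>
      have rk: "rank y = q + 1 \<and> rank z = q + 1" if "(y, z) \<in> twist \<C> (q + 1) N" for y z
        using twist_in_I_set(3,4)[OF that _, of "enat (q + 1)"] normal_sym_permutes[OF N] by simp
      show "(u, w) \<in> Rees_twist \<C> r q N"
        using uv vw rk[of u v] rk[of v w] twist_trans[OF N, where u = u and v = v and w = w]
        unfolding Rees_twist_def psg_sim_def by auto
    qed
  qed
next
  fix A B A' B' and f g :: "'a \<Rightarrow> 'a"
  assume "(mor A f B, mor A' g B') \<in> Rees_twist \<C> r q N"
  then show "A = A' \<and> B = B'" by (simp add: Rees_twist_mor)
next
  fix A B Z and f g h :: "'a \<Rightarrow> 'a"
  assume fg: "(mor A f B, mor A g B) \<in> Rees_twist \<C> r q N"
    and Z: "Z \<in> \<C>" "h ` Z \<subseteq> A" "enat (card (h ` Z)) \<le> r"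
  have mem: "mor A f B \<in> I_set \<C> r" "mor A g B \<in> I_set \<C> r"
    using fg unfolding Rees_twist_mor by blast+
  note f' = comp_left_in_I_set[OF mem(1) Z(1,2)] and g' = comp_left_in_I_set[OF mem(2) Z(1,2)]
  have eq: "mor Z (f \<circ> h) B = mor Z (g \<circ> h) B" if "mor A f B = mor A g B"
    using that Z(2) by (auto simp: mor_eq_iff)
  have tw: "(mor Z (f \<circ> h) B, mor Z (g \<circ> h) B) \<in> twist \<C> (q + 1) N \<or>
      card ((f \<circ> h) ` Z) \<le> q \<and> card ((g \<circ> h) ` Z) \<le> q"
    if "(mor A f B, mor A g B) \<in> twist \<C> (q + 1) N"
    using twist_left[OF N that Z(1) _ Z(2)] members[OF Z(1)] by auto
  have "card ((f \<circ> h) ` Z) \<le> q \<and> card ((g \<circ> h) ` Z) \<le> q \<or>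
      mor Z (f \<circ> h) B = mor Z (g \<circ> h) B \<or>
      (mor Z (f \<circ> h) B, mor Z (g \<circ> h) B) \<in> twist \<C> (q + 1) N"
    using fg eq tw le_trans[OF f'(1)] le_trans[OF g'(1)] unfolding Rees_twist_mor by blast
  then show "(mor Z (f \<circ> h) B, mor Z (g \<circ> h) B) \<in> Rees_twist \<C> r q N"
    unfolding Rees_twist_mor using f'(2) g'(2) by blast
next
  fix A B D and f g b :: "'a \<Rightarrow> 'a"
  assume fg: "(mor A f B, mor A g B) \<in> Rees_twist \<C> r q N"
    and D: "D \<in> \<C>" "b ` B \<subseteq> D" "enat (card (b ` B)) \<le> r"
  have mem: "mor A f B \<in> I_set \<C> r" "mor A g B \<in> I_set \<C> r"
    using fg unfolding Rees_twist_mor by blast+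
  note f' = comp_right_in_I_set[OF mem(1) D(1,2)] and g' = comp_right_in_I_set[OF mem(2) D(1,2)]
  have eq: "mor A (b \<circ> f) D = mor A (b \<circ> g) D" if "mor A f B = mor A g B"
    using that by (auto simp: mor_eq_iff)
  have tw: "(mor A (b \<circ> f) D, mor A (b \<circ> g) D) \<in> twist \<C> (q + 1) N \<or>
      card ((b \<circ> f) ` A) \<le> q \<and> card ((b \<circ> g) ` A) \<le> q"
    if "(mor A f B, mor A g B) \<in> twist \<C> (q + 1) N"
    using twist_right[OF N that D(1,2)] by auto
  have "card ((b \<circ> f) ` A) \<le> q \<and> card ((b \<circ> g) ` A) \<le> q \<or>
      mor A (b \<circ> f) D = mor A (b \<circ> g) D \<or>
      (mor A (b \<circ> f) D, mor A (b \<circ> g) D) \<in> twist \<C> (q + 1) N"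
    using fg eq tw le_trans[OF f'(1)] le_trans[OF g'(1)] unfolding Rees_twist_mor by blast
  then show "(mor A (b \<circ> f) D, mor A (b \<circ> g) D) \<in> Rees_twist \<C> r q N"
    unfolding Rees_twist_mor using f'(2) g'(2) by blast
qed

lemma Nabla_Cong: "Nabla (I_psg \<C> r) \<in> Cong (I_psg \<C> r)"
proof (rule Cong_I_psgI)
  show "equiv (I_set \<C> r) (Nabla (I_psg \<C> r))"
    by (auto intro!: equivI refl_onI symI transI simp: Nabla_def psg_sim_def)
next
  fix A B A' B' and f g :: "'a \<Rightarrow> 'a"
  assume "(mor A f B, mor A' g B') \<in> Nabla (I_psg \<C> r)"
  then show "A = A' \<and> B = B'" by (simp add: Nabla_mor)
next
  fix A B Z and f g h :: "'a \<Rightarrow> 'a"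
  assume fg: "(mor A f B, mor A g B) \<in> Nabla (I_psg \<C> r)" and Z: "Z \<in> \<C>" "h ` Z \<subseteq> A" "enat (card (h ` Z)) \<le> r"
  show "(mor Z (f \<circ> h) B, mor Z (g \<circ> h) B) \<in> Nabla (I_psg \<C> r)"
    using fg comp_left_in_I_set(2)[OF _ Z(1,2)] unfolding Nabla_mor by blast
next
  fix A B D and f g b :: "'a \<Rightarrow> 'a"
  assume fg: "(mor A f B, mor A g B) \<in> Nabla (I_psg \<C> r)" and D: "D \<in> \<C>" "b ` B \<subseteq> D" "enat (card (b ` B)) \<le> r"
  show "(mor A (b \<circ> f) D, mor A (b \<circ> g) D) \<in> Nabla (I_psg \<C> r)"
    using fg comp_right_in_I_set(2)[OF _ D(1,2)] unfolding Nabla_mor by blast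
qed

lemma Delta_Cong: "Delta (I_psg \<C> r) \<in> Cong (I_psg \<C> r)"
proof (rule Cong_I_psgI)
  show "equiv (I_set \<C> r) (Delta (I_psg \<C> r))"
    by (auto intro!: equivI refl_onI symI transI simp: Delta_def)
next
  fix A B A' B' and f g :: "'a \<Rightarrow> 'a"
  assume "(mor A f B, mor A' g B') \<in> Delta (I_psg \<C> r)"
  then show "A = A' \<and> B = B'" by (simp add: Delta_mor)
next
  fix A B Z and f g h :: "'a \<Rightarrow> 'a"
  assume fg: "(mor A f B, mor A g B) \<in> Delta (I_psg \<C> r)" and Z: "Z \<in> \<C>" "h ` Z \<subseteq> A" "enat (card (h ` Z)) \<le> r"
  then have "mor Z (f \<circ> h) B = mor Z (g \<circ> h) B"
    unfolding Delta_mor mor_eq_iff by auto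
  then show "(mor Z (f \<circ> h) B, mor Z (g \<circ> h) B) \<in> Delta (I_psg \<C> r)"
    using fg comp_left_in_I_set(2)[OF _ Z(1,2)] unfolding Delta_mor by blast
next
  fix A B D and f g b :: "'a \<Rightarrow> 'a"
  assume fg: "(mor A f B, mor A g B) \<in> Delta (I_psg \<C> r)" and D: "D \<in> \<C>" "b ` B \<subseteq> D" "enat (card (b ` B)) \<le> r"
  then have "mor A (b \<circ> f) D = mor A (b \<circ> g) D"
    unfolding Delta_mor mor_eq_iff by auto
  then show "(mor A (b \<circ> f) D, mor A (b \<circ> g) D) \<in> Delta (I_psg \<C> r)"
    using fg comp_right_in_I_set(2)[OF _ D(1,2)] unfolding Delta_mor by blast
qed

end

section \<open>Reading off the degree and the normal subgroup from a congruence\<close>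

context
  fixes \<C> :: "'a set set" and r :: enat and \<sigma> :: "'a morph rel"
  assumes \<sigma>: "\<sigma> \<in> Cong (I_psg \<C> r)"
begin

lemma Cong_chart_transfer:
  assumes c: "chart \<C> p A B s t" and c': "chart \<C> p A' B' s' t'" and p: "1 \<le> p" "enat p \<le> r"
    and \<pi>: "\<pi> permutes {1..p}"
    and st: "(mor A (\<lambda>a. t (s a)) B, mor A (\<lambda>a. t (\<pi> (s a))) B) \<in> \<sigma>"
  shows "(mor A' (\<lambda>a. t' (s' a)) B', mor A' (\<lambda>a. t' (\<pi> (s' a))) B') \<in> \<sigma>"
proof -
  define e where "e = inv_into A s"
  have e: "e i \<in> A" "s (e i) = i" if "i \<in> {1..p}" for i
    using that c by (auto simp: e_def chart_def inv_into_into f_inv_into_f)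
  have "{1..p} \<noteq> {}" using p(1) by simp
  then obtain b where b: "\<And>i. i \<in> {1..p} \<Longrightarrow> b (t i) = t' i" "range b \<subseteq> t' ` {1..p}"
    using extend_from_image[of t "{1..p}" t'] c unfolding chart_def by metis
  have "(\<lambda>z. e (s' z)) ` A' = e ` {1..p}" using c' by (simp add: chart_def flip: image_image)
  moreover have "card (e ` {1..p}) \<le> p" using card_image_le[of "{1..p}" e] by simp
  ultimately have h: "enat (card ((\<lambda>z. e (s' z)) ` A')) \<le> r" using enat_le_trans p(2) by metis
  have s': "s' z \<in> {1..p}" if "z \<in> A'" for z using that c' by (auto simp: chart_def)
  have "b ` B \<subseteq> B'" using b(2) c' by (auto simp: chart_def)
  then have "(mor A' (\<lambda>z. b (t (s (e (s' z))))) B', mor A' (\<lambda>z. b (t (\<pi> (s (e (s' z)))))) B') \<in> \<sigma>"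
    using h c' s' e(1) card_image_range_le[OF b(2) p(2)]
    by (intro Cong_two_sided[OF \<sigma> st]) (auto simp: chart_def)
  also have "mor A' (\<lambda>z. b (t (s (e (s' z))))) B' = mor A' (\<lambda>a. t' (s' a)) B'"
    by (rule mor_cong) (use s' e b in simp)
  also have "mor A' (\<lambda>z. b (t (\<pi> (s (e (s' z)))))) B' = mor A' (\<lambda>a. t' (\<pi> (s' a))) B'"
  proof (rule mor_cong)
    fix z assume "z \<in> A'"
    from s'[OF this] show "b (t (\<pi> (s (e (s' z))))) = t' (\<pi> (s' z))"
      using e b permutes_in_image[OF \<pi>] by metis
  qed
  finally show ?thesis .
qed

text \<open>Every closure property is the defining relation read in another chart: inverses use
  \<open>inv' \<pi> \<circ> s\<close>, products use \<open>\<rho> \<circ> s\<close>, and conjugates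
  use \<open>inv' \<rho> \<circ> s\<close> together with \<open>t \<circ> \<rho>\<close>.\<close>

lemma Cong_normal_subgroup:
  assumes c: "chart \<C> p A B s t" and p: "1 \<le> p" "enat p \<le> r"
  defines "N \<equiv> {\<pi>. \<pi> permutes {1..p} \<and> (mor A (\<lambda>a. t (s a)) B, mor A (\<lambda>a. t (\<pi> (s a))) B) \<in> \<sigma>}"
  shows "N \<lhd> sym_group p"
proof -
  interpret S: group "sym_group p" by (rule sym_group_is_group)
  have base: "mor A (\<lambda>a. t (s a)) B \<in> I_set \<C> r"
    using twist_in_I_set(1)[OF twistI[OF c, of id "{id}"], of _ _ r] p(2) permutes_id
    by simp
  have N: "(mor A (\<lambda>a. t' (s' a)) B, mor A (\<lambda>a. t' (\<pi> (s' a))) B) \<in> \<sigma>"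
    if "\<pi> \<in> N" "chart \<C> p A B s' t'" for \<pi> s' t'
    using Cong_chart_transfer[OF c that(2) p] that(1) by (simp add: N_def)
  have perm: "\<pi> permutes {1..p}" if "\<pi> \<in> N" for \<pi> using that by (simp add: N_def)
  have "subgroup N (sym_group p)"
  proof (rule S.subgroupI)
    show "N \<subseteq> carrier (sym_group p)" using perm by (auto simp: sym_group_carrier)
    have "id \<in> N" using Cong_refl[OF \<sigma> base] by (simp add: N_def permutes_id)
    then show "N \<noteq> {}" by blast
  next
    fix \<pi> assume \<pi>: "\<pi> \<in> N"
    note inv = permutes_inv[OF perm[OF \<pi>]]
    have "(mor A (\<lambda>a. t (inv' \<pi> (s a))) B, mor A (\<lambda>a. t (\<pi> (inv' \<pi> (s a)))) B) \<in> \<sigma>"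
      by (rule N[OF \<pi> chart_permute(2)[OF c inv]])
    then have "(mor A (\<lambda>a. t (s a)) B, mor A (\<lambda>a. t (inv' \<pi> (s a))) B) \<in> \<sigma>"
      unfolding permutes_inverses(1)[OF perm[OF \<pi>]] by (rule Cong_sym[OF \<sigma>])
    then show "inv\<^bsub>sym_group p\<^esub> \<pi> \<in> N"
      using inv perm[OF \<pi>] by (simp add: sym_group_carrier N_def)
  next
    fix \<pi> \<rho> assume \<pi>: "\<pi> \<in> N" and \<rho>: "\<rho> \<in> N"
    have "(mor A (\<lambda>a. t (\<rho> (s a))) B, mor A (\<lambda>a. t (\<pi> (\<rho> (s a)))) B) \<in> \<sigma>"
      by (rule N[OF \<pi> chart_permute(2)[OF c perm[OF \<rho>]]])
    then have "(mor A (\<lambda>a. t (s a)) B, mor A (\<lambda>a. t (\<pi> (\<rho> (s a)))) B) \<in> \<sigma>"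
      using Cong_trans[OF \<sigma> N[OF \<rho> c]] by blast
    then show "\<pi> \<otimes>\<^bsub>sym_group p\<^esub> \<rho> \<in> N"
      using permutes_compose[OF perm[OF \<rho>] perm[OF \<pi>]] by (simp add: sym_group_mult N_def)
  qed
  moreover have "\<rho> \<circ> \<pi> \<circ> inv' \<rho> \<in> N" if \<rho>: "\<rho> permutes {1..p}" and \<pi>: "\<pi> \<in> N" for \<rho> \<pi>
  proof -
    note inv = permutes_inv[OF \<rho>]
    have "(mor A (\<lambda>a. t (\<rho> (inv' \<rho> (s a)))) B, mor A (\<lambda>a. t (\<rho> (\<pi> (inv' \<rho> (s a))))) B) \<in> \<sigma>"
      by (rule N[OF \<pi> chart_permute(1)[OF chart_permute(2)[OF c inv] \<rho>]])
    then show ?thesis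
      using permutes_compose[OF permutes_compose[OF inv perm[OF \<pi>]] \<rho>]
      by (simp add: N_def permutes_inverses(1)[OF \<rho>] comp_assoc)
  qed
  ultimately show ?thesis
    unfolding S.normal_inv_iff by (simp add: sym_group_carrier sym_group_mult)
qed

text \<open>The degree \<open>k\<close> is the least rank that fails to collapse,
  \<open>q = k - 1\<close>, and \<open>N\<close> is read off from a single chart of degree
  \<open>k\<close>. For a related pair of distinct maps outside the collapsed part the rank is
  squeezed to \<open>k\<close>, after which the pair is a twist in some chart and is transferred to
  the fixed one.\<close>

lemma Cong_classification:
  assumes members: "\<And>A. A \<in> \<C> \<Longrightarrow> finite A \<and> A \<noteq> {}" and r2: "2 \<le> r"
    and D: "\<sigma> \<noteq> Delta (I_psg \<C> r)" and V: "\<sigma> \<noteq> Nabla (I_psg \<C> r)"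
  obtains q N where "1 \<le> q" "enat q < r" "N \<lhd> sym_group (q + 1)" "\<sigma> = Rees_twist \<C> r q N"
proof -
  have in_mor: "(u, v) \<in> \<sigma> \<Longrightarrow> \<exists>A f B g. u = mor A f B \<and> v = mor A g B" for u v
    by (rule Cong_pairE[OF \<sigma>]) blast+
  have one: "collapsed \<C> r \<sigma> 1"
  proof -
    have "Delta (I_psg \<C> r) \<subseteq> \<sigma>" using Cong_refl[OF \<sigma>] by (auto simp: Delta_def)
    then obtain w where "w \<in> \<sigma>" "w \<notin> Delta (I_psg \<C> r)" using D by blast
    then obtain u v where uv: "(u, v) \<in> \<sigma>" "(u, v) \<notin> Delta (I_psg \<C> r)" by (cases w) blast
    obtain A f B g where m: "u = mor A f B" "v = mor A g B" using in_mor[OF uv(1)] by blast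
    have "u \<in> I_set \<C> r" using equiv_type[OF Cong_equiv[OF \<sigma>]] uv(1) by blast
    then have "mor A f B \<noteq> mor A g B" using uv(2) unfolding m Delta_def Id_on_iff I_psg_simps(1) by blast
    then obtain a where "a \<in> A" "f a \<noteq> g a" by (auto simp: mor_eq_iff)
    then show ?thesis using collapsed_1_if_neq[OF members r2 \<sigma>] uv(1) m by blast
  qed
  \<comment> \<open>If every \<open>k \<le> r\<close> collapsed, \<sigma> would be the full
    relation: both maps of any pair have finite rank, also when \<open>r\<close> is
    infinite.\<close>
  have "\<exists>k. enat k \<le> r \<and> \<not> collapsed \<C> r \<sigma> k"
  proof (rule ccontr)
    assume "\<not> ?thesis"
    then have all: "\<And>k. enat k \<le> r \<Longrightarrow> collapsed \<C> r \<sigma> k" by blast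
    have "Nabla (I_psg \<C> r) \<subseteq> \<sigma>"
    proof
      fix w assume "w \<in> Nabla (I_psg \<C> r)"
      then obtain u v where uv: "w = (u, v)" "u \<in> I_set \<C> r" "v \<in> I_set \<C> r" "psg_sim (I_psg \<C> r) u v"
        by (auto simp: Nabla_def)
      obtain A f B where u: "u = mor A f B" using I_setE[OF uv(2)] by metis
      obtain A' g B' where v: "v = mor A' g B'" using I_setE[OF uv(3)] by metis
      have AB: "A' = A" "B' = B" using uv(4) u v by simp_all
      let ?k = "max (card (f ` A)) (card (g ` A))"
      have "enat ?k \<le> r" using uv(2,3) u v AB by (simp add: max_def)
      from all[OF this] show "w \<in> \<sigma>" using uv u v AB by (simp add: collapsed_def)
    qed
    moreover have "\<sigma> \<subseteq> Nabla (I_psg \<C> r)"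
    proof
      fix w assume w: "w \<in> \<sigma>"
      obtain u v where uv: "w = (u, v)" by (cases w)
      have "u \<in> I_set \<C> r" "v \<in> I_set \<C> r" using equiv_type[OF Cong_equiv[OF \<sigma>]] uv w by blast+
      moreover have "psg_sim (I_psg \<C> r) u v" using in_mor[of u v] w uv by auto
      ultimately show "w \<in> Nabla (I_psg \<C> r)" using uv by (simp add: Nabla_def)
    qed
    ultimately show False using V by blast
  qed
  define k where "k = (LEAST k. enat k \<le> r \<and> \<not> collapsed \<C> r \<sigma> k)"
  have k: "enat k \<le> r" "\<not> collapsed \<C> r \<sigma> k"
    using LeastI_ex[OF \<open>\<exists>k. enat k \<le> r \<and> \<not> collapsed \<C> r \<sigma> k\<close>] by (simp_all add: k_def)
  have below: "collapsed \<C> r \<sigma> j" if "j < k" for j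
    using not_less_Least[OF that[unfolded k_def]] enat_le_trans[of j k r] k(1) that by auto
  have k2: "2 \<le> k" using k(2) one collapsed_0[OF members] collapsed_mono by (metis not_less_eq_eq numeral_2_eq_2 One_nat_def)
  define q where "q = k - 1"
  have kq: "k = q + 1" and q1: "1 \<le> q" using k2 by (simp_all add: q_def)
  have qr: "enat q < r" using k(1) kq by (metis enat_ord_simps(2) less_add_one less_le_trans)
  have cq: "collapsed \<C> r \<sigma> q" using below kq by simp
  \<comment> \<open>If no map had rank \<open>k\<close>, the collapse of \<open>q\<close> would
    already be that of \<open>k\<close>. The map found here supplies the chart that defines
    \<open>N\<close>.\<close>
  have "\<exists>A f B. mor A f B \<in> I_set \<C> r \<and> card (f ` A) = k"
  proof (rule ccontr)
    assume not: "\<not> ?thesis"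
    have "collapsed \<C> r \<sigma> k"
      unfolding collapsed_def
    proof (intro allI impI)
      fix A B and f g :: "'a \<Rightarrow> 'a"
      assume fg: "mor A f B \<in> I_set \<C> r" "mor A g B \<in> I_set \<C> r" "card (f ` A) \<le> k" "card (g ` A) \<le> k"
      have "card (f ` A) \<noteq> k" "card (g ` A) \<noteq> k" using not fg(1,2) by blast+
      then have "card (f ` A) \<le> q" "card (g ` A) \<le> q" using fg kq by simp_all
      then show "(mor A f B, mor A g B) \<in> \<sigma>" using cq fg(1,2) by (simp add: collapsed_def)
    qed
    with k(2) show False by simp
  qed
  then obtain A0 f0 B0 where m0: "mor A0 f0 B0 \<in> I_set \<C> r" and card0: "card (f0 ` A0) = k" by blast
  have "finite A0" using m0 members by simp
  then obtain s0 t0 where "s0 ` A0 = {1..k}" "inj_on t0 {1..k}" "t0 ` {1..k} = f0 ` A0"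
    using factor_through_interval[OF _ card0] by metis
  then have c0: "chart \<C> k A0 B0 s0 t0" using m0 by (simp add: chart_def)
  define N where "N = {\<pi>. \<pi> permutes {1..k} \<and> (mor A0 (\<lambda>a. t0 (s0 a)) B0, mor A0 (\<lambda>a. t0 (\<pi> (s0 a))) B0) \<in> \<sigma>}"
  have k1: "1 \<le> k" using k2 by simp
  have N: "N \<lhd> sym_group (q + 1)"
    using Cong_normal_subgroup[OF c0 k1 k(1)] kq N_def by simp
  have twist_sub: "twist \<C> (q + 1) N \<subseteq> \<sigma>"
    using Cong_chart_transfer[OF c0 _ k1 k(1)] kq unfolding twist_def N_def by blast
  have "\<sigma> = Rees_twist \<C> r q N"
  proof
    show "Rees_twist \<C> r q N \<subseteq> \<sigma>"
    proof
      fix w assume w: "w \<in> Rees_twist \<C> r q N"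
      then obtain u v where uv: "w = (u, v)" "u \<in> I_set \<C> r" "v \<in> I_set \<C> r"
        by (auto simp: Rees_twist_def)
      obtain A f B where u: "u = mor A f B" using I_setE[OF uv(2)] by metis
      obtain A' g B' where v: "v = mor A' g B'" using I_setE[OF uv(3)] by metis
      have fg: "A' = A" "B' = B" "mor A f B \<in> I_set \<C> r" "mor A g B \<in> I_set \<C> r"
        "card (f ` A) \<le> q \<and> card (g ` A) \<le> q \<or> mor A f B = mor A g B \<or>
          (mor A f B, mor A g B) \<in> twist \<C> (q + 1) N"
        using w unfolding uv(1) u v Rees_twist_mor by blast+
      have "(mor A f B, mor A g B) \<in> \<sigma>"
        using fg(5)
      proof (elim disjE)
        assume "card (f ` A) \<le> q \<and> card (g ` A) \<le> q"
        then show ?thesis using cq fg(3,4) unfolding collapsed_def by blast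
      next
        assume "mor A f B = mor A g B"
        then show ?thesis using Cong_refl[OF \<sigma> fg(3)] by simp
      qed (use twist_sub in blast)
      then show "w \<in> \<sigma>" using uv u v fg by simp
    qed
    show "\<sigma> \<subseteq> Rees_twist \<C> r q N"
    proof
      fix w assume w: "w \<in> \<sigma>"
      obtain A f B g where m: "w = (mor A f B, mor A g B)" using in_mor w by (cases w) blast
      with w have fg: "(mor A f B, mor A g B) \<in> \<sigma>" by simp
      note gf = Cong_sym[OF \<sigma> fg]
      note mem = Cong_memD[OF \<sigma> fg]
      have finA: "finite A" using mem(1) members by blast
      have "(mor A f B, mor A g B) \<in> twist \<C> (q + 1) N"
        if neq: "mor A f B \<noteq> mor A g B" and high: "\<not> (card (f ` A) \<le> q \<and> card (g ` A) \<le> q)"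
      proof -
        have H: "f ` A = g ` A \<and> (\<forall>a\<in>A. \<forall>a'\<in>A. f a = f a' \<longleftrightarrow> g a = g a')"
        proof (cases "card (g ` A) \<le> card (f ` A)")
          case True
          then have "k \<le> card (f ` A)" using high kq by auto
          then have "\<not> collapsed \<C> r \<sigma> (card (f ` A))" using k(2) collapsed_mono by blast
          then show ?thesis using collapsed_or_H_related[OF members r2 \<sigma> fg neq True] by blast
        next
          case False
          then have "k \<le> card (g ` A)" using high kq by auto
          then have "\<not> collapsed \<C> r \<sigma> (card (g ` A))" using k(2) collapsed_mono by blast
          moreover have "card (f ` A) \<le> card (g ` A)" using False by simp
          ultimately show ?thesis
            using collapsed_or_H_related[OF members r2 \<sigma> gf neq[symmetric]] by blast
        qed
        obtain a where a: "a \<in> A" "f a \<noteq> g a" using neq by (auto simp: mor_eq_iff)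
        \<comment> \<open>The rank exceeds \<open>q\<close>, hence is at least \<open>k\<close>;
          were it larger than \<open>k\<close>, the rank \<open>k\<close> would be among those
          collapsed here.\<close>
        have "collapsed \<C> r \<sigma> (card (f ` A) - 1)"
          using collapsed_if_H_related[OF members r2 \<sigma> fg a] H by blast
        then have "\<not> k \<le> card (f ` A) - 1" using k(2) collapsed_mono by blast
        moreover have "\<not> card (f ` A) \<le> q" using high H by simp
        ultimately have card: "card (f ` A) = k" using kq by simp
        obtain s t \<pi> where st: "s ` A = {1..k}" "inj_on t {1..k}" "t ` {1..k} = f ` A" "\<pi> permutes {1..k}"
            "\<And>a. a \<in> A \<Longrightarrow> f a = t (s a)" "\<And>a. a \<in> A \<Longrightarrow> g a = t (\<pi> (s a))"
          using H_related_factor[OF finA card, of g] H by metis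
        have c: "chart \<C> k A B s t" using st mem by (simp add: chart_def)
        have "mor A f B = mor A (\<lambda>a. t (s a)) B" "mor A g B = mor A (\<lambda>a. t (\<pi> (s a))) B"
          using st(5,6) by (auto intro: mor_cong)
        then have "(mor A (\<lambda>a. t (s a)) B, mor A (\<lambda>a. t (\<pi> (s a))) B) \<in> \<sigma>" using fg by simp
        then have "\<pi> \<in> N" using Cong_chart_transfer[OF c c0 k1 k(1) st(4)] st(4) by (simp add: N_def)
        from twistI[OF c this st(5,6)] show ?thesis unfolding kq .
      qed
      then show "w \<in> Rees_twist \<C> r q N"
        unfolding m Rees_twist_mor mor_in_I_set using mem by blast
    qed
  qed
  then show ?thesis using that q1 qr N by blast
qed

end

lemma Rees_twist_chain:
  assumes N: "N \<lhd> sym_group (q + 1)" "enat q < r" and N': "N' \<lhd> sym_group (q' + 1)" "enat q' < r"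
  shows "Rees_twist \<C> r q N \<subseteq> Rees_twist \<C> r q' N' \<or> Rees_twist \<C> r q' N' \<subseteq> Rees_twist \<C> r q N"
proof -
  consider "q < q'" | "q' < q" | "q = q'" by linarith
  then show ?thesis
  proof cases
    case 1
    then show ?thesis using Rees_twist_subset[OF _ _ N(2)] normal_sym_permutes[OF N(1)] by blast
  next
    case 2
    then show ?thesis using Rees_twist_subset[OF _ _ N'(2)] normal_sym_permutes[OF N'(1)] by blast
  next
    case 3
    then have "N \<subseteq> N' \<or> N' \<subseteq> N"
      using normal_subgroups_sym_group_chain[OF N(1), of N'] N'(1) by simp
    then show ?thesis unfolding 3 using Rees_twist_mono[of N N'] Rees_twist_mono[of N' N] by blast
  qed
qed

section \<open>The minimal ideal\<close>

lemma mor_mult_const: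
  "b \<in> B \<Longrightarrow> mor A (\<lambda>_. b) B \<cdot>\<^bsub>I_psg \<C> r\<^esub> mor B (\<lambda>_. d) D = mor A (\<lambda>_. d) D"
  by (subst mor_mult_I_psg) (auto simp: comp_def)

lemma trans_cat_mult_const:
  "b \<in> B \<Longrightarrow> mor A (\<lambda>_. b) B \<cdot>\<^bsub>trans_cat \<C>\<^esub> mor B f D = mor A (\<lambda>_. f b) D"
  by (subst mor_mult_trans_cat) (auto simp: comp_def)

section \<open>The constant maps as the minimal ideal\<close>

context
  fixes \<C> :: "'a set set"
  assumes members: "\<And>A. A \<in> \<C> \<Longrightarrow> finite A \<and> A \<noteq> {}"
  notes [simp del] = mor_in_I_set
begin

lemma const_in_I_set_1 [simp]: "mor A (\<lambda>_. b) B \<in> I_set \<C> 1 \<longleftrightarrow> A \<in> \<C> \<and> B \<in> \<C> \<and> b \<in> B"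
  using members[of A] by (auto simp: mor_in_I_set image_constant_conv one_enat_def)

lemma I_set_1E:
  assumes "m \<in> I_set \<C> 1"
  obtains A b B where "m = mor A (\<lambda>_. b) B" "A \<in> \<C>" "B \<in> \<C>" "b \<in> B"
proof -
  obtain A f B where m: "m = mor A f B" "A \<in> \<C>" "B \<in> \<C>" "f ` A \<subseteq> B" "enat (card (f ` A)) \<le> 1"
    using I_setE[OF assms] by metis
  then have A: "finite A" "A \<noteq> {}" "card (f ` A) \<le> Suc 0" using members by (auto simp: one_enat_def)
  then obtain a where a: "a \<in> A" by blast
  have "\<forall>y\<in>f ` A. \<forall>y'\<in>f ` A. y = y'"
    using A(3) unfolding card_le_Suc0_iff_eq[OF finite_imageI[OF A(1)]] .
  then have "mor A f B = mor A (\<lambda>_. f a) B" using a by (intro mor_cong) blast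
  then show ?thesis using that m a by blast
qed

lemma const_eq_iff: "A \<in> \<C> \<Longrightarrow> mor A (\<lambda>_. b) B = mor A' (\<lambda>_. b') B' \<longleftrightarrow> A = A' \<and> B = B' \<and> b = b'"
  using members[of A] by (auto simp: mor_eq_iff)

lemma psg_ideal_I_set_1:
  assumes ne: "\<C> \<noteq> {}"
  shows "psg_ideal (trans_cat \<C>) (I_set \<C> 1)"
  unfolding psg_ideal_def
proof (intro conjI ballI impI)
  show "I_set \<C> 1 \<subseteq> carrier (trans_cat \<C>)" by (auto simp: I_set_def)
  from ne obtain A where "A \<in> \<C>" by blast
  moreover then obtain a where "a \<in> A" using members by blast
  ultimately have "mor A (\<lambda>_. a) A \<in> I_set \<C> 1" by simp
  then show "I_set \<C> 1 \<noteq> {}" by blast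
next
  fix m n assume m: "m \<in> I_set \<C> 1" and n: "n \<in> carrier (trans_cat \<C>)"
  obtain A b B where m': "m = mor A (\<lambda>_. b) B" "A \<in> \<C>" "B \<in> \<C>" "b \<in> B" using I_set_1E[OF m] by metis
  obtain Z f D where n': "n = mor Z f D" "Z \<in> \<C>" "D \<in> \<C>" "f ` Z \<subseteq> D" using trans_catE[OF n] by metis
  {
    assume "rg (trans_cat \<C>) n = dm (trans_cat \<C>) m"
    then have "n \<cdot>\<^bsub>trans_cat \<C>\<^esub> m = mor Z (\<lambda>_. b) B" using m' n' by (simp add: comp_def)
    then show "n \<cdot>\<^bsub>trans_cat \<C>\<^esub> m \<in> I_set \<C> 1" using m' n' by simp
  next
    assume D: "rg (trans_cat \<C>) m = dm (trans_cat \<C>) n"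
    then have "m \<cdot>\<^bsub>trans_cat \<C>\<^esub> n = mor A (\<lambda>_. f b) D"
      using m' n' trans_cat_mult_const by simp
    moreover have "f b \<in> D" using D m' n' by auto
    ultimately show "m \<cdot>\<^bsub>trans_cat \<C>\<^esub> n \<in> I_set \<C> 1" using m' n' by simp
  }
qed

text \<open>Any member of an ideal, placed between a constant map into its domain and the constant
  map to \<open>b\<close>, becomes the constant map to \<open>b\<close>; so an ideal contains all
  maps of rank 1.\<close>

lemma I_set_1_minimal:
  assumes J: "psg_ideal (trans_cat \<C>) J"
  shows "I_set \<C> 1 \<subseteq> J"
proof
  fix m assume m: "m \<in> I_set \<C> 1"
  obtain A b B where m': "m = mor A (\<lambda>_. b) B" "A \<in> \<C>" "B \<in> \<C>" "b \<in> B" using I_set_1E[OF m] by metis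
  from J obtain n where n: "n \<in> J" "n \<in> carrier (trans_cat \<C>)" by (auto simp: psg_ideal_def)
  obtain Z f D where n': "n = mor Z f D" "Z \<in> \<C>" "D \<in> \<C>" "f ` Z \<subseteq> D" using trans_catE[OF n(2)] by metis
  obtain z where z: "z \<in> Z" using n' members by blast
  let ?p = "mor A (\<lambda>_. z) Z" and ?s = "mor D (\<lambda>_. b) B"
  have left: "k \<cdot>\<^bsub>trans_cat \<C>\<^esub> l \<in> J"
    if "l \<in> J" "k \<in> carrier (trans_cat \<C>)" "rg (trans_cat \<C>) k = dm (trans_cat \<C>) l" for k l
    using J that unfolding psg_ideal_def by blast
  have right: "l \<cdot>\<^bsub>trans_cat \<C>\<^esub> k \<in> J"
    if "l \<in> J" "k \<in> carrier (trans_cat \<C>)" "rg (trans_cat \<C>) l = dm (trans_cat \<C>) k" for k l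
    using J that unfolding psg_ideal_def by blast
  have "?p \<cdot>\<^bsub>trans_cat \<C>\<^esub> n \<in> J"
    by (rule left[OF n(1)]) (use n' m' z in auto)
  moreover have "?p \<cdot>\<^bsub>trans_cat \<C>\<^esub> n = mor A (\<lambda>_. f z) D"
    using n'(1) z trans_cat_mult_const by simp
  ultimately have "mor A (\<lambda>_. f z) D \<cdot>\<^bsub>trans_cat \<C>\<^esub> ?s \<in> J"
    by (intro right) (use n' m' z in auto)
  moreover have "mor A (\<lambda>_. f z) D \<cdot>\<^bsub>trans_cat \<C>\<^esub> ?s = m"
    unfolding m'(1) by (rule trans_cat_mult_const) (use n'(4) z in blast)
  ultimately show "m \<in> J" by simp
qed

text \<open>A constant map is given by its two objects and its value. There is one equivalence of
  values per codomain, shared by all domains.\<close>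

definition const_cong :: "('a set \<Rightarrow> 'a rel) \<Rightarrow> 'a morph rel" where
  "const_cong \<epsilon> = {(mor A (\<lambda>_. b) B, mor A (\<lambda>_. b') B) | A B b b'. A \<in> \<C> \<and> B \<in> \<C> \<and> (b, b') \<in> \<epsilon> B}"

text \<open>Values are compared through the constant maps from \<open>B\<close> to itself, one
  sample domain. The restriction to \<C> places the result in the extensional product of the
  lattices.\<close>

definition value_cong :: "'a morph rel \<Rightarrow> 'a set \<Rightarrow> 'a rel" where
  "value_cong \<sigma> = (\<lambda>B\<in>\<C>. {(b, b'). (mor B (\<lambda>_. b) B, mor B (\<lambda>_. b') B) \<in> \<sigma>})"

lemma const_cong_iff:
  assumes "A \<in> \<C>"
  shows "(mor A (\<lambda>_. b) B, mor A' (\<lambda>_. b') B') \<in> const_cong \<epsilon> \<longleftrightarrow> A' = A \<and> B' = B \<and> B \<in> \<C> \<and> (b, b') \<in> \<epsilon> B"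
proof
  assume "(mor A (\<lambda>_. b) B, mor A' (\<lambda>_. b') B') \<in> const_cong \<epsilon>"
  then obtain Z D c c' where *: "mor A (\<lambda>_. b) B = mor Z (\<lambda>_. c) D" "mor A' (\<lambda>_. b') B' = mor Z (\<lambda>_. c') D"
      "Z \<in> \<C>" "D \<in> \<C>" "(c, c') \<in> \<epsilon> D"
    unfolding const_cong_def by blast
  have "A = Z \<and> B = D \<and> b = c" using *(1) unfolding const_eq_iff[OF assms] .
  moreover have "Z = A' \<and> D = B' \<and> c' = b'" using *(2)[symmetric] unfolding const_eq_iff[OF *(3)] .
  ultimately show "A' = A \<and> B' = B \<and> B \<in> \<C> \<and> (b, b') \<in> \<epsilon> B" using *(4,5) by blast
qed (use assms in \<open>auto simp: const_cong_def\<close>)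

text \<open>Left multiplication keeps the value of a constant map, and right multiplication by a map
  of rank 1 sends all values to one. So compatibility imposes nothing on the family \<epsilon>, and
  the equivalences over different objects are independent.\<close>

lemma const_cong_Cong:
  assumes \<epsilon>: "\<And>B. B \<in> \<C> \<Longrightarrow> equiv B (\<epsilon> B)"
  shows "const_cong \<epsilon> \<in> Cong (I_psg \<C> 1)"
proof -
  have mem: "b \<in> B" "b' \<in> B" if "(b, b') \<in> \<epsilon> B" "B \<in> \<C>" for b b' B
    using equiv_type[OF \<epsilon>[OF that(2)]] that(1) by auto
  have E: "\<exists>A b b' B. u = mor A (\<lambda>_. b) B \<and> v = mor A (\<lambda>_. b') B \<and> A \<in> \<C> \<and> B \<in> \<C> \<and> b \<in> B \<and> b' \<in> B \<and> (b, b') \<in> \<epsilon> B"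
    if "(u, v) \<in> const_cong \<epsilon>" for u v
  proof -
    from that obtain A B b b' where *: "u = mor A (\<lambda>_. b) B" "v = mor A (\<lambda>_. b') B" "A \<in> \<C>" "B \<in> \<C>" "(b, b') \<in> \<epsilon> B"
      unfolding const_cong_def by blast
    then show ?thesis using mem[OF *(5,4)] by blast
  qed
  have E_mor: "A' = A \<and> B' = B \<and> A \<in> \<C> \<and> B \<in> \<C> \<and>
      (\<exists>b b'. b \<in> B \<and> b' \<in> B \<and> (b, b') \<in> \<epsilon> B \<and>
        mor A f B = mor A (\<lambda>_. b) B \<and> mor A g B = mor A (\<lambda>_. b') B)"
    if fg: "(mor A f B, mor A' g B') \<in> const_cong \<epsilon>" for A B A' B' f g
  proof -
    obtain Z D c c' where *: "mor A f B = mor Z (\<lambda>_. c) D" "mor A' g B' = mor Z (\<lambda>_. c') D"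
        "Z \<in> \<C>" "D \<in> \<C>" "c \<in> D" "c' \<in> D" "(c, c') \<in> \<epsilon> D"
      using E[OF fg] by blast
    have "A = Z" "B = D" "A' = Z" "B' = D" using *(1,2) unfolding mor_eq_iff by blast+
    then show ?thesis using * by blast
  qed
  show ?thesis
  proof (rule Cong_I_psgI)
    show "equiv (I_set \<C> 1) (const_cong \<epsilon>)"
    proof (rule equivI)
      show "const_cong \<epsilon> \<subseteq> I_set \<C> 1 \<times> I_set \<C> 1"
      proof
        fix w assume w: "w \<in> const_cong \<epsilon>"
        obtain u v where uv: "w = (u, v)" by (cases w)
        from E[OF w[unfolded uv]] show "w \<in> I_set \<C> 1 \<times> I_set \<C> 1" unfolding uv by auto
      qed
      show "refl_on (I_set \<C> 1) (const_cong \<epsilon>)"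
      proof (rule refl_onI)
        fix m assume "m \<in> I_set \<C> 1"
        then obtain A b B where "m = mor A (\<lambda>_. b) B" "A \<in> \<C>" "B \<in> \<C>" "b \<in> B" by (rule I_set_1E)
        then show "(m, m) \<in> const_cong \<epsilon>"
          using \<epsilon>[of B] by (simp add: const_cong_iff equiv_def refl_on_def)
      qed
      show "sym (const_cong \<epsilon>)"
      proof (rule symI)
        fix u v assume "(u, v) \<in> const_cong \<epsilon>"
        then obtain A b b' B where "u = mor A (\<lambda>_. b) B" "v = mor A (\<lambda>_. b') B" "A \<in> \<C>" "B \<in> \<C>" "(b, b') \<in> \<epsilon> B"
          using E by blast
        then show "(v, u) \<in> const_cong \<epsilon>"
          using \<epsilon>[of B] by (auto simp: const_cong_iff equiv_def dest: symD)
      qed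
      show "trans (const_cong \<epsilon>)"
      proof (rule transI)
        fix u v w assume uv: "(u, v) \<in> const_cong \<epsilon>" and vw: "(v, w) \<in> const_cong \<epsilon>"
        obtain A b b' B where u: "u = mor A (\<lambda>_. b) B" "v = mor A (\<lambda>_. b') B" "A \<in> \<C>" "B \<in> \<C>" "(b, b') \<in> \<epsilon> B"
          using E[OF uv] by blast
        obtain A' c c' B' where w: "v = mor A' (\<lambda>_. c) B'" "w = mor A' (\<lambda>_. c') B'" "(c, c') \<in> \<epsilon> B'"
          using E[OF vw] by blast
        have eq: "A = A'" "B = B'" "b' = c"
          using trans[OF sym[OF u(2)] w(1)] unfolding const_eq_iff[OF u(3)] by blast+
        have "trans (\<epsilon> B)" using \<epsilon>[OF u(4)] by (simp add: equiv_def)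
        moreover have "(b', c') \<in> \<epsilon> B" using w(3) unfolding eq .
        ultimately have "(b, c') \<in> \<epsilon> B" using transD[OF _ u(5)] by blast
        then show "(u, w) \<in> const_cong \<epsilon>"
          unfolding u(1) w(2) const_cong_iff[OF u(3)] using eq u(4) by blast
      qed
    qed
  next
    fix A B A' B' and f g :: "'a \<Rightarrow> 'a"
    assume "(mor A f B, mor A' g B') \<in> const_cong \<epsilon>"
    from E_mor[OF this] show "A = A' \<and> B = B'" by blast
  next
    fix A B Z and f g h :: "'a \<Rightarrow> 'a"
    assume fg: "(mor A f B, mor A g B) \<in> const_cong \<epsilon>" and Z: "Z \<in> \<C>" "h ` Z \<subseteq> A" "enat (card (h ` Z)) \<le> 1"
    obtain b b' where b: "mor A f B = mor A (\<lambda>_. b) B" "mor A g B = mor A (\<lambda>_. b') B" "B \<in> \<C>" "(b, b') \<in> \<epsilon> B"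
      using E_mor[OF fg] by blast
    have "mor Z (f \<circ> h) B = mor Z (\<lambda>_. b) B" "mor Z (g \<circ> h) B = mor Z (\<lambda>_. b') B"
      using b(1,2) Z(2) by (auto simp: mor_eq_iff)
    then show "(mor Z (f \<circ> h) B, mor Z (g \<circ> h) B) \<in> const_cong \<epsilon>"
      using b Z by (simp add: const_cong_iff)
  next
    fix A B D and f g k :: "'a \<Rightarrow> 'a"
    assume fg: "(mor A f B, mor A g B) \<in> const_cong \<epsilon>" and D: "D \<in> \<C>" "k ` B \<subseteq> D" "enat (card (k ` B)) \<le> 1"
    obtain b b' where b: "mor A f B = mor A (\<lambda>_. b) B" "mor A g B = mor A (\<lambda>_. b') B" "A \<in> \<C>" "B \<in> \<C>" "b \<in> B" "b' \<in> B"
      using E_mor[OF fg] by blast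
    have finB: "finite B" using members b(4) by blast
    have "card (k ` B) \<le> Suc 0" using D(3) by (simp add: one_enat_def)
    then have "\<forall>y\<in>k ` B. \<forall>y'\<in>k ` B. y = y'"
      unfolding card_le_Suc0_iff_eq[OF finite_imageI[OF finB]] .
    then have kb: "k b' = k b" using b(5,6) by blast
    have "mor A (k \<circ> f) D = mor A (\<lambda>_. k b) D" "mor A (k \<circ> g) D = mor A (\<lambda>_. k b) D"
      using b(1,2) kb by (auto simp: mor_eq_iff)
    moreover have "k b \<in> D" using D(2) b(5) by blast
    ultimately show "(mor A (k \<circ> f) D, mor A (k \<circ> g) D) \<in> const_cong \<epsilon>"
      using b(3) D(1) \<epsilon>[OF D(1)] by (simp add: const_cong_iff equiv_def refl_on_def)
  qed
qed

section \<open>Recovering a congruence of the minimal ideal from its values\<close>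

context
  fixes \<sigma> :: "'a morph rel"
  assumes \<sigma>: "\<sigma> \<in> Cong (I_psg \<C> 1)"
begin

text \<open>Left multiplication by a constant map changes the domain and nothing else, so the
  relation between values is the same for every domain.\<close>

lemma Cong_I_1_iff:
  assumes "A \<in> \<C>" "B \<in> \<C>"
  shows "(mor A (\<lambda>_. b) B, mor A (\<lambda>_. b') B) \<in> \<sigma> \<longleftrightarrow> (b, b') \<in> value_cong \<sigma> B"
proof -
  have const: "(mor Z (\<lambda>_. b) B, mor Z (\<lambda>_. b') B) \<in> \<sigma>"
    if bb': "(mor Y (\<lambda>_. b) B, mor Y (\<lambda>_. b') B) \<in> \<sigma>" and Y: "Y \<in> \<C>" and Z: "Z \<in> \<C>" for Y Z
  proof -
    obtain y where y: "y \<in> Y" using members[OF Y] by blast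
    have "enat (card ((\<lambda>_::'a. y) ` Z)) \<le> 1"
      using members[OF Z] by (simp add: image_constant_conv one_enat_def)
    then show ?thesis
      using Cong_left[OF \<sigma> bb' Z, of "\<lambda>_. y"] y by (auto simp: comp_def)
  qed
  show ?thesis
    using const[of A B] const[of B A] assms by (auto simp: value_cong_def)
qed

lemma value_cong_equiv:
  assumes B: "B \<in> \<C>"
  shows "equiv B (value_cong \<sigma> B)"
proof (rule equivI)
  note iff = Cong_I_1_iff[OF B B, symmetric]
  show "value_cong \<sigma> B \<subseteq> B \<times> B"
  proof
    fix w assume "w \<in> value_cong \<sigma> B"
    then obtain b b' where w: "w = (b, b')" "(mor B (\<lambda>_. b) B, mor B (\<lambda>_. b') B) \<in> \<sigma>"
      using B by (auto simp: value_cong_def)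
    then have "mor B (\<lambda>_. b) B \<in> I_set \<C> 1" "mor B (\<lambda>_. b') B \<in> I_set \<C> 1"
      using equiv_type[OF Cong_equiv[OF \<sigma>]] by blast+
    then show "w \<in> B \<times> B" unfolding const_in_I_set_1 using w(1) by blast
  qed
  show "refl_on B (value_cong \<sigma> B)"
    by (rule refl_onI) (use B Cong_refl[OF \<sigma>] in \<open>simp add: iff\<close>)
  show "sym (value_cong \<sigma> B)"
    by (rule symI) (use Cong_sym[OF \<sigma>] in \<open>simp add: iff\<close>)
  show "trans (value_cong \<sigma> B)"
    by (rule transI) (use Cong_trans[OF \<sigma>] in \<open>unfold iff, blast\<close>)
qed

lemma const_cong_value_cong: "const_cong (value_cong \<sigma>) = \<sigma>"
proof
  show "const_cong (value_cong \<sigma>) \<subseteq> \<sigma>"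
    using Cong_I_1_iff unfolding const_cong_def by blast
  show "\<sigma> \<subseteq> const_cong (value_cong \<sigma>)"
  proof
    fix w assume w: "w \<in> \<sigma>"
    obtain u v where uv: "w = (u, v)" by (cases w)
    have uI: "u \<in> I_set \<C> 1" "v \<in> I_set \<C> 1" using equiv_type[OF Cong_equiv[OF \<sigma>]] w uv by blast+
    obtain A b B where u: "u = mor A (\<lambda>_. b) B" "A \<in> \<C>" "B \<in> \<C>" using I_set_1E[OF uI(1)] by metis
    obtain A' b' B' where v: "v = mor A' (\<lambda>_. b') B'" using I_set_1E[OF uI(2)] by metis
    have "A' = A" "B' = B"
      using Cong_pairE[OF \<sigma> w[unfolded uv u v]] by (metis mor_eq_iff)+
    then show "w \<in> const_cong (value_cong \<sigma>)"
      using w u v uv Cong_I_1_iff[OF u(2,3)] by (simp add: const_cong_iff)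
  qed
qed

end

lemma Cong_I_1: "Cong (I_psg \<C> 1) = const_cong ` {\<epsilon>. \<forall>B\<in>\<C>. equiv B (\<epsilon> B)}"
proof
  show "Cong (I_psg \<C> 1) \<subseteq> const_cong ` {\<epsilon>. \<forall>B\<in>\<C>. equiv B (\<epsilon> B)}"
    using const_cong_value_cong value_cong_equiv by (intro subsetI image_eqI) auto
  show "const_cong ` {\<epsilon>. \<forall>B\<in>\<C>. equiv B (\<epsilon> B)} \<subseteq> Cong (I_psg \<C> 1)"
    using const_cong_Cong by blast
qed

lemma lattice_iso_value_cong:
  "lattice_iso (Cong_lattice (I_psg \<C> 1)) (prod_lattice \<C> Eq_lattice) value_cong"
proof (rule lattice_iso_if_order_iso)
  show "lattice (prod_lattice \<C> Eq_lattice)"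
    by (intro lattice_prod_lattice lattice_Eq_lattice)
  show "eq (Cong_lattice (I_psg \<C> 1)) = (=)" by (simp add: Cong_lattice_def)
  have carr: "carrier (prod_lattice \<C> Eq_lattice) = (\<Pi>\<^sub>E B\<in>\<C>. {\<epsilon>. equiv B \<epsilon>})"
    by (simp add: prod_lattice_def Eq_lattice_def)
  have "value_cong (const_cong \<epsilon>) = \<epsilon>" if "\<epsilon> \<in> carrier (prod_lattice \<C> Eq_lattice)" for \<epsilon>
  proof
    fix B
    have "\<epsilon> \<in> extensional \<C>" using that unfolding carr by (simp add: PiE_def)
    then show "value_cong (const_cong \<epsilon>) B = \<epsilon> B"
      by (cases "B \<in> \<C>") (auto simp: value_cong_def const_cong_iff extensional_def)
  qed
  moreover have "value_cong \<sigma> \<in> (\<Pi>\<^sub>E B\<in>\<C>. {\<epsilon>. equiv B \<epsilon>})" if "\<sigma> \<in> Cong (I_psg \<C> 1)" for \<sigma>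
    using value_cong_equiv[OF that] by (auto simp: value_cong_def)
  moreover have "const_cong \<epsilon> \<in> Cong (I_psg \<C> 1)" if "\<epsilon> \<in> (\<Pi>\<^sub>E B\<in>\<C>. {\<epsilon>. equiv B \<epsilon>})" for \<epsilon>
    using that by (intro const_cong_Cong) auto
  ultimately show "bij_betw value_cong (carrier (Cong_lattice (I_psg \<C> 1))) (carrier (prod_lattice \<C> Eq_lattice))"
    using const_cong_value_cong unfolding carr
    by (intro bij_betw_byWitness[where f' = const_cong]) (auto simp: Cong_lattice_def)
  fix \<sigma> \<tau> assume "\<sigma> \<in> carrier (Cong_lattice (I_psg \<C> 1))" "\<tau> \<in> carrier (Cong_lattice (I_psg \<C> 1))"
  then have st: "\<sigma> = const_cong (value_cong \<sigma>)" "\<tau> = const_cong (value_cong \<tau>)"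
    using const_cong_value_cong by (simp_all add: Cong_lattice_def)
  have "\<sigma> \<subseteq> \<tau> \<longleftrightarrow> (\<forall>B\<in>\<C>. value_cong \<sigma> B \<subseteq> value_cong \<tau> B)"
  proof
    assume "\<sigma> \<subseteq> \<tau>"
    then show "\<forall>B\<in>\<C>. value_cong \<sigma> B \<subseteq> value_cong \<tau> B" by (auto simp: value_cong_def)
  next
    assume "\<forall>B\<in>\<C>. value_cong \<sigma> B \<subseteq> value_cong \<tau> B"
    then have "const_cong (value_cong \<sigma>) \<subseteq> const_cong (value_cong \<tau>)"
      unfolding const_cong_def by blast
    then show "\<sigma> \<subseteq> \<tau>" using st by simp
  qed
  then show "\<sigma> \<sqsubseteq>\<^bsub>Cong_lattice (I_psg \<C> 1)\<^esub> \<tau> \<longleftrightarrow>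
      value_cong \<sigma> \<sqsubseteq>\<^bsub>prod_lattice \<C> Eq_lattice\<^esub> value_cong \<tau>"
    by (simp add: Cong_lattice_def prod_lattice_def Eq_lattice_def)
qed

text \<open>A constant map depends on its domain only through the object, so the first factor of the
  band is a singleton over each object.\<close>

definition const_map_pair :: "'a morph \<Rightarrow> 'a set \<times> ('a set \<times> 'a)" where
  "const_map_pair = (\<lambda>(A, \<alpha>, B). (A, (B, \<alpha> (SOME a. a \<in> A))))"

lemma const_map_pair_mor: "A \<in> \<C> \<Longrightarrow> const_map_pair (mor A (\<lambda>_. b) B) = (A, (B, b))"
  using members[of A] by (simp add: const_map_pair_def mor_def some_in_eq)

text \<open>Members of \<C> may overlap; tagging each value with its codomain makes the second
  factors disjoint.\<close>

lemma band_data_I_1: "band_data \<C> (\<lambda>A. {A}) (\<lambda>A. {A} \<times> A)"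
  using members by (auto simp: band_data_def disjoint_family_on_def)

lemma psg_iso_const_map_pair:
  "psg_iso (I_psg \<C> 1) (partial_rect_band \<C> (\<lambda>A. {A}) (\<lambda>A. {A} \<times> A)) const_map_pair"
proof -
  let ?T = "partial_rect_band \<C> (\<lambda>A. {A}) (\<lambda>A. {A} \<times> A)"
  have carr: "carrier ?T = {(A, (B, b)). A \<in> \<C> \<and> B \<in> \<C> \<and> b \<in> B}"
    by (auto simp: partial_rect_band_def)
  have "bij_betw const_map_pair (I_set \<C> 1) (carrier ?T)"
  proof (rule bij_betwI')
    fix u v assume uv: "u \<in> I_set \<C> 1" "v \<in> I_set \<C> 1"
    obtain A b B where "u = mor A (\<lambda>_. b) B" "A \<in> \<C>" using I_set_1E[OF uv(1)] by metis
    moreover obtain A' b' B' where "v = mor A' (\<lambda>_. b') B'" "A' \<in> \<C>" using I_set_1E[OF uv(2)] by metis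
    ultimately show "const_map_pair u = const_map_pair v \<longleftrightarrow> u = v"
      by (simp add: const_map_pair_mor const_eq_iff)
  next
    fix u assume "u \<in> I_set \<C> 1"
    then show "const_map_pair u \<in> carrier ?T"
      by (elim I_set_1E) (auto simp: const_map_pair_mor carr)
  next
    fix w assume "w \<in> carrier ?T"
    then obtain A B b where "w = (A, (B, b))" "A \<in> \<C>" "B \<in> \<C>" "b \<in> B" by (auto simp: carr)
    then show "\<exists>u\<in>I_set \<C> 1. w = const_map_pair u"
      by (intro bexI[of _ "mor A (\<lambda>_. b) B"]) (simp_all add: const_map_pair_mor)
  qed
  moreover have "dm ?T (const_map_pair u) = dm (I_psg \<C> 1) u \<and> rg ?T (const_map_pair u) = rg (I_psg \<C> 1) u"
    if "u \<in> I_set \<C> 1" for u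
    using that band_dm[OF band_data_I_1] band_rg[OF band_data_I_1]
    by (elim I_set_1E) (simp add: const_map_pair_mor)
  moreover have "const_map_pair (u \<cdot>\<^bsub>I_psg \<C> 1\<^esub> v) = const_map_pair u \<cdot>\<^bsub>?T\<^esub> const_map_pair v"
    if uI: "u \<in> I_set \<C> 1" and vI: "v \<in> I_set \<C> 1" and uv: "rg (I_psg \<C> 1) u = dm (I_psg \<C> 1) v" for u v
  proof -
    obtain A b B where u: "u = mor A (\<lambda>_. b) B" "A \<in> \<C>" "B \<in> \<C>" "b \<in> B" using I_set_1E[OF uI] by metis
    obtain A' d D where v: "v = mor A' (\<lambda>_. d) D" "A' \<in> \<C>" using I_set_1E[OF vI] by metis
    have "A' = B" using uv u v by simp
    then show ?thesis
      using u v by (simp add: mor_mult_const const_map_pair_mor partial_rect_band_def del: mor_mult_I_psg)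
  qed
  ultimately show ?thesis
    by (simp add: psg_iso_def partial_rect_band_def)
qed

text \<open>An equivalence on a singleton contributes only reflexivity, so all information sits in
  \<open>E2\<close>, with the tag \<open>B\<close> stripped off.\<close>

lemma band_cong_pullback:
  assumes "\<And>A. A \<in> \<C> \<Longrightarrow> equiv {A} (E1 A) \<and> equiv ({A} \<times> A) (E2 A)"
  shows "{(\<alpha>, \<beta>). \<alpha> \<in> I_set \<C> 1 \<and> \<beta> \<in> I_set \<C> 1 \<and>
      (const_map_pair \<alpha>, const_map_pair \<beta>) \<in> band_cong \<C> (\<lambda>A. {A}) (\<lambda>A. {A} \<times> A) E1 E2} =
    const_cong (\<lambda>B. {(b, b'). ((B, b), (B, b')) \<in> E2 B})" (is "?L = ?R")
proof -
  have E1: "(A, A) \<in> E1 A" if "A \<in> \<C>" for A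
    using assms[OF that] by (auto simp: equiv_def refl_on_def)
  have E2: "b \<in> B \<and> b' \<in> B" if "((B, b), (B, b')) \<in> E2 B" "B \<in> \<C>" for B b b'
    using equiv_type[of "{B} \<times> B" "E2 B"] assms[OF that(2)] that(1) by auto
  have "(u, v) \<in> ?L \<longleftrightarrow> (u, v) \<in> ?R" for u v
  proof (cases "u \<in> I_set \<C> 1 \<and> v \<in> I_set \<C> 1")
    case True
    obtain A b B where u: "u = mor A (\<lambda>_. b) B" "A \<in> \<C>" "B \<in> \<C>" "b \<in> B" using True I_set_1E by metis
    obtain A' b' B' where v: "v = mor A' (\<lambda>_. b') B'" "A' \<in> \<C>" "B' \<in> \<C>" "b' \<in> B'" using True I_set_1E by metis
    show ?thesis
      using u v E1 E2 by (auto simp: const_cong_iff const_map_pair_mor band_cong_def)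
  next
    case False
    have "(u, v) \<notin> ?R"
    proof
      assume "(u, v) \<in> ?R"
      then obtain A B b b' where "u = mor A (\<lambda>_. b) B" "v = mor A (\<lambda>_. b') B" "A \<in> \<C>" "B \<in> \<C>"
          "((B, b), (B, b')) \<in> E2 B"
        unfolding const_cong_def by blast
      then show False using False E2 by simp
    qed
    then show ?thesis using False by blast
  qed
  then show ?thesis by auto
qed

lemma Cong_I_1_band:
  "Cong (I_psg \<C> 1) =
    {{(\<alpha>, \<beta>). \<alpha> \<in> I_set \<C> 1 \<and> \<beta> \<in> I_set \<C> 1 \<and>
      (const_map_pair \<alpha>, const_map_pair \<beta>) \<in> band_cong \<C> (\<lambda>A. {A}) (\<lambda>A. {A} \<times> A) E1 E2} | E1 E2.
      \<forall>A\<in>\<C>. equiv {A} (E1 A) \<and> equiv ({A} \<times> A) (E2 A)}" (is "_ = ?R")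
proof
  show "Cong (I_psg \<C> 1) \<subseteq> ?R"
  proof
    fix \<sigma> assume "\<sigma> \<in> Cong (I_psg \<C> 1)"
    then obtain \<epsilon> where \<epsilon>: "\<sigma> = const_cong \<epsilon>" "\<And>B. B \<in> \<C> \<Longrightarrow> equiv B (\<epsilon> B)"
      unfolding Cong_I_1 by blast
    define E1 where "E1 = (\<lambda>A::'a set. {(A, A)})"
    define E2 where "E2 = (\<lambda>B. {((B, b), (B, b')) | b b'. (b, b') \<in> \<epsilon> B})"
    have "equiv {A} (E1 A)" for A by (auto simp: E1_def equiv_def refl_on_def sym_def trans_def)
    moreover have "equiv ({B} \<times> B) (E2 B)" if B: "B \<in> \<C>" for B
    proof (rule equivI)
      have eq: "\<epsilon> B \<subseteq> B \<times> B" "refl_on B (\<epsilon> B)" "sym (\<epsilon> B)" "trans (\<epsilon> B)"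
        using \<epsilon>(2)[OF B] by (auto simp: equiv_def)
      show "E2 B \<subseteq> ({B} \<times> B) \<times> ({B} \<times> B)" using eq(1) by (auto simp: E2_def)
      show "refl_on ({B} \<times> B) (E2 B)"
        by (rule refl_onI) (use eq(2) in \<open>auto simp: E2_def dest: refl_onD\<close>)
      show "sym (E2 B)" by (rule symI) (use eq(3) in \<open>auto simp: E2_def dest: symD\<close>)
      show "trans (E2 B)" by (rule transI) (use eq(4) in \<open>auto simp: E2_def dest: transD\<close>)
    qed
    ultimately have E: "\<forall>A\<in>\<C>. equiv {A} (E1 A) \<and> equiv ({A} \<times> A) (E2 A)" by blast
    have "const_cong (\<lambda>B. {(b, b'). ((B, b), (B, b')) \<in> E2 B}) = const_cong \<epsilon>"
      by (simp add: E2_def)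
    then show "\<sigma> \<in> ?R" using band_cong_pullback[of E1 E2] E \<epsilon>(1) by blast
  qed
  show "?R \<subseteq> Cong (I_psg \<C> 1)"
  proof
    fix \<sigma> assume "\<sigma> \<in> ?R"
    then obtain E1 E2 where E: "\<forall>A\<in>\<C>. equiv {A} (E1 A) \<and> equiv ({A} \<times> A) (E2 A)"
      and \<sigma>: "\<sigma> = {(\<alpha>, \<beta>). \<alpha> \<in> I_set \<C> 1 \<and> \<beta> \<in> I_set \<C> 1 \<and>
        (const_map_pair \<alpha>, const_map_pair \<beta>) \<in> band_cong \<C> (\<lambda>A. {A}) (\<lambda>A. {A} \<times> A) E1 E2}"
      by blast
    have "\<sigma> = const_cong (\<lambda>B. {(b, b'). ((B, b), (B, b')) \<in> E2 B})"
      unfolding \<sigma> by (rule band_cong_pullback) (use E in blast)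
    moreover have "equiv B {(b, b'). ((B, b), (B, b')) \<in> E2 B}" if B: "B \<in> \<C>" for B
    proof (rule equivI)
      have eq: "E2 B \<subseteq> ({B} \<times> B) \<times> ({B} \<times> B)" "refl_on ({B} \<times> B) (E2 B)" "sym (E2 B)" "trans (E2 B)"
        using E B by (auto simp: equiv_def)
      show "{(b, b'). ((B, b), (B, b')) \<in> E2 B} \<subseteq> B \<times> B" using eq(1) by auto
      show "refl_on B {(b, b'). ((B, b), (B, b')) \<in> E2 B}"
        by (rule refl_onI) (use eq(2) in \<open>auto dest: refl_onD\<close>)
      show "sym {(b, b'). ((B, b), (B, b')) \<in> E2 B}"
        by (rule symI) (use eq(3) in \<open>auto dest: symD\<close>)
      show "trans {(b, b'). ((B, b), (B, b')) \<in> E2 B}"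
        by (rule transI) (use eq(4) in \<open>auto dest: transD\<close>)
    qed
    ultimately show "\<sigma> \<in> Cong (I_psg \<C> 1)" using const_cong_Cong by simp
  qed
qed

end

section \<open>The congruence lattices\<close>

theorem theorem5p5:
  fixes \<C> :: "'a set set"
    and X :: "nat \<Rightarrow> 'a set"
    and x :: "nat \<Rightarrow> nat \<Rightarrow> 'a"
  assumes nonempty: "\<C> \<noteq> {}"
    and members: "\<And>A. A \<in> \<C> \<Longrightarrow> finite A \<and> A \<noteq> {}"
    and choice: "\<And>q. 1 \<le> q \<Longrightarrow> enat q < xi \<C> \<Longrightarrow>
      X q \<in> \<C> \<and> q \<le> card (X q) \<and> bij_betw (x q) {1..card (X q)} (X q)"
  shows
    "(psg_ideal (trans_cat \<C>) (I_set \<C> 1) \<and>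
      (\<forall>J. psg_ideal (trans_cat \<C>) J \<longrightarrow> I_set \<C> 1 \<subseteq> J) \<and>
      (\<exists>(U :: 'a set \<Rightarrow> 'a set set) (V :: 'a set \<Rightarrow> ('a set \<times> 'a) set) \<phi>.
         band_data \<C> U V \<and>
         psg_iso (I_psg \<C> 1) (partial_rect_band \<C> U V) \<phi> \<and>
         Cong (I_psg \<C> 1) =
           {{(\<alpha>, \<beta>). \<alpha> \<in> I_set \<C> 1 \<and> \<beta> \<in> I_set \<C> 1 \<and> (\<phi> \<alpha>, \<phi> \<beta>) \<in> band_cong \<C> U V E1 E2} | E1 E2.
              \<forall>A\<in>\<C>. equiv (U A) (E1 A) \<and> equiv (V A) (E2 A)}) \<and>
      (\<exists>f. lattice_iso (Cong_lattice (I_psg \<C> 1)) (prod_lattice \<C> Eq_lattice) f)) \<and>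
     (\<forall>r::enat. (2 \<le> r \<and> r < xi \<C>) \<or> (r = \<infinity> \<and> xi \<C> = \<infinity>) \<longrightarrow>
        Cong (I_psg \<C> r) =
          {Delta (I_psg \<C> r)} \<union>
          {Rees_normal (I_psg \<C> r) (I_set \<C> (enat q))
             (natural (q + 1) (X (q + 1)) (x (q + 1)) ` N) | q N.
             1 \<le> q \<and> enat q < r \<and> N \<lhd> sym_group (q + 1)} \<union>
          {Nabla (I_psg \<C> r)} \<and>
        chain\<^sub>\<subseteq> (Cong (I_psg \<C> r)))"
proof (intro conjI allI impI)
  show "psg_ideal (trans_cat \<C>) (I_set \<C> 1)"
    by (rule psg_ideal_I_set_1[OF members nonempty])
  show "I_set \<C> 1 \<subseteq> J" if "psg_ideal (trans_cat \<C>) J" for J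
    by (rule I_set_1_minimal[OF members that])
  show "\<exists>(U :: 'a set \<Rightarrow> 'a set set) (V :: 'a set \<Rightarrow> ('a set \<times> 'a) set) \<phi>.
      band_data \<C> U V \<and> psg_iso (I_psg \<C> 1) (partial_rect_band \<C> U V) \<phi> \<and>
      Cong (I_psg \<C> 1) =
        {{(\<alpha>, \<beta>). \<alpha> \<in> I_set \<C> 1 \<and> \<beta> \<in> I_set \<C> 1 \<and> (\<phi> \<alpha>, \<phi> \<beta>) \<in> band_cong \<C> U V E1 E2} | E1 E2.
          \<forall>A\<in>\<C>. equiv (U A) (E1 A) \<and> equiv (V A) (E2 A)}"
    by (intro exI conjI) (rule band_data_I_1[OF members] psg_iso_const_map_pair[OF members]
        Cong_I_1_band[OF members]; assumption)+
  show "\<exists>f. lattice_iso (Cong_lattice (I_psg \<C> 1)) (prod_lattice \<C> Eq_lattice) f"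
    using lattice_iso_value_cong[OF members] by blast
next
  fix r :: enat assume r: "(2 \<le> r \<and> r < xi \<C>) \<or> (r = \<infinity> \<and> xi \<C> = \<infinity>)"
  then have r2: "2 \<le> r" by auto
  \<comment> \<open>From \<open>q < r\<close> follows \<open>q + 1 \<le> r\<close>, and
    \<open>q + 1\<close> lies below \<open>xi \<C>\<close> in both cases, in the infinite one
    because it is finite. So \<open>choice\<close> supplies a set of degree
    \<open>q + 1\<close>.\<close>
  have Rees: "Rees_normal (I_psg \<C> r) (I_set \<C> (enat q)) (natural (q + 1) (X (q + 1)) (x (q + 1)) ` N)
      = Rees_twist \<C> r q N" if "enat q < r" "N \<lhd> sym_group (q + 1)" for q N
  proof -
    have "enat (q + 1) \<le> r" using that(1) Suc_ile_eq[of q r] by simp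
    then have "enat (q + 1) < xi \<C>" using r by (auto intro: le_less_trans)
    then show ?thesis using Rees_normal_eq_Rees_twist[OF members that] choice[of "q + 1"] by simp
  qed
  \<comment> \<open>The classification is proved with \<open>Rees_twist\<close>, where no chosen
    sets occur, and translated afterwards; the chain property is read off from the same
    form.\<close>
  have eq: "Cong (I_psg \<C> r) = {Delta (I_psg \<C> r)} \<union>
      {Rees_twist \<C> r q N | q N. 1 \<le> q \<and> enat q < r \<and> N \<lhd> sym_group (q + 1)} \<union> {Nabla (I_psg \<C> r)}"
    (is "_ = ?R")
  proof
    show "Cong (I_psg \<C> r) \<subseteq> ?R"
    proof
      fix \<sigma> assume \<sigma>: "\<sigma> \<in> Cong (I_psg \<C> r)"
      show "\<sigma> \<in> ?R"
      proof (cases "\<sigma> = Delta (I_psg \<C> r) \<or> \<sigma> = Nabla (I_psg \<C> r)")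
        case False
        then obtain q N where "1 \<le> q" "enat q < r" "N \<lhd> sym_group (q + 1)" "\<sigma> = Rees_twist \<C> r q N"
          using Cong_classification[OF \<sigma> members r2] by blast
        then show ?thesis by blast
      qed blast
    qed
    show "?R \<subseteq> Cong (I_psg \<C> r)"
    proof
      fix \<sigma> assume "\<sigma> \<in> ?R"
      then consider "\<sigma> = Delta (I_psg \<C> r)" | "\<sigma> = Nabla (I_psg \<C> r)"
        | q N where "\<sigma> = Rees_twist \<C> r q N" "N \<lhd> sym_group (q + 1)"
        by blast
      then show "\<sigma> \<in> Cong (I_psg \<C> r)"
      proof cases
        case 1
        then show ?thesis using Delta_Cong[OF members] by simp
      next
        case 2
        then show ?thesis using Nabla_Cong[OF members] by simp
      next
        case 3
        then show ?thesis using Rees_twist_Cong[OF members] by simp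
      qed
    qed
  qed
  have "{Rees_normal (I_psg \<C> r) (I_set \<C> (enat q)) (natural (q + 1) (X (q + 1)) (x (q + 1)) ` N) | q N.
      1 \<le> q \<and> enat q < r \<and> N \<lhd> sym_group (q + 1)} =
    {Rees_twist \<C> r q N | q N. 1 \<le> q \<and> enat q < r \<and> N \<lhd> sym_group (q + 1)}"
    (is "?F = ?G")
  proof
    show "?F \<subseteq> ?G" using Rees by blast
    show "?G \<subseteq> ?F"
    proof
      fix \<sigma> assume "\<sigma> \<in> ?G"
      then obtain q N where q: "\<sigma> = Rees_twist \<C> r q N" "1 \<le> q" "enat q < r" "N \<lhd> sym_group (q + 1)" by blast
      from q(1) have "\<sigma> = Rees_normal (I_psg \<C> r) (I_set \<C> (enat q))
          (natural (q + 1) (X (q + 1)) (x (q + 1)) ` N)"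
        unfolding Rees[OF q(3,4)] .
      then show "\<sigma> \<in> ?F" using q(2-4) by blast
    qed
  qed
  with eq show "Cong (I_psg \<C> r) = {Delta (I_psg \<C> r)} \<union>
      {Rees_normal (I_psg \<C> r) (I_set \<C> (enat q)) (natural (q + 1) (X (q + 1)) (x (q + 1)) ` N) | q N.
        1 \<le> q \<and> enat q < r \<and> N \<lhd> sym_group (q + 1)} \<union> {Nabla (I_psg \<C> r)}"
    by simp
  have Delta_le: "Delta (I_psg \<C> r) \<subseteq> \<sigma>" and Nabla_ge: "\<sigma> \<subseteq> Nabla (I_psg \<C> r)"
    if "\<sigma> \<in> Cong (I_psg \<C> r)" for \<sigma>
    using that by (auto simp: Cong_def Delta_def Nabla_def equiv_def dest: refl_onD)
  show "chain\<^sub>\<subseteq> (Cong (I_psg \<C> r))"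
    unfolding chain_subset_def
  proof (intro ballI)
    fix \<sigma> \<tau> assume st: "\<sigma> \<in> Cong (I_psg \<C> r)" "\<tau> \<in> Cong (I_psg \<C> r)"
    show "\<sigma> \<subseteq> \<tau> \<or> \<tau> \<subseteq> \<sigma>"
    proof (cases "\<sigma> = Delta (I_psg \<C> r) \<or> \<sigma> = Nabla (I_psg \<C> r) \<or> \<tau> = Delta (I_psg \<C> r) \<or> \<tau> = Nabla (I_psg \<C> r)")
      case True
      then show ?thesis using Delta_le Nabla_ge st by blast
    next
      case False
      then obtain q N where q: "enat q < r" "N \<lhd> sym_group (q + 1)" "\<sigma> = Rees_twist \<C> r q N"
        using st(1) unfolding eq by blast
      from False obtain q' N' where q': "enat q' < r" "N' \<lhd> sym_group (q' + 1)" "\<tau> = Rees_twist \<C> r q' N'"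
        using st(2) unfolding eq by blast
      show ?thesis unfolding q(3) q'(3) by (rule Rees_twist_chain[OF q(2,1) q'(2,1)])
    qed
  qed
qed

end
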